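(* Let $\tau$ be a Salem number of degree $d$, and for $n\in\mathbb{N}$ let $P_n(x)=1+a_{1,n}x+\cdots+a_{d-1,n}x^{d-1}+x^d$ be the minimal polynomial of $\tau^n$ over $\mathbb{Q}$. Let $p_d$ denote the probability, when $n\in\mathbb{N}$ is randomly chosen, that the coefficients of $P_n(x)$ satisfy $$|a_{d-1,n}|>\frac{1}{2}\left(\frac{d}{d-2}\right)\left(2+\sum_{k=2}^{d-2}|a_{k,n}|\right).$$ Then: (a) $p_4=1/3$; (b) $$p_6=\frac{4}{\pi^2}\left[\int_{\arccos\frac{\sqrt{30}}{6}}^{\arccos\frac{\sqrt{19}-1}{6}}\left(\arccos\frac{-5-6\cos t}{6+6\cos t}-(\pi-t)\right)\mathrm{d}t+\int_{\arccos\frac{\sqrt{19}-1}{6}}^{\arccos\frac{\sqrt{6}}{6}}\left(\arccos\frac{1-6\cos t}{6-6\cos t}-(\pi-t)\right)\mathrm{d}t\right]=0.0717258\ldots.$$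
   Context: A Salem number is a real algebraic integer $\tau>1$ of degree at least four, conjugate to $\tau^{-1}$, all of whose conjugates other than $\tau$ and $\tau^{-1}$ lie on the unit circle $|z|=1$; if $\tau$ is a Salem number of degree $d$ then so is $\tau^n$ for every $n\in\mathbb{N}$, so $P_n$ is monic of degree $d$ with $P_n(0)=1$. The "probability that the condition holds when $n$ is randomly chosen" is understood as the natural density $\lim_{N\to\infty}\frac{1}{N}\#\{1\le n\le N : \text{the inequality holds for } P_n\}$. *)

theory Defs
  imports "HOL-Analysis.Analysis" "HOL-Computational_Algebra.Computational_Algebra"
begin

definition min_poly :: "'a :: field_char_0 \<Rightarrow> rat poly" where
  "min_poly x = (THE p. lead_coeff p = 1 \<and> irreducible p \<and> poly (map_poly of_rat p) x = 0)"

lemma ex1_min_poly: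
  fixes x :: "'a :: field_char_0"
  assumes "algebraic x"
  shows "\<exists>!p :: rat poly. lead_coeff p = 1 \<and> irreducible p \<and> poly (map_poly of_rat p) x = 0"
proof -
  define E where "E p = poly (map_poly of_rat p) x" for p :: "rat poly"
  have E_simps: "E 0 = 0" "E [:c:] = of_rat c" for c
    by (auto simp: E_def map_poly_pCons)
  have E_add: "E (p + q) = E p + E q" and E_mult: "E (p * q) = E p * E q" for p q
  proof -
    show add: "E (p + q) = E p + E q" for p q
    proof -
      have "map_poly of_rat (p + q) = map_poly of_rat p + (map_poly of_rat q :: 'a poly)"
        by (intro poly_eqI) (simp add: coeff_map_poly of_rat_add)
      thus ?thesis by (simp add: E_def)
    qed
    have smult: "E (smult c q) = of_rat c * E q" for c q
    proof -
      have "map_poly of_rat (smult c q) = smult (of_rat c) (map_poly of_rat q :: 'a poly)"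
        by (intro poly_eqI) (simp add: coeff_map_poly of_rat_mult)
      thus ?thesis by (simp add: E_def)
    qed
    have pc: "E (pCons c p) = of_rat c + x * E p" for c p
      by (simp add: E_def map_poly_pCons)
    show "E (p * q) = E p * E q"
    proof (induction p)
      case 0
      show ?case by (simp add: E_simps)
    next
      case (pCons c p)
      show ?case
        by (simp add: add smult pc pCons.IH algebra_simps)
    qed
  qed
  obtain q0 where q0: "q0 \<noteq> 0" "E q0 = 0"
  proof -
    from assms obtain q :: "'a poly" where q: "\<forall>i. coeff q i \<in> \<int>" "q \<noteq> 0" "poly q x = 0"
      by (auto simp: algebraic_def)
    define r :: "rat poly" where "r = map_poly (\<lambda>c. of_int (SOME k. c = of_int k)) q"
    have f: "of_int (SOME k. c = of_int k) = c" if "c \<in> \<int>" for c :: 'a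
      using that by (metis (mono_tags, lifting) Ints_cases someI_ex)
    have f0: "(of_int (SOME k. (0::'a) = of_int k) :: rat) = 0"
      using f[of 0] by simp
    have "map_poly of_rat r = q"
      using q(1) by (intro poly_eqI) (simp add: r_def coeff_map_poly f0 f)
    hence "E r = 0" "r \<noteq> 0" using q by (auto simp: E_def)
    thus thesis using that by blast
  qed
  define S where "S p \<longleftrightarrow> p \<noteq> 0 \<and> E p = 0" for p
  define m where "m = arg_min degree S"
  have "S q0" using q0 by (simp add: S_def)
  hence m: "S m" and m_le: "\<And>p. S p \<Longrightarrow> degree m \<le> degree p"
    unfolding m_def by (auto intro: arg_min_natI arg_min_nat_le)
  define p where "p = smult (inverse (lead_coeff m)) m"
  have m0: "m \<noteq> 0" "E m = 0" using m by (auto simp: S_def)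
  have p_eq: "p = [:inverse (lead_coeff m):] * m" by (simp add: p_def)
  have p: "lead_coeff p = 1" "E p = 0" "p \<noteq> 0" "degree p = degree m"
    using m0 E_mult[of "[:inverse (lead_coeff m):]" m] by (auto simp: p_def)
  have p_dvd: "p dvd q" if "E q = 0" for q
  proof -
    have "q = p * (q div p) + q mod p" by simp
    hence "E q = E p * E (q div p) + E (q mod p)" by (metis E_add E_mult)
    hence "E (q mod p) = 0" using that p by simp
    hence "q mod p = 0"
      using m_le[of "q mod p"] degree_mod_less[of p q] p unfolding S_def by linarith
    thus ?thesis by auto
  qed
  have unit_deg: "is_unit a \<longleftrightarrow> a \<noteq> 0 \<and> degree a = 0" for a :: "rat poly"
    by (cases "a = 0") (simp_all add: is_unit_iff_degree)
  have irr: "irreducible p"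
  proof (rule irreducibleI)
    show "p \<noteq> 0" by fact
    show "\<not> is_unit p"
    proof
      assume "is_unit p"
      then obtain c where "p = [:c:]" "c \<noteq> 0" using p by (auto simp: unit_deg elim: degree_eq_zeroE)
      thus False using p by (simp add: E_simps)
    qed
  next
    fix a b assume ab: "p = a * b"
    hence nz: "a \<noteq> 0" "b \<noteq> 0" using p by auto
    have "E a = 0 \<or> E b = 0" using ab p E_mult[of a b] by auto
    hence "degree p \<le> degree a \<or> degree p \<le> degree b"
      using m_le nz p by (auto simp: S_def)
    moreover have "degree p = degree a + degree b" using ab nz by (simp add: degree_mult_eq)
    ultimately show "is_unit a \<or> is_unit b" using nz by (auto simp: unit_deg)
  qed
  have uniq: "q = p" if q: "lead_coeff q = 1" "irreducible q" "E q = 0" for q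
  proof -
    obtain c where c: "q = p * c" using p_dvd[OF q(3)] by auto
    hence "is_unit c" using q(2) irr by (metis irreducible_def)
    then obtain k where "c = [:k:]" by (auto simp: unit_deg elim: degree_eq_zeroE)
    moreover have "lead_coeff c = 1" using c q(1) p by (simp add: lead_coeff_mult)
    ultimately show ?thesis using c by simp
  qed
  show ?thesis
    using p irr uniq by (intro ex1I[of _ p]) (auto simp: E_def)
qed

lemma min_poly:
  assumes "algebraic x"
  shows "lead_coeff (min_poly x) = 1" "irreducible (min_poly x)"
    "poly (map_poly of_rat (min_poly x)) x = 0"
  using theI'[OF ex1_min_poly[OF assms]] by (simp_all add: min_poly_def)

definition alg_degree :: "'a :: field_char_0 \<Rightarrow> nat" where
  "alg_degree x = degree (min_poly x)"

definition conjugates :: "'a :: field_char_0 \<Rightarrow> complex set" where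
  "conjugates x = {z. poly (map_poly of_rat (min_poly x)) z = 0}"

definition salem_number :: "real \<Rightarrow> bool" where
  "salem_number \<tau> \<longleftrightarrow>
     \<tau> > 1 \<and> algebraic_int \<tau> \<and> alg_degree \<tau> \<ge> 4 \<and>
     complex_of_real (inverse \<tau>) \<in> conjugates \<tau> \<and>
     (\<forall>z \<in> conjugates \<tau> - {of_real \<tau>, of_real (inverse \<tau>)}. norm z = 1)"

definition has_natural_density :: "nat set \<Rightarrow> real \<Rightarrow> bool" where
  "has_natural_density A \<delta> \<longleftrightarrow> (\<lambda>N. real (card (A \<inter> {1..N})) / real N) \<longlonglongrightarrow> \<delta>"

text \<open>The division by \<open>d - 2\<close> is in \<^typ>\<open>rat\<close>; the definition is meant for \<open>d > 2\<close>.\<close>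

definition coeff_inequality :: "nat \<Rightarrow> rat poly \<Rightarrow> bool" where
  "coeff_inequality d P \<longleftrightarrow>
     \<bar>coeff P (d - 1)\<bar> > 1 / 2 * (of_nat d / (of_nat d - 2)) * (2 + (\<Sum>k = 2..d - 2. \<bar>coeff P k\<bar>))"

text \<open>
  On both intervals the arguments of all \<^term>\<open>arccos\<close> terms lie in $[-1,1]$, and the endpoints
  are increasing (about 0.4205, 0.9766 and 1.1503), so neither integral is over an empty interval.
\<close>

definition p6_value :: real where
  "p6_value = 4 / pi\<^sup>2 *
     (integral {arccos (sqrt 30 / 6) .. arccos ((sqrt 19 - 1) / 6)}
        (\<lambda>t. arccos ((- 5 - 6 * cos t) / (6 + 6 * cos t)) - (pi - t)) +
      integral {arccos ((sqrt 19 - 1) / 6) .. arccos (sqrt 6 / 6)}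
        (\<lambda>t. arccos ((1 - 6 * cos t) / (6 - 6 * cos t)) - (pi - t)))"

end

(*
  If X, Y, Z are the values of w^n + w^(-n) at the reciprocal pairs of conjugates w of a Salem number
  of degree 6 (X belonging to tau itself), the minimal polynomial of tau^n is the product of the
  x^2 - X x + 1, x^2 - Y x + 1 and x^2 - Z x + 1. Since X tends to infinity while Y and Z are the
  doubled cosines of n times two fixed angles, the inequality becomes, up to O(1/X), a condition on
  the two cosines; in degree 4 it becomes |cos| < 1/2.

  The angles are independent of pi over the rationals: a relation between them says that a certain
  rational function of one conjugate vanishes, hence it vanishes at tau as well, where absolute values
  make this impossible. So the angles are equidistributed (Weyl sums and Stone-Weierstrass), and
  the density is the normalised area of the region where the limiting condition holds. Its
  symmetries cut this region into four congruent pieces, each bounded by t + s = pi and by the two arcs in the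
  integrals of the theorem.

  For the numerical value, arcsin (k / cos x) is enclosed between polynomials in k / cos x, whose
  antiderivatives are explicit combinations of powers of 1 / cos x and artanh (sin x); these are
  evaluated in integer fixed-point arithmetic with directed rounding.
*)

theory Submission
  imports Defs "HOL-Probability.Probability_Measure"
begin

section \<open>Conjugates of Salem numbers\<close>

text \<open>The inequality at \<open>n\<close> agrees with its limit only away from the boundary of
  the region, so the density is squeezed: the strict region has at least the claimed area, the
  non-strict region at most, and a continuous ramp absorbs the error of order \<open>1 / X\<close>.
  A relation \<open>cos (a * \<alpha>) = cos (b * \<beta>)\<close> involves two conjugates at once.
  Multiplying the corresponding difference over both pairs other than that of
  \<open>cis \<alpha>\<close> yields a rational expression in \<open>cis \<alpha>\<close> alone. Its
  counterpart at \<open>\<tau>\<close> would equate \<open>\<tau> ^ a + inverse \<tau> ^ a\<close>,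
  which exceeds 2, with a doubled cosine. In degree 6 the same independence keeps the n-th powers of
  the conjugates distinct, which makes the product of quadratics minimal. For the decimals the
  obstacle is the second arc: there the argument of the arccosine in half angles reaches about
  0.973, where its power series converges slowly. The inverse function has argument
  \<open>sin (t / 2)\<close> instead, with square at most 0.296. The enclosed angles also enclose
  \<open>pi\<close>, because the outer endpoints add up to \<open>pi / 2\<close>.\<close>

definition ev :: "rat poly \<Rightarrow> 'a :: field_char_0 \<Rightarrow> 'a" where
  "ev p z = poly (map_poly of_rat p) z"

lemma ev_0 [simp]: "ev 0 z = 0"
  and ev_1 [simp]: "ev 1 z = 1"
  and ev_pCons [simp]: "ev (pCons c p) z = of_rat c + z * ev p z"
  by (simp_all add: ev_def map_poly_pCons)

lemma ev_monom [simp]: "ev (monom c n) z = of_rat c * z ^ n"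
  by (simp add: ev_def map_poly_monom poly_monom)

lemma ev_smult [simp]: "ev (smult c p) z = of_rat c * ev p z"
  by (induction p) (simp_all add: of_rat_mult algebra_simps)

lemma ev_add [simp]: "ev (p + q) z = ev p z + ev q z"
proof (induction p arbitrary: q)
  case (pCons a p q)
  obtain b r where "q = pCons b r" by (cases q)
  thus ?case by (simp add: pCons.IH of_rat_add algebra_simps)
qed simp

lemma ev_diff [simp]: "ev (p - q) z = ev p z - ev q z"
  using ev_add[of "p - q" q z] by simp

lemma ev_mult [simp]: "ev (p * q) z = ev p z * ev q z"
  by (induction p) (simp_all add: algebra_simps)

lemma ev_power [simp]: "ev (p ^ n) z = ev p z ^ n"
  by (induction n) simp_all

lemma ev_of_real: "ev p (complex_of_real x) = of_real (ev p x)"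
proof (induction p)
  case (pCons a p)
  have "complex_of_real (of_rat a) = of_rat a"
    by (cases a) (simp add: of_rat_rat)
  with pCons show ?case by simp
qed simp

lemma ev_pcompose [simp]: "ev (p \<circ>\<^sub>p q) z = ev p (ev q z)"
  by (induction p) (simp_all add: pcompose_pCons)

lemma ev_min_poly: "algebraic x \<Longrightarrow> ev (min_poly x) x = 0"
  using min_poly(3) by (simp add: ev_def)

lemma in_conjugates_iff: "z \<in> conjugates x \<longleftrightarrow> ev (min_poly x) z = 0"
  by (simp add: conjugates_def ev_def)

text \<open>The polynomials vanishing at \<open>z\<close> form an ideal, and division with remainder
  shows that a nonzero one of least degree, \<open>m\<close>, divides them all. Irreducibility makes
  \<open>p\<close> an associate of \<open>m\<close>.\<close>

lemma irreducible_dvd_of_common_root: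
  fixes z :: "'a :: field_char_0"
  assumes "irreducible p" "ev p z = 0" "ev q z = 0"
  shows "p dvd q"
proof -
  define S where "S r \<longleftrightarrow> r \<noteq> 0 \<and> ev r z = 0" for r
  define m where "m = arg_min degree S"
  have "S p" using assms by (auto simp: S_def)
  hence "S m" and m_le: "\<And>r. S r \<Longrightarrow> degree m \<le> degree r"
    unfolding m_def by (auto intro: arg_min_natI arg_min_nat_le)
  hence m: "m \<noteq> 0" "ev m z = 0" by (auto simp: S_def)
  have m_dvd: "m dvd r" if "ev r z = 0" for r
  proof -
    have "ev (m * (r div m) + r mod m) z = 0" using that by simp
    hence "ev (r mod m) z = 0" unfolding ev_add ev_mult m by simp
    hence "r mod m = 0"
      using m_le[of "r mod m"] degree_mod_less[OF m(1), of r] unfolding S_def by linarith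
    thus ?thesis by auto
  qed
  obtain k where k: "p = m * k" using m_dvd[OF assms(2)] by auto
  have "\<not> is_unit m"
  proof
    assume "is_unit m"
    then obtain c where "m = [:c:]" using m(1) by (metis degree_eq_zeroE is_unit_iff_degree)
    thus False using m by simp
  qed
  hence "is_unit k" using assms(1) k by (metis irreducibleD)
  hence "p dvd m" using k by (simp add: mult_unit_dvd_iff)
  thus ?thesis using m_dvd[OF assms(3)] by (rule dvd_trans)
qed

text \<open>Plays the part of the Galois group: a rational equation may be moved from one conjugate
  to any other, in particular from the unit circle to \<open>\<tau>\<close>, where sizes can be
  compared.\<close>

lemma conjugates_transfer:
  assumes "algebraic x" "z \<in> conjugates x" "ev q z = 0" "w \<in> conjugates x"
  shows "ev q w = 0"
proof -
  have "min_poly x dvd q"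
    using assms irreducible_dvd_of_common_root min_poly(2) by (metis in_conjugates_iff)
  thus ?thesis using assms(4) by (auto simp: in_conjugates_iff)
qed

lemma of_real_in_conjugates: "algebraic (x :: real) \<Longrightarrow> complex_of_real x \<in> conjugates x"
  by (simp add: in_conjugates_iff ev_of_real ev_min_poly)

section \<open>Factorisation over the complex numbers and symmetric functions of the
  conjugates\<close>

lemma degree_map_of_rat [simp]: "degree (map_poly of_rat p) = degree p"
  by (rule degree_map_poly) simp

lemma pderiv_map_of_rat: "pderiv (map_poly of_rat p) = map_poly of_rat (pderiv p)"
  by (rule poly_eqI) (simp add: coeff_pderiv coeff_map_poly of_rat_mult of_rat_add)

lemma finite_conjugates: "algebraic x \<Longrightarrow> finite (conjugates x)"
  using min_poly(1)[of x] unfolding conjugates_def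
  by (intro poly_roots_finite) (auto simp: map_poly_eq_0_iff)

text \<open>A common root of \<open>min_poly x\<close> and its derivative would make the irreducible
  polynomial divide one of smaller degree, which is nonzero in characteristic 0. So all roots are
  simple.\<close>

lemma conjugates_factorization:
  assumes "algebraic x"
  shows "map_poly of_rat (min_poly x) = (\<Prod>z\<in>conjugates x. [:-z, 1:])"
    and "card (conjugates x) = alg_degree x"
proof -
  let ?P = "map_poly of_rat (min_poly x) :: complex poly"
  have irr: "irreducible (min_poly x)" and lc: "lead_coeff (min_poly x) = 1"
    using min_poly[OF assms] by auto
  have deg: "degree (min_poly x) > 0"
    using irr by (metis gr0I irreducible_def is_unit_iff_degree)
  have "rsquarefree ?P"
    unfolding rsquarefree_roots pderiv_map_of_rat
  proof safe
    fix a assume "poly ?P a = 0" "poly (map_poly of_rat (pderiv (min_poly x))) a = 0"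
    hence "min_poly x dvd pderiv (min_poly x)"
      using irreducible_dvd_of_common_root[OF irr, of a] unfolding ev_def by blast
    thus False using deg not_dvd_pderiv[of "min_poly x"] by simp
  qed
  moreover have "lead_coeff ?P = 1"
    using lc by (simp add: coeff_map_poly)
  ultimately show P: "?P = (\<Prod>z\<in>conjugates x. [:-z, 1:])"
    using complex_poly_decompose_rsquarefree[of ?P] by (simp add: conjugates_def)
  have "degree ?P = (\<Sum>z\<in>conjugates x. 1)"
    unfolding P by (subst degree_prod_eq_sum_degree) auto
  thus "card (conjugates x) = alg_degree x"
    by (simp add: alg_degree_def)
qed

text \<open>A form of Newton's identities. With \<open>P = [:-z, 1:] * Q z\<close>, comparing
  coefficients expresses \<open>z\<close> times a coefficient of \<open>Q z\<close> by the next
  lower coefficient and one of \<open>P\<close>, so the sums \<open>S m j\<close> are rational by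
  induction on \<open>m\<close>, starting from the derivative of \<open>P\<close>. The power sum is
  \<open>S m j\<close> at the top degree, where every \<open>Q z\<close> has coefficient 1.\<close>

lemma power_sum_conjugates_rational:
  assumes "algebraic x"
  shows "(\<Sum>z\<in>conjugates x. z ^ k) \<in> \<rat>"
proof -
  define R where "R = conjugates x"
  define P where "P = (map_poly of_rat (min_poly x) :: complex poly)"
  define Q where "Q z = (\<Prod>w\<in>R - {z}. [:-w, 1:])" for z
  define S where "S m j = (\<Sum>z\<in>R. z ^ m * coeff (Q z) j)" for m j
  have fin: "finite R" using finite_conjugates[OF assms] by (simp add: R_def)
  have P: "P = (\<Prod>z\<in>R. [:-z, 1:])"
    using conjugates_factorization[OF assms] by (simp add: R_def P_def)
  have rat: "coeff P j \<in> \<rat>" for j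
    by (simp add: P_def coeff_map_poly)
  have PQ: "P = [:-z, 1:] * Q z" if "z \<in> R" for z
    unfolding P Q_def using fin that by (subst prod.remove[of _ z]) auto
  have lead: "coeff (Q z) (card R - Suc 0) = 1" if "z \<in> R" for z
  proof -
    have "degree (Q z) = (\<Sum>w\<in>R - {z}. degree [:-w, 1:])"
      unfolding Q_def by (rule degree_prod_eq_sum_degree) auto
    hence "degree (Q z) = card R - 1" using that fin by simp
    moreover have "lead_coeff (Q z) = 1"
      unfolding Q_def by (simp add: lead_coeff_prod)
    ultimately show ?thesis by simp
  qed
  have p_eq: "(\<Sum>z\<in>R. z ^ m) = S m (card R - Suc 0)" for m
    unfolding S_def by (intro sum.cong) (simp_all add: lead)
  have "\<forall>j. S m j \<in> \<rat>" for m
  proof (induction m)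
    case 0
    have "pderiv P = (\<Sum>z\<in>R. Q z)"
      unfolding P Q_def by (simp add: pderiv_prod pderiv_pCons)
    hence "S 0 j = coeff (pderiv P) j" for j
      by (simp add: S_def coeff_sum)
    thus ?case using rat by (simp add: coeff_pderiv)
  next
    case (Suc m)
    have pm: "(\<Sum>z\<in>R. z ^ m) \<in> \<rat>" using Suc by (simp add: p_eq)
    show ?case
    proof
      fix j show "S (Suc m) j \<in> \<rat>"
      proof (cases j)
        case 0
        have "z ^ Suc m * coeff (Q z) 0 = - coeff P 0 * z ^ m" if "z \<in> R" for z
          using PQ[OF that] by (simp add: coeff_mult)
        hence "S (Suc m) 0 = - coeff P 0 * (\<Sum>z\<in>R. z ^ m)"
          unfolding S_def sum_distrib_left by (intro sum.cong) auto
        thus ?thesis using rat pm 0 by simp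
      next
        case (Suc i)
        have "z ^ Suc m * coeff (Q z) (Suc i) = z ^ m * coeff (Q z) i - coeff P (Suc i) * z ^ m"
          if "z \<in> R" for z
        proof -
          have "coeff P (Suc i) = coeff (Q z) i - z * coeff (Q z) (Suc i)"
            using arg_cong[OF PQ[OF that], of "\<lambda>p. coeff p (Suc i)"] by simp
          hence Pi: "coeff P (Suc i) = coeff (Q z) i - z * coeff (Q z) (Suc i)" .
          show ?thesis unfolding Pi by (simp add: algebra_simps)
        qed
        hence "S (Suc m) (Suc i) = S m i - coeff P (Suc i) * (\<Sum>z\<in>R. z ^ m)"
          unfolding S_def sum_distrib_left sum_subtractf[symmetric] by (intro sum.cong) auto
        thus ?thesis using rat pm Suc \<open>\<forall>j. S m j \<in> \<rat>\<close> by simp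
      qed
    qed
  qed
  thus ?thesis using p_eq[of k] by (simp add: R_def)
qed

text \<open>Injectivity gives \<open>min_poly (x ^ n)\<close> at least as many roots as the degree
  of \<open>F\<close>, while it divides \<open>F\<close>. Both being monic, they coincide, and
  irreducibility of \<open>F\<close> is a consequence.\<close>

lemma min_poly_power_eqI:
  fixes x :: real
  assumes algx: "algebraic x"
    and inj: "inj_on (\<lambda>z. z ^ n) (conjugates x)"
    and F: "lead_coeff F = 1" "degree F = alg_degree x" "ev F (x ^ n) = 0"
  shows "min_poly (x ^ n) = F"
proof -
  let ?M = "min_poly (x ^ n)"
  have algn: "algebraic (x ^ n)"
    using algx F by (auto intro!: algebraicI'[of "map_poly of_rat F"] simp: coeff_map_poly map_poly_eq_0_iff ev_def)
  have M: "lead_coeff ?M = 1" "irreducible ?M" "ev ?M (x ^ n) = 0"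
    using min_poly[OF algn] by (simp_all add: ev_def)
  have root: "ev ?M (z ^ n) = 0" if "z \<in> conjugates x" for z
  proof -
    have "ev (?M \<circ>\<^sub>p monom 1 n) (complex_of_real x) = 0"
      using M(3) by (simp flip: of_real_power add: ev_of_real)
    thus ?thesis
      using conjugates_transfer[OF algx of_real_in_conjugates[OF algx] _ that] by fastforce
  qed
  have "(\<lambda>z. z ^ n) ` conjugates x \<subseteq> conjugates (x ^ n)"
    using root by (auto simp: in_conjugates_iff)
  hence "card (conjugates x) \<le> card (conjugates (x ^ n))"
    using inj finite_conjugates[OF algn] by (metis card_image card_mono)
  hence deg: "degree F \<le> degree ?M"
    using conjugates_factorization(2)[OF algx] conjugates_factorization(2)[OF algn] F(2)
    by (simp add: alg_degree_def)
  obtain k where k: "F = ?M * k"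
    using irreducible_dvd_of_common_root[OF M(2,3) F(3)] by auto
  have nz: "?M \<noteq> 0" "k \<noteq> 0" using F(1) k by auto
  hence "degree k = 0" using deg k by (simp add: degree_mult_eq)
  moreover have "lead_coeff k = 1" using F(1) M(1) k by (simp add: lead_coeff_mult)
  ultimately have "k = 1" by (metis degree_0_id of_nat_1 one_poly_eq_simps(1) degree_eq_zeroE lead_coeff_pCons(2) pCons_one)
  thus ?thesis using k by simp
qed

section \<open>Salem numbers and their conjugates\<close>

lemma salem_algebraic: "salem_number \<tau> \<Longrightarrow> algebraic \<tau>"
  by (auto simp: salem_number_def intro: algebraic_int_imp_algebraic)

text \<open>A real conjugate of modulus 1 would be 1 or -1, the root of a linear rational
  polynomial, against degree at least 4; this is where \<open>Im z \<noteq> 0\<close> comes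
  from.\<close>

lemma salem_conjugates:
  assumes "salem_number \<tau>"
  shows "complex_of_real \<tau> \<in> conjugates \<tau>" "complex_of_real (inverse \<tau>) \<in> conjugates \<tau>"
    and "z \<in> conjugates \<tau> \<Longrightarrow> z \<noteq> of_real \<tau> \<Longrightarrow> z \<noteq> of_real (inverse \<tau>) \<Longrightarrow> norm z = 1 \<and> Im z \<noteq> 0"
    and "z \<in> conjugates \<tau> \<Longrightarrow> cnj z \<in> conjugates \<tau>"
proof -
  have alg: "algebraic \<tau>" using assms by (rule salem_algebraic)
  show "complex_of_real \<tau> \<in> conjugates \<tau>" using alg by (rule of_real_in_conjugates)
  show "complex_of_real (inverse \<tau>) \<in> conjugates \<tau>" using assms by (simp add: salem_number_def)
  show "cnj z \<in> conjugates \<tau>" if "z \<in> conjugates \<tau>"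
  proof -
    have "ev p (cnj z) = cnj (ev p z)" for p
    proof (induction p)
      case (pCons a p)
      have "cnj (of_rat a) = of_rat a" by (cases a) (simp add: of_rat_rat)
      with pCons show ?case by simp
    qed simp
    with that show ?thesis by (simp add: in_conjugates_iff)
  qed
  show "norm z = 1 \<and> Im z \<noteq> 0"
    if z: "z \<in> conjugates \<tau>" "z \<noteq> of_real \<tau>" "z \<noteq> of_real (inverse \<tau>)"
  proof -
    have n1: "norm z = 1" using assms z by (simp add: salem_number_def)
    moreover have "Im z \<noteq> 0"
    proof
      assume "Im z = 0"
      with n1 have "\<bar>Re z\<bar> = 1" by (simp add: cmod_eq_Re)
      with \<open>Im z = 0\<close> have "z = 1 \<or> z = -1" by (auto simp: complex_eq_iff abs_if split: if_splits)
      then obtain c where "ev [:c, 1:] z = 0"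
        using that[of] by (metis add.right_inverse ev_0 ev_pCons mult.right_neutral mult_zero_right of_rat_1 of_rat_minus add_0_right add.left_inverse)
      hence "min_poly \<tau> dvd [:c, 1:]"
        using irreducible_dvd_of_common_root min_poly(2)[OF alg] z(1) by (metis in_conjugates_iff)
      hence "alg_degree \<tau> \<le> 1"
        using dvd_imp_degree_le[of "min_poly \<tau>" "[:c, 1:]"] by (simp add: alg_degree_def)
      thus False using assms by (simp add: salem_number_def)
    qed
    ultimately show ?thesis by simp
  qed
qed

text \<open>Complex conjugation pairs the conjugates on the circle without fixed points, so one
  representative from each pair, taken in the upper half plane, describes them all. The degree
  formula turns degrees 4 and 6 into one and two such representatives.\<close>

lemma salem_upper_conjugates:
  assumes "salem_number \<tau>"
  defines "U \<equiv> {z \<in> conjugates \<tau>. Im z > 0}"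
  shows "conjugates \<tau> = {of_real \<tau>, of_real (inverse \<tau>)} \<union> U \<union> cnj ` U"
    and "alg_degree \<tau> = 2 + 2 * card U"
    and "z \<in> U \<Longrightarrow> z = cis (Arg z) \<and> sin (Arg z) > 0"
    and "finite U"
proof -
  note sc = salem_conjugates[OF assms(1)]
  have alg: "algebraic \<tau>" using assms(1) by (rule salem_algebraic)
  have tau: "\<tau> > 1" using assms(1) by (simp add: salem_number_def)
  show eq: "conjugates \<tau> = {of_real \<tau>, of_real (inverse \<tau>)} \<union> U \<union> cnj ` U"
  proof (intro equalityI subsetI)
    fix z assume z: "z \<in> conjugates \<tau>"
    show "z \<in> {of_real \<tau>, of_real (inverse \<tau>)} \<union> U \<union> cnj ` U"
    proof (cases "z = of_real \<tau> \<or> z = of_real (inverse \<tau>) \<or> Im z > 0")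
      case False
      hence "Im (cnj z) > 0" using sc(3)[of z] z by simp
      hence "cnj z \<in> U" using sc(4) z by (simp add: U_def)
      hence "z \<in> cnj ` U" by (metis complex_cnj_cnj image_eqI)
      thus ?thesis by blast
    qed (use z in \<open>auto simp: U_def\<close>)
  qed (use sc in \<open>auto simp: U_def\<close>)
  show fin: "finite U" using finite_conjugates[OF alg] by (simp add: U_def)
  have "card (cnj ` U) = card U" by (rule card_image) (simp add: inj_on_def)
  moreover have "card (U \<union> cnj ` U) = card U + card (cnj ` U)"
    using fin by (intro card_Un_disjoint) (auto simp: U_def)
  moreover have "complex_of_real \<tau> \<notin> insert (of_real (inverse \<tau>)) (U \<union> cnj ` U)"
    "complex_of_real (inverse \<tau>) \<notin> U \<union> cnj ` U"
    using tau by (auto simp: U_def complex_eq_iff field_simps)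
       (smt (verit) mult_less_cancel_left1)+
  ultimately have "card (conjugates \<tau>) = 2 + 2 * card U"
    using fin unfolding eq by (simp add: Un_assoc)
  thus "alg_degree \<tau> = 2 + 2 * card U"
    using conjugates_factorization(2)[OF alg] by simp
  show "z = cis (Arg z) \<and> sin (Arg z) > 0" if z: "z \<in> U"
  proof -
    have "z \<noteq> of_real \<tau>" "z \<noteq> of_real (inverse \<tau>)" using z by (auto simp: U_def)
    hence "norm z = 1" using sc(3)[of z] z by (simp add: U_def)
    hence "z = cis (Arg z)" by (metis cis_Arg norm_zero sgn_eq scaleR_one inverse_1 sgn_div_norm zero_neq_one)
    moreover from this have "sin (Arg z) = Im z" by (metis cis.sel(2))
    ultimately show ?thesis using z by (simp add: U_def)
  qed
qed

lemma real_of_Rats_complex: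
  assumes "complex_of_real x \<in> \<rat>"
  obtains q where "x = of_rat q"
proof -
  obtain q where "complex_of_real x = of_rat q" using assms by (elim Rats_cases)
  also have "\<dots> = complex_of_real (of_rat q)" by (cases q) (simp add: of_rat_rat)
  finally show ?thesis using that by simp
qed

text \<open>Moved to \<open>\<tau>\<close>, the equation \<open>z ^ m = 1\<close> would contradict
  \<open>\<tau> > 1\<close>. Over all \<open>m\<close> this says that \<open>\<theta>\<close> is not
  a rational multiple of \<open>pi\<close>.\<close>

lemma salem_not_root_of_unity:
  assumes "salem_number \<tau>" "cis \<theta> \<in> conjugates \<tau>" "m > 0"
  shows "cos (of_nat m * \<theta>) \<noteq> 1"
proof
  assume "cos (of_nat m * \<theta>) = 1"
  hence "cis \<theta> ^ m = 1"
    by (simp add: Complex.DeMoivre complex_eq_iff cos_one_sin_zero)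
  hence "ev (monom 1 m - 1) (cis \<theta>) = 0" by simp
  hence "ev (monom 1 m - 1) (complex_of_real \<tau>) = 0"
    using conjugates_transfer salem_algebraic salem_conjugates(1) assms by blast
  hence "\<tau> ^ m = 1" by (simp flip: of_real_power)
  moreover have "\<tau> ^ m > 1" using assms by (simp add: salem_number_def one_less_power)
  ultimately show False by simp
qed

lemma cis_add_cis_minus: "cis x + cis (- x) = of_real (2 * cos x)"
  by (simp add: complex_eq_iff)

section \<open>Minimal polynomials of powers in degree 4\<close>

lemma salem_conjugates_4:
  assumes "salem_number \<tau>" "alg_degree \<tau> = 4"
  obtains \<theta> where "conjugates \<tau> = {of_real \<tau>, of_real (inverse \<tau>), cis \<theta>, cis (- \<theta>)}"
    and "sin \<theta> > 0"
proof -
  define U where "U = {z \<in> conjugates \<tau>. Im z > 0}"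
  note U = salem_upper_conjugates[OF assms(1), folded U_def]
  have "card U = 1" using U(2) assms(2) by simp
  then obtain u where u: "U = {u}" by (auto simp: card_1_singleton_iff)
  hence "u = cis (Arg u)" "sin (Arg u) > 0" using U(3)[of u] by auto
  moreover from this have "cnj u = cis (- Arg u)" by (metis cis_cnj)
  ultimately show ?thesis using that[of "Arg u"] U(1) u by (simp add: insert_commute)
qed

text \<open>The middle coefficient of the product of the two quadratics is rational because
  \<open>X * Y\<close> is half of the difference between \<open>(X + Y)\<^sup>2\<close> and
  \<open>X\<^sup>2 + Y\<^sup>2\<close>, both of which come from power sums.\<close>

lemma min_poly_salem_power_4:
  assumes "salem_number \<tau>" "alg_degree \<tau> = 4" "n > 0"
    and R: "conjugates \<tau> = {of_real \<tau>, of_real (inverse \<tau>), cis \<theta>, cis (- \<theta>)}"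
    and "sin \<theta> > 0"
    and X: "X = \<tau> ^ n + inverse \<tau> ^ n" and Y: "Y = 2 * cos (n * \<theta>)"
  shows "\<exists>a b. min_poly (\<tau> ^ n) = [:1, - a, b, - a, 1:] \<and> of_rat a = X + Y \<and> of_rat b = X * Y + 2"
proof -
  have tau: "\<tau> > 1" and alg: "algebraic \<tau>"
    using assms(1) by (auto simp: salem_number_def salem_algebraic)
  have pw: "(\<Sum>z\<in>conjugates \<tau>. z ^ k) = of_real (\<tau> ^ k + inverse \<tau> ^ k + 2 * cos (k * \<theta>))" for k
  proof -
    have "norm (complex_of_real \<tau>) \<noteq> 1" "norm (inverse (complex_of_real \<tau>)) \<noteq> 1"
      using tau by (auto simp: norm_inverse)
    hence "of_real \<tau> \<noteq> cis x" "inverse (of_real \<tau>) \<noteq> cis x" for x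
      by (metis norm_cis)+
    moreover have "complex_of_real \<tau> \<noteq> of_real (inverse \<tau>)"
      using tau by (metis inverse_less_1_iff less_asym of_real_eq_iff order_less_trans)
    moreover have "cis \<theta> \<noteq> cis (- \<theta>)" using \<open>sin \<theta> > 0\<close> by (simp add: complex_eq_iff)
    ultimately show ?thesis
      unfolding R using cis_add_cis_minus[of "k * \<theta>"]
      by (simp add: Complex.DeMoivre algebra_simps)
  qed
  have inv: "\<tau> ^ n * inverse \<tau> ^ n = 1" using tau by (simp flip: power_mult_distrib)
  obtain p1 where p1: "X + Y = of_rat p1"
    using power_sum_conjugates_rational[OF alg, of n] pw[of n] X Y real_of_Rats_complex by metis
  obtain p2 where p2: "\<tau> ^ (2 * n) + inverse \<tau> ^ (2 * n) + 2 * cos ((2 * n) * \<theta>) = of_rat p2"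
    using power_sum_conjugates_rational[OF alg, of "2 * n"] pw[of "2 * n"] real_of_Rats_complex by metis
  \<comment> \<open>Each square exceeds the sum of the \<open>2 * n\<close>-th powers over its pair
    by twice the product of a number and its inverse, hence 4 in total.\<close>
  have "X\<^sup>2 + Y\<^sup>2 = of_rat p2 + 4"
  proof -
    have "X\<^sup>2 = \<tau> ^ (2 * n) + inverse \<tau> ^ (2 * n) + 2"
      using inv unfolding X power2_sum by (simp add: power_mult power_commutes mult.commute)
    moreover have "Y\<^sup>2 = 2 * cos ((2 * n) * \<theta>) + 2"
      using cos_double_cos[of "n * \<theta>"] by (simp add: Y power_mult_distrib mult.assoc)
    ultimately show ?thesis using p2 by simp
  qed
  hence "X * Y + 2 = (of_rat p1 ^ 2 - (of_rat p2 + 4)) / 2 + 2"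
    by (simp flip: p1 add: power2_sum)
  also have "\<dots> = of_rat ((p1\<^sup>2 - (p2 + 4)) / 2 + 2)"
    by (simp add: of_rat_add of_rat_diff of_rat_divide of_rat_power)
  finally obtain b where b: "X * Y + 2 = of_rat b" by blast
  define F where "F = [:1, - p1, b, - p1, 1:]"
  have F_real: "ev F x = (x\<^sup>2 - X * x + 1) * (x\<^sup>2 - Y * x + 1)" for x :: real
    by (simp add: F_def of_rat_minus flip: p1 b) (simp add: power2_eq_square algebra_simps)
  have "ev F (\<tau> ^ n) = 0"
  proof -
    have "(\<tau> ^ n)\<^sup>2 - X * \<tau> ^ n + 1 = 0" using inv
      by (simp add: X power2_eq_square algebra_simps)
    thus ?thesis by (simp add: F_real)
  qed
  moreover have "inj_on (\<lambda>z. z ^ n) (conjugates \<tau>)"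
  proof -
    have 1: "\<tau> ^ n > 1" "inverse \<tau> ^ n < 1" "inverse \<tau> ^ n > 0"
      using tau \<open>n > 0\<close> by (auto simp: power_less_one_iff inverse_less_1_iff)
    have a: "complex_of_real \<tau> ^ n \<noteq> of_real (inverse \<tau>) ^ n"
      using 1 by (metis less_asym of_real_eq_iff of_real_power order_less_trans)
    have "norm (complex_of_real \<tau> ^ n) \<noteq> 1" "norm (complex_of_real (inverse \<tau>) ^ n) \<noteq> 1"
      using 1 tau by (auto simp: norm_power norm_inverse)
    hence b: "complex_of_real \<tau> ^ n \<noteq> cis x" "complex_of_real (inverse \<tau>) ^ n \<noteq> cis x" for x
      by (metis norm_cis)+
    \<comment> \<open>Since \<open>cos (2 * n * \<theta>) = 1 - 2 * sin (n * \<theta>) ^ 2\<close>,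
      this keeps the n-th powers of \<open>cis \<theta>\<close> and its inverse apart.\<close>
    have "cos (of_nat (2 * n) * \<theta>) \<noteq> 1"
      using assms by (intro salem_not_root_of_unity[of \<tau>]) auto
    hence "sin (n * \<theta>) \<noteq> 0" using cos_double_sin[of "n * \<theta>"] by (auto simp: mult.assoc)
    hence c: "cis (n * \<theta>) \<noteq> cis (n * - \<theta>)" by (auto simp: complex_eq_iff)
    show ?thesis
      unfolding R inj_on_def using a b c a[symmetric] b[symmetric] c[symmetric]
      by (auto simp: Complex.DeMoivre)
  qed
  ultimately have "min_poly (\<tau> ^ n) = F"
    by (intro min_poly_power_eqI) (use alg assms in \<open>auto simp: F_def\<close>)
  thus ?thesis using p1 b by (auto simp: F_def)
qed

section \<open>Independence of the angles and minimal polynomials of powers in degree 6\<close>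

lemma salem_conjugates_6:
  assumes "salem_number \<tau>" "alg_degree \<tau> = 6"
  obtains \<alpha> \<beta> where
    "conjugates \<tau> = {of_real \<tau>, of_real (inverse \<tau>), cis \<alpha>, cis (- \<alpha>), cis \<beta>, cis (- \<beta>)}"
    and "sin \<alpha> > 0" "sin \<beta> > 0" "cis \<alpha> \<noteq> cis \<beta>"
proof -
  define U where "U = {z \<in> conjugates \<tau>. Im z > 0}"
  note U = salem_upper_conjugates[OF assms(1), folded U_def]
  have "card U = 2" using U(2) assms(2) by simp
  then obtain u v where u: "U = {u, v}" "u \<noteq> v" by (auto simp: card_2_iff)
  hence 1: "u = cis (Arg u)" "sin (Arg u) > 0" "v = cis (Arg v)" "sin (Arg v) > 0"
    using U(3)[of u] U(3)[of v] by auto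
  moreover from this have "cnj u = cis (- Arg u)" "cnj v = cis (- Arg v)" by (metis cis_cnj)+
  ultimately show ?thesis using that[of "Arg u" "Arg v"] U(1) u by (simp add: insert_commute)
qed

lemma add_inverse_power:
  fixes u w :: real
  assumes "u * w = 1"
  shows "(u + w)\<^sup>2 = u\<^sup>2 + w\<^sup>2 + 2" "(u + w) ^ 3 = u ^ 3 + w ^ 3 + 3 * (u + w)"
proof -
  show "(u + w)\<^sup>2 = u\<^sup>2 + w\<^sup>2 + 2" using assms by (simp add: power2_sum)
  have "(u + w) ^ 3 = u ^ 3 + w ^ 3 + 3 * (u * w) * (u + w)"
    by (simp add: power3_eq_cube algebra_simps)
  thus "(u + w) ^ 3 = u ^ 3 + w ^ 3 + 3 * (u + w)" by (simp add: assms)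
qed

context
  fixes \<tau> \<alpha> \<beta> :: real
  assumes salem: "salem_number \<tau>"
    and R: "conjugates \<tau> = {of_real \<tau>, of_real (inverse \<tau>), cis \<alpha>, cis (- \<alpha>), cis \<beta>, cis (- \<beta>)}"
    and sin_pos: "sin \<alpha> > 0" "sin \<beta> > 0" and neq: "cis \<alpha> \<noteq> cis \<beta>"
begin

lemma power_sum_6:
  "(\<Sum>z\<in>conjugates \<tau>. z ^ k) =
     of_real (\<tau> ^ k + inverse \<tau> ^ k + 2 * cos (k * \<alpha>) + 2 * cos (k * \<beta>))"
proof -
  have tau: "\<tau> > 1" using salem by (simp add: salem_number_def)
  have "norm (complex_of_real \<tau>) \<noteq> 1" "norm (inverse (complex_of_real \<tau>)) \<noteq> 1"
    using tau by (auto simp: norm_inverse)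
  hence "of_real \<tau> \<noteq> cis x" "inverse (of_real \<tau>) \<noteq> cis x" for x
    by (metis norm_cis)+
  moreover have "complex_of_real \<tau> \<noteq> of_real (inverse \<tau>)"
    using tau by (metis inverse_less_1_iff less_asym of_real_eq_iff)
  moreover have "cis \<alpha> \<noteq> cis (- \<alpha>)" "cis \<alpha> \<noteq> cis (- \<beta>)" "cis \<beta> \<noteq> cis (- \<alpha>)"
    "cis \<beta> \<noteq> cis (- \<beta>)" "cis (- \<alpha>) \<noteq> cis (- \<beta>)"
    using sin_pos neq by (auto simp: complex_eq_iff)
  ultimately show ?thesis
    unfolding R using cis_add_cis_minus[of "k * \<alpha>"] cis_add_cis_minus[of "k * \<beta>"] neq
    by (simp add: Complex.DeMoivre algebra_simps)
qed

text \<open>Newton's identities for three quantities, applied to the power sums with exponents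
  \<open>n\<close>, \<open>2 * n\<close> and \<open>3 * n\<close>; the square and the cube of a pair
  sum differ from the pair sums of exponents \<open>2 * n\<close> and \<open>3 * n\<close> only by
  lower ones.\<close>

lemma elementary_symmetric_rational_6:
  assumes "X = \<tau> ^ n + inverse \<tau> ^ n" "Y = 2 * cos (n * \<alpha>)" "Z = 2 * cos (n * \<beta>)"
  obtains a b c where "X + Y + Z = of_rat a" "X * Y + X * Z + Y * Z = of_rat b" "X * Y * Z = of_rat c"
proof -
  have "\<exists>q. \<tau> ^ k + inverse \<tau> ^ k + 2 * cos (k * \<alpha>) + 2 * cos (k * \<beta>) = of_rat q" for k
    using power_sum_conjugates_rational[OF salem_algebraic[OF salem], of k] power_sum_6[of k]
      real_of_Rats_complex by metis
  then obtain p where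
    p: "\<And>k. \<tau> ^ k + inverse \<tau> ^ k + 2 * cos (k * \<alpha>) + 2 * cos (k * \<beta>) = of_rat (p k)"
    by metis
  have inv: "\<tau> ^ n * inverse \<tau> ^ n = 1"
    using salem by (simp add: salem_number_def flip: power_mult_distrib)
  have X2: "X\<^sup>2 = \<tau> ^ (2 * n) + inverse \<tau> ^ (2 * n) + 2"
    and X3: "X ^ 3 = \<tau> ^ (3 * n) + inverse \<tau> ^ (3 * n) + 3 * X"
    using add_inverse_power[OF inv] unfolding assms by (simp_all flip: power_mult add: mult.commute)
  have C: "(2 * cos (n * t))\<^sup>2 = 2 * cos ((2 * n) * t) + 2"
    "(2 * cos (n * t)) ^ 3 = 2 * cos ((3 * n) * t) + 3 * (2 * cos (n * t))" for t :: real
    using cos_double_cos[of "n * t"] cos_treble_cos[of "n * t"]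
    by (simp_all add: power_mult_distrib mult.assoc)
  have s1: "X + Y + Z = of_rat (p n)" using p[of n] assms by simp
  have s2: "X\<^sup>2 + Y\<^sup>2 + Z\<^sup>2 = of_rat (p (2 * n) + 6)"
    using p[of "2 * n"] X2 C(1)[of \<alpha>] C(1)[of \<beta>] by (simp add: assms(2,3) of_rat_add)
  have s3: "X ^ 3 + Y ^ 3 + Z ^ 3 = of_rat (p (3 * n) + 3 * p n)"
    using p[of "3 * n"] s1 X3 C(2)[of \<alpha>] C(2)[of \<beta>]
    by (simp add: assms(2,3) of_rat_add of_rat_mult)
  have "X * Y + X * Z + Y * Z = ((X + Y + Z)\<^sup>2 - (X\<^sup>2 + Y\<^sup>2 + Z\<^sup>2)) / 2"
    by (simp add: power2_eq_square algebra_simps)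
  also have "\<dots> = of_rat (((p n)\<^sup>2 - (p (2 * n) + 6)) / 2)"
    unfolding s1 s2 by (simp add: of_rat_diff of_rat_divide of_rat_power)
  finally obtain b where b: "X * Y + X * Z + Y * Z = of_rat b" by blast
  \<comment> \<open>The identity \<open>p3 = e1 ^ 3 - 3 * e1 * e2 + 3 * e3\<close> between power
    sums and elementary symmetric functions, solved for \<open>e3\<close>.\<close>
  have "X * Y * Z = ((X ^ 3 + Y ^ 3 + Z ^ 3) - (X + Y + Z) ^ 3 +
      3 * (X + Y + Z) * (X * Y + X * Z + Y * Z)) / 3"
    by (simp add: power3_eq_cube algebra_simps)
  also have "\<dots> = of_rat (((p (3 * n) + 3 * p n) - p n ^ 3 + 3 * p n * b) / 3)"
    unfolding s1 s3 b by (simp add: of_rat_diff of_rat_add of_rat_mult of_rat_divide of_rat_power)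
  finally show ?thesis using s1 b that by blast
qed

text \<open>\<open>p\<close> and \<open>e\<close> are the first two elementary symmetric functions
  of the pair sums with exponent \<open>b\<close>. Together with the pair sum of one conjugate they
  give the sum and the product of the other two, hence a polynomial \<open>Q\<close> in which
  \<open>\<beta>\<close> no longer appears. At \<open>\<tau>\<close> the factors are
  \<open>X a - 2 * cos (b * \<alpha>)\<close> and \<open>X a - 2 * cos (b * \<beta>)\<close>,
  positive because \<open>X a > 2\<close>.\<close>

lemma angles_independent_aux:
  assumes "a > 0"
  shows "cos (of_nat a * \<alpha>) \<noteq> cos (of_nat b * \<beta>)"
proof
  assume eq: "cos (of_nat a * \<alpha>) = cos (of_nat b * \<beta>)"
  have tau: "\<tau> > 1" using salem by (simp add: salem_number_def)
  define X where "X k = \<tau> ^ k + inverse \<tau> ^ k" for k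
  obtain p e d where p: "X b + 2 * cos (b * \<alpha>) + 2 * cos (b * \<beta>) = of_rat p"
    and e: "X b * (2 * cos (b * \<alpha>)) + X b * (2 * cos (b * \<beta>)) +
        (2 * cos (b * \<alpha>)) * (2 * cos (b * \<beta>)) = of_rat e"
    using elementary_symmetric_rational_6[OF refl refl refl] unfolding X_def by metis
  define A B :: "rat poly" where "A = monom 1 (2 * a) + 1" and "B = monom 1 (2 * b) + 1"
  text \<open>Up to the factor \<open>z\<^sup>2\<^sup>a\<^sup>+\<^sup>2\<^sup>b\<close>, the value of \<open>Q\<close> at a conjugate \<open>z\<close> is the product of
    \<open>(z\<^sup>a + z\<^sup>-\<^sup>a) - (w\<^sup>b + w\<^sup>-\<^sup>b)\<close> over the two pairs \<open>{w, 1/w}\<close> of conjugates other than \<open>{z, 1/z}\<close>.\<close>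
  define Q where "Q = A\<^sup>2 * monom 1 (2 * b) - A * monom 1 (a + b) * (monom p b - B)
      + monom 1 (2 * a) * (monom e (2 * b) - B * (monom p b - B))"
  have ev_Q: "ev Q z = z ^ (2 * a) * z ^ (2 * b) *
      ((z ^ a + inverse z ^ a)\<^sup>2 - (z ^ a + inverse z ^ a) * (of_rat p - (z ^ b + inverse z ^ b))
       + (of_rat e - (z ^ b + inverse z ^ b) * (of_rat p - (z ^ b + inverse z ^ b))))"
    if "z \<noteq> 0" for z :: complex
  proof -
    define u v where "u = z ^ a" and "v = z ^ b"
    have "u \<noteq> 0" "v \<noteq> 0" using that by (simp_all add: u_def v_def)
    have m: "z ^ (2 * a) = u\<^sup>2" "z ^ (2 * b) = v\<^sup>2" "z ^ (a + b) = u * v" "z ^ b = v"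
      by (simp_all add: u_def v_def power_add mult.commute flip: power_mult)
    have "ev Q z = (u\<^sup>2 + 1)\<^sup>2 * v\<^sup>2 - (u\<^sup>2 + 1) * (u * v) * (of_rat p * v - (v\<^sup>2 + 1))
        + u\<^sup>2 * (of_rat e * v\<^sup>2 - (v\<^sup>2 + 1) * (of_rat p * v - (v\<^sup>2 + 1)))"
      by (simp add: Q_def A_def B_def m)
    also have "\<dots> = u\<^sup>2 * v\<^sup>2 * ((u + inverse u)\<^sup>2 - (u + inverse u) * (of_rat p - (v + inverse v))
       + (of_rat e - (v + inverse v) * (of_rat p - (v + inverse v))))"
    proof -
      have 1: "u\<^sup>2 + 1 = u * (u + inverse u)" "v\<^sup>2 + 1 = v * (v + inverse v)"
        using \<open>u \<noteq> 0\<close> \<open>v \<noteq> 0\<close> by (simp_all add: power2_eq_square algebra_simps)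
      have "(u * x)\<^sup>2 * v\<^sup>2 - u * x * (u * v) * (p * v - v * y) + u\<^sup>2 * (e * v\<^sup>2 - v * y * (p * v - v * y)) =
          u\<^sup>2 * v\<^sup>2 * (x\<^sup>2 - x * (p - y) + (e - y * (p - y)))" for x y p e :: complex
        by (simp add: power2_eq_square algebra_simps)
      thus ?thesis unfolding 1 by simp
    qed
    finally show ?thesis unfolding power_inverse m u_def[symmetric] v_def[symmetric] .
  qed
  have rat_c: "complex_of_real (of_rat q) = of_rat q" for q
    by (cases q) (simp add: of_rat_rat)
  \<comment> \<open>Here the other two pairs are those of \<open>\<tau>\<close> and
    \<open>cis \<beta>\<close>, and the factor of \<open>cis \<beta>\<close> is zero by
    \<open>eq\<close>.\<close>
  have "ev Q (cis \<alpha>) = 0"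
  proof -
    have t: "cis \<alpha> ^ k + inverse (cis \<alpha>) ^ k = of_real (2 * cos (k * \<alpha>))" for k
      using cis_add_cis_minus[of "k * \<alpha>"]
      by (simp add: Complex.DeMoivre power_inverse flip: cis_inverse)
    show ?thesis
      unfolding ev_Q[OF cis_neq_zero] t eq rat_c[symmetric] p[symmetric] e[symmetric]
      by (simp add: power2_eq_square algebra_simps)
  qed
  hence "ev Q (complex_of_real \<tau>) = 0"
    using conjugates_transfer[OF salem_algebraic[OF salem], of "cis \<alpha>" Q "of_real \<tau>"] by (simp add: R)
  moreover have "complex_of_real \<tau> ^ k + inverse (complex_of_real \<tau>) ^ k = of_real (X k)" for k
    by (simp add: X_def)
  ultimately have "complex_of_real ((X a)\<^sup>2 - X a * (of_rat p - X b) + (of_rat e - X b * (of_rat p - X b))) = 0"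
    using tau ev_Q[of "of_real \<tau>"] by (simp add: rat_c)
  hence "(X a)\<^sup>2 - X a * (of_rat p - X b) + (of_rat e - X b * (of_rat p - X b)) = 0"
    unfolding of_real_eq_0_iff .
  hence "(X a - 2 * cos (b * \<alpha>)) * (X a - 2 * cos (b * \<beta>)) = 0"
    unfolding p[symmetric] e[symmetric] by (simp add: power2_eq_square algebra_simps)
  moreover have "X a > 2"
  proof -
    have "\<tau> ^ a > 1" using tau assms by simp
    hence "(\<tau> ^ a - 1)\<^sup>2 > 0" by simp
    also have "(\<tau> ^ a - 1)\<^sup>2 = \<tau> ^ a * (X a - 2)"
      using tau by (simp add: X_def power_inverse power2_eq_square algebra_simps)
    finally show ?thesis using \<open>\<tau> ^ a > 1\<close> zero_less_mult_pos[of "\<tau> ^ a" "X a - 2"] by simp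
  qed
  ultimately show False using cos_le_one[of "b * \<alpha>"] cos_le_one[of "b * \<beta>"] by auto
qed

end

text \<open>Equality of the cosines would mean that the sum or the difference of
  \<open>a * \<alpha>\<close> and \<open>b * \<beta>\<close> is a multiple of \<open>2 * pi\<close>;
  over all \<open>a\<close> and \<open>b\<close> this is linear independence of
  \<open>\<alpha>\<close>, \<open>\<beta>\<close> and \<open>pi\<close> over the rationals.\<close>

lemma angles_independent:
  assumes "salem_number \<tau>"
    and "conjugates \<tau> = {of_real \<tau>, of_real (inverse \<tau>), cis \<alpha>, cis (- \<alpha>), cis \<beta>, cis (- \<beta>)}"
    and "sin \<alpha> > 0" "sin \<beta> > 0" "cis \<alpha> \<noteq> cis \<beta>" "a > 0 \<or> b > 0"
  shows "cos (of_nat a * \<alpha>) \<noteq> cos (of_nat b * \<beta>)"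
proof (cases "a > 0")
  case True
  thus ?thesis using angles_independent_aux assms by blast
next
  case False
  hence "cos (of_nat b * \<beta>) \<noteq> cos (of_nat a * \<alpha>)"
    using assms by (intro angles_independent_aux[of \<tau>]) auto
  thus ?thesis by simp
qed

lemma min_poly_salem_power_6:
  assumes "salem_number \<tau>" "alg_degree \<tau> = 6" "n > 0"
    and R: "conjugates \<tau> = {of_real \<tau>, of_real (inverse \<tau>), cis \<alpha>, cis (- \<alpha>), cis \<beta>, cis (- \<beta>)}"
    and sin: "sin \<alpha> > 0" "sin \<beta> > 0" and neq: "cis \<alpha> \<noteq> cis \<beta>"
    and X: "X = \<tau> ^ n + inverse \<tau> ^ n" and Y: "Y = 2 * cos (n * \<alpha>)" and Z: "Z = 2 * cos (n * \<beta>)"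
  shows "\<exists>a b c. min_poly (\<tau> ^ n) = [:1, - a, b, - c, b, - a, 1:] \<and> of_rat a = X + Y + Z \<and>
    of_rat b = X * Y + X * Z + Y * Z + 3 \<and> of_rat c = X * Y * Z + 2 * (X + Y + Z)"
proof -
  have tau: "\<tau> > 1" and alg: "algebraic \<tau>"
    using assms(1) by (auto simp: salem_number_def salem_algebraic)
  have inv: "\<tau> ^ n * inverse \<tau> ^ n = 1" using tau by (simp flip: power_mult_distrib)
  obtain a b c where abc: "X + Y + Z = of_rat a" "X * Y + X * Z + Y * Z = of_rat b" "X * Y * Z = of_rat c"
    using elementary_symmetric_rational_6[OF assms(1) R sin neq X Y Z] .
  define F where "F = [:1, - a, b + 3, - (c + 2 * a), b + 3, - a, 1:]"
  have F_real: "ev F x = (x\<^sup>2 - X * x + 1) * (x\<^sup>2 - Y * x + 1) * (x\<^sup>2 - Z * x + 1)" for x :: real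
    by (simp add: F_def of_rat_minus of_rat_add of_rat_mult of_rat_diff flip: abc)
       (simp add: power2_eq_square algebra_simps)
  have "ev F (\<tau> ^ n) = 0"
  proof -
    have "(\<tau> ^ n)\<^sup>2 - X * \<tau> ^ n + 1 = 0" using inv
      by (simp add: X power2_eq_square algebra_simps)
    thus ?thesis by (simp add: F_real)
  qed
  moreover have "inj_on (\<lambda>z. z ^ n) (conjugates \<tau>)"
  proof -
    have 1: "\<tau> ^ n > 1" "inverse \<tau> ^ n < 1" "inverse \<tau> ^ n > 0"
      using tau \<open>n > 0\<close> by (auto simp: power_less_one_iff inverse_less_1_iff)
    have a: "complex_of_real \<tau> ^ n \<noteq> of_real (inverse \<tau>) ^ n"
      using 1 by (metis less_asym of_real_eq_iff of_real_power order_less_trans)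
    have "norm (complex_of_real \<tau> ^ n) \<noteq> 1" "norm (complex_of_real (inverse \<tau>) ^ n) \<noteq> 1"
      using 1 tau by (auto simp: norm_power norm_inverse)
    hence b: "complex_of_real \<tau> ^ n \<noteq> cis x" "complex_of_real (inverse \<tau>) ^ n \<noteq> cis x" for x
      by (metis norm_cis)+
    have "cos (of_nat (2 * n) * \<alpha>) \<noteq> 1" "cos (of_nat (2 * n) * \<beta>) \<noteq> 1"
      using salem_not_root_of_unity[OF assms(1), of \<alpha> "2 * n"]
        salem_not_root_of_unity[OF assms(1), of \<beta> "2 * n"] \<open>n > 0\<close> by (simp_all add: R)
    hence "sin (n * \<alpha>) \<noteq> 0" "sin (n * \<beta>) \<noteq> 0"
      using cos_double_sin[of "n * \<alpha>"] cos_double_sin[of "n * \<beta>"] by (auto simp: mult.assoc)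
    \<comment> \<open>With equal exponents, independence separates the n-th powers of the two pairs
      on the circle.\<close>
    moreover have "cos (n * \<alpha>) \<noteq> cos (n * \<beta>)"
      using angles_independent[of \<tau> \<alpha> \<beta> n n] assms by simp
    ultimately have c: "cis (n * \<alpha>) \<noteq> cis (n * - \<alpha>)" "cis (n * \<beta>) \<noteq> cis (n * - \<beta>)"
      "cis (n * \<alpha>) \<noteq> cis (n * \<beta>)" "cis (n * \<alpha>) \<noteq> cis (n * - \<beta>)"
      "cis (n * - \<alpha>) \<noteq> cis (n * \<beta>)" "cis (n * - \<alpha>) \<noteq> cis (n * - \<beta>)"
      by (auto simp: complex_eq_iff)
    have "distinct [of_real \<tau> ^ n, of_real (inverse \<tau>) ^ n,
        cis \<alpha> ^ n, cis (- \<alpha>) ^ n, cis \<beta> ^ n, cis (- \<beta>) ^ n]"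
      using a b c by (simp add: Complex.DeMoivre del: of_real_inverse)
    hence "distinct (map (\<lambda>z. z ^ n)
        [of_real \<tau>, of_real (inverse \<tau>), cis \<alpha>, cis (- \<alpha>), cis \<beta>, cis (- \<beta>)])"
      unfolding list.map .
    hence "inj_on (\<lambda>z. z ^ n)
        (set [of_real \<tau>, of_real (inverse \<tau>), cis \<alpha>, cis (- \<alpha>), cis \<beta>, cis (- \<beta>)])"
      by (rule distinct_map[THEN iffD1, THEN conjunct2])
    thus ?thesis unfolding R list.set .
  qed
  moreover have "lead_coeff F = 1" "degree F = alg_degree \<tau>"
    by (simp_all add: F_def assms(2))
  ultimately have "min_poly (\<tau> ^ n) = F"
    using alg by (intro min_poly_power_eqI)
  moreover have "of_rat (b + 3) = X * Y + X * Z + Y * Z + 3"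
    "of_rat (c + 2 * a) = X * Y * Z + 2 * (X + Y + Z)"
    unfolding abc by (simp_all add: of_rat_add of_rat_mult)
  ultimately show ?thesis using abc(1)
    by (intro exI[of _ a] exI[of _ "b + 3"] exI[of _ "c + 2 * a"]) (simp only: F_def simp_thms)
qed

section \<open>Passage to the limit in the coefficient inequality\<close>

lemma of_rat_abs: "(of_rat \<bar>q\<bar> :: real) = \<bar>of_rat q\<bar>"
  by (simp add: abs_if of_rat_minus)

lemma coeff_inequality_of_rat:
  "coeff_inequality d P \<longleftrightarrow>
     \<bar>of_rat (coeff P (d - 1))\<bar> >
       1 / 2 * (real d / (real d - 2)) * (2 + (\<Sum>k = 2..d - 2. \<bar>of_rat (coeff P k) :: real\<bar>))"
proof -
  have "coeff_inequality d P \<longleftrightarrow>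
    (of_rat (1 / 2 * (of_nat d / (of_nat d - 2)) * (2 + (\<Sum>k = 2..d - 2. \<bar>coeff P k\<bar>))) :: real)
      < of_rat \<bar>coeff P (d - 1)\<bar>"
    unfolding coeff_inequality_def of_rat_less ..
  thus ?thesis
    unfolding of_rat_mult of_rat_divide of_rat_diff of_rat_add of_rat_sum of_rat_abs
      of_rat_1 of_rat_numeral_eq of_rat_of_nat_eq .
qed

text \<open>Each coefficient is affine in \<open>X\<close> with bounded \<open>p\<close> and
  \<open>q\<close>. This is the error made when its absolute value, divided by \<open>X\<close>, is
  replaced by the leading part.\<close>

lemma abs_affine_div_diff:
  fixes X :: real
  assumes "X > 0"
  shows "\<bar>\<bar>X * p + q\<bar> / X - \<bar>p\<bar>\<bar> \<le> \<bar>q\<bar> / X"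
proof -
  have "\<bar>\<bar>X * p + q\<bar> - \<bar>X * p\<bar>\<bar> \<le> \<bar>q\<bar>" by linarith
  hence "\<bar>\<bar>X * p + q\<bar> - \<bar>X * p\<bar>\<bar> / X \<le> \<bar>q\<bar> / X"
    using assms by (intro divide_right_mono) auto
  moreover have "\<bar>\<bar>X * p + q\<bar> - \<bar>X * p\<bar>\<bar> / X = \<bar>\<bar>X * p + q\<bar> / X - \<bar>p\<bar>\<bar>"
    using assms by (simp add: abs_mult field_simps flip: abs_div_pos)
  ultimately show ?thesis by simp
qed

lemma tendsto_0_of_le_inverse_power:
  fixes \<tau> :: real
  assumes "\<tau> > 1" and "\<And>n. \<bar>f n\<bar> \<le> C / (\<tau> ^ n + inverse \<tau> ^ n)" "C \<ge> 0"
  shows "f \<longlonglongrightarrow> 0"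
proof (rule Lim_null_comparison)
  show "\<forall>\<^sub>F n in sequentially. norm (f n) \<le> C * inverse (\<tau> ^ n)"
  proof (intro always_eventually allI)
    fix n
    have "C / (\<tau> ^ n + inverse \<tau> ^ n) \<le> C / \<tau> ^ n"
      using assms by (intro divide_left_mono) (auto intro!: add_pos_pos mult_pos_pos)
    thus "norm (f n) \<le> C * inverse (\<tau> ^ n)"
      using assms(2)[of n] by (simp add: divide_inverse)
  qed
  show "(\<lambda>n. C * inverse (\<tau> ^ n)) \<longlonglongrightarrow> 0"
    using LIMSEQ_inverse_realpow_zero[OF assms(1)] by (rule tendsto_mult_right_zero)
qed

text \<open>The inequality is recorded exactly, as the sign of \<open>r n\<close>, and only
  \<open>r n\<close> itself is compared with its limit; the effect on the sign near the boundary is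
  left to the equidistribution argument.\<close>

lemma coeff_inequality_salem_power_4:
  assumes "salem_number \<tau>" "alg_degree \<tau> = 4"
  obtains \<theta> r where "\<And>a. a > 0 \<Longrightarrow> cos (real a * \<theta>) \<noteq> 1"
    and "\<And>n. n > 0 \<Longrightarrow> coeff_inequality 4 (min_poly (\<tau> ^ n)) \<longleftrightarrow> r n < 0"
    and "(\<lambda>n. r n - (2 * \<bar>cos (real n * \<theta>)\<bar> - 1)) \<longlonglongrightarrow> 0"
proof -
  obtain \<theta> where R: "conjugates \<tau> = {of_real \<tau>, of_real (inverse \<tau>), cis \<theta>, cis (- \<theta>)}"
    and \<theta>: "sin \<theta> > 0"
    using salem_conjugates_4[OF assms] .
  have tau: "\<tau> > 1" using assms(1) by (simp add: salem_number_def)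
  define X where "X n = \<tau> ^ n + inverse \<tau> ^ n" for n
  define Y where "Y n = 2 * cos (real n * \<theta>)" for n
  have X: "X n > 0" for n using tau by (simp add: X_def add_pos_pos)
  have div_less: "a / X n < b / X n \<longleftrightarrow> a < b" for a b n
    using X[of n] by (simp add: divide_less_cancel)
  have Y: "\<bar>Y n\<bar> \<le> 2" for n by (simp add: Y_def abs_mult)
  \<comment> \<open>The right side of the inequality minus the left side, divided by
    \<open>X n\<close>; the factor \<open>1 / 2 * (d / (d - 2))\<close> is 1 for
    \<open>d = 4\<close>.\<close>
  define r where "r n = 2 / X n + \<bar>X n * Y n + 2\<bar> / X n - \<bar>X n * 1 + Y n\<bar> / X n" for n
  show ?thesis
  proof (rule that)
    show "cos (real a * \<theta>) \<noteq> 1" if "a > 0" for a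
      using salem_not_root_of_unity[OF assms(1) _ that] by (simp add: R)
    show "coeff_inequality 4 (min_poly (\<tau> ^ n)) \<longleftrightarrow> r n < 0" if n: "n > 0" for n
    proof -
      obtain a b where ab: "min_poly (\<tau> ^ n) = [:1, - a, b, - a, 1:]"
        "of_rat a = X n + Y n" "of_rat b = X n * Y n + 2"
        using min_poly_salem_power_4[OF assms n R \<theta> X_def Y_def] by blast
      have "coeff_inequality 4 (min_poly (\<tau> ^ n)) \<longleftrightarrow> 2 + \<bar>X n * Y n + 2\<bar> < \<bar>X n + Y n\<bar>"
        unfolding coeff_inequality_of_rat ab(1) ab(2)[symmetric] ab(3)[symmetric]
        by (simp add: of_rat_minus numeral_eq_Suc)
      also have "\<dots> \<longleftrightarrow> (2 + \<bar>X n * Y n + 2\<bar>) / X n < \<bar>X n + Y n\<bar> / X n"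
        by (simp only: div_less)
      also have "\<dots> \<longleftrightarrow> r n < 0" by (simp add: r_def add_divide_distrib)
      finally show ?thesis .
    qed
    show "(\<lambda>n. r n - (2 * \<bar>cos (real n * \<theta>)\<bar> - 1)) \<longlonglongrightarrow> 0"
    \<comment> \<open>The error has the numerators 2, 2 and \<open>\<bar>Y n\<bar>\<close>, the last
      at most 2.\<close>
    proof (rule tendsto_0_of_le_inverse_power[OF tau, where C = 6])
      fix n
      have "\<bar>r n - (\<bar>Y n\<bar> - \<bar>1\<bar>)\<bar> \<le> 2 / X n + \<bar>2\<bar> / X n + \<bar>Y n\<bar> / X n"
      proof -
        have lin: "\<bar>t + A - C - (A' - C')\<bar> \<le> t + u + w"
          if "t \<ge> 0" "\<bar>A - A'\<bar> \<le> u" "\<bar>C - C'\<bar> \<le> w" for A A' C C' t u w :: real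
          using that by linarith
        show ?thesis unfolding r_def
          by (intro lin abs_affine_div_diff X) (use X[of n] in simp)
      qed
      also have "\<dots> \<le> 6 / X n"
        using Y[of n] X[of n] by (simp add: divide_right_mono flip: add_divide_distrib)
      finally show "\<bar>r n - (2 * \<bar>cos (real n * \<theta>)\<bar> - 1)\<bar> \<le> 6 / (\<tau> ^ n + inverse \<tau> ^ n)"
        by (simp add: X_def Y_def abs_mult)
    qed simp
  qed
qed

lemma coeff_inequality_salem_power_6:
  assumes "salem_number \<tau>" "alg_degree \<tau> = 6"
  obtains \<alpha> \<beta> r where "\<And>a b. a > 0 \<or> b > 0 \<Longrightarrow> cos (real a * \<alpha>) \<noteq> cos (real b * \<beta>)"
    and "\<And>n. n > 0 \<Longrightarrow> coeff_inequality 6 (min_poly (\<tau> ^ n)) \<longleftrightarrow> r n < 0"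
    and "(\<lambda>n. r n - (3 * \<bar>cos (real n * \<alpha>) + cos (real n * \<beta>)\<bar> +
      3 / 2 * \<bar>1 + 2 * cos (real n * \<alpha>) * cos (real n * \<beta>)\<bar> - 1)) \<longlonglongrightarrow> 0"
proof -
  obtain \<alpha> \<beta> where
    R: "conjugates \<tau> = {of_real \<tau>, of_real (inverse \<tau>), cis \<alpha>, cis (- \<alpha>), cis \<beta>, cis (- \<beta>)}"
    and sin: "sin \<alpha> > 0" "sin \<beta> > 0" and neq: "cis \<alpha> \<noteq> cis \<beta>"
    using salem_conjugates_6[OF assms] .
  have tau: "\<tau> > 1" using assms(1) by (simp add: salem_number_def)
  define X where "X n = \<tau> ^ n + inverse \<tau> ^ n" for n
  define Y where "Y n = 2 * cos (real n * \<alpha>)" for n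
  define Z where "Z n = 2 * cos (real n * \<beta>)" for n
  have X: "X n > 0" for n using tau by (simp add: X_def add_pos_pos)
  have div_less: "a / X n < b / X n \<longleftrightarrow> a < b" for a b n
    using X[of n] by (simp add: divide_less_cancel)
  have Y: "\<bar>Y n\<bar> \<le> 2" and Z: "\<bar>Z n\<bar> \<le> 2" for n by (simp_all add: Y_def Z_def abs_mult)
  have YZ: "\<bar>Y n * Z n\<bar> \<le> 4" for n
    using mult_mono[OF Y[of n] Z[of n]] by (simp add: abs_mult)
  \<comment> \<open>For \<open>d = 6\<close> the factor is \<open>3 / 4\<close>; the polynomial
    being palindromic, the coefficient \<open>b\<close> occurs twice in the sum and \<open>c\<close>
    once.\<close>
  define r where "r n = 3 / 4 * (2 / X n + 2 * (\<bar>X n * (Y n + Z n) + (Y n * Z n + 3)\<bar> / X n)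
      + \<bar>X n * (Y n * Z n + 2) + 2 * (Y n + Z n)\<bar> / X n) - \<bar>X n * 1 + (Y n + Z n)\<bar> / X n" for n
  show ?thesis
  proof (rule that)
    show "cos (real a * \<alpha>) \<noteq> cos (real b * \<beta>)" if "a > 0 \<or> b > 0" for a b
      using angles_independent[OF assms(1) R sin neq that] .
    show "coeff_inequality 6 (min_poly (\<tau> ^ n)) \<longleftrightarrow> r n < 0" if n: "n > 0" for n
    proof -
      obtain a b c where ab: "min_poly (\<tau> ^ n) = [:1, - a, b, - c, b, - a, 1:]"
        "of_rat a = X n + Y n + Z n" "of_rat b = X n * Y n + X n * Z n + Y n * Z n + 3"
        "of_rat c = X n * Y n * Z n + 2 * (X n + Y n + Z n)"
        using min_poly_salem_power_6[OF assms n R sin neq X_def Y_def Z_def] by blast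
      have e: "of_rat a = X n * 1 + (Y n + Z n)" "of_rat b = X n * (Y n + Z n) + (Y n * Z n + 3)"
        "of_rat c = X n * (Y n * Z n + 2) + 2 * (Y n + Z n)"
        unfolding ab by (simp_all add: algebra_simps)
      have "coeff_inequality 6 (min_poly (\<tau> ^ n)) \<longleftrightarrow>
          3 / 4 * (2 + 2 * \<bar>of_rat b\<bar> + \<bar>of_rat c\<bar>) < \<bar>of_rat a :: real\<bar>"
        unfolding coeff_inequality_of_rat ab(1)
        by (simp add: of_rat_minus numeral_eq_Suc add.assoc)
      also have "\<dots> \<longleftrightarrow> (3 / 4 * (2 + 2 * \<bar>of_rat b\<bar> + \<bar>of_rat c\<bar>)) / X n < \<bar>of_rat a\<bar> / X n"
        by (simp only: div_less)
      also have "\<dots> \<longleftrightarrow> r n < 0"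
        unfolding e by (simp add: r_def add_divide_distrib mult.commute[of "X n" 4])
      finally show ?thesis .
    qed
    show "(\<lambda>n. r n - (3 * \<bar>cos (real n * \<alpha>) + cos (real n * \<beta>)\<bar> +
      3 / 2 * \<bar>1 + 2 * cos (real n * \<alpha>) * cos (real n * \<beta>)\<bar> - 1)) \<longlonglongrightarrow> 0"
    \<comment> \<open>\<open>3 / 4 * (2 + 2 * 7 + 2 * 4) + 4 = 22\<close>, from
      \<open>\<bar>Y n\<bar> \<le> 2\<close> and \<open>\<bar>Z n\<bar> \<le> 2\<close>.\<close>
    proof (rule tendsto_0_of_le_inverse_power[OF tau, where C = 22])
      fix n
      have "\<bar>r n - (3 / 4 * (2 * \<bar>Y n + Z n\<bar> + \<bar>Y n * Z n + 2\<bar>) - \<bar>1\<bar>)\<bar> \<le>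
          3 / 4 * (2 / X n + 2 * (\<bar>Y n * Z n + 3\<bar> / X n) + \<bar>2 * (Y n + Z n)\<bar> / X n) + \<bar>Y n + Z n\<bar> / X n"
      proof -
        have lin: "\<bar>3 / 4 * (t + 2 * A + B) - C - (3 / 4 * (2 * A' + B') - C')\<bar> \<le> 3 / 4 * (t + 2 * u + v) + w"
          if "t \<ge> 0" "\<bar>A - A'\<bar> \<le> u" "\<bar>B - B'\<bar> \<le> v" "\<bar>C - C'\<bar> \<le> w"
          for A A' B B' C C' t u v w :: real
        proof -
          have "3 / 4 * (t + 2 * A + B) - C - (3 / 4 * (2 * A' + B') - C') =
              3 / 4 * t + 3 / 2 * (A - A') + 3 / 4 * (B - B') - (C - C')"
            by (simp add: field_simps)
          thus ?thesis using that by (simp only: abs_le_iff) (auto simp: field_simps)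
        qed
        show ?thesis unfolding r_def
          by (intro lin abs_affine_div_diff X) (use X[of n] in simp)
      qed
      also have "\<dots> = (3 / 4 * (2 + 2 * \<bar>Y n * Z n + 3\<bar> + \<bar>2 * (Y n + Z n)\<bar>) + \<bar>Y n + Z n\<bar>) / X n"
        by (simp add: add_divide_distrib)
      also have "\<dots> \<le> 22 / X n"
      proof (rule divide_right_mono)
        show "3 / 4 * (2 + 2 * \<bar>Y n * Z n + 3\<bar> + \<bar>2 * (Y n + Z n)\<bar>) + \<bar>Y n + Z n\<bar> \<le> 22"
        proof -
          have "\<bar>Y n * Z n + 3\<bar> \<le> 7" using YZ[of n] by linarith
          moreover have "\<bar>Y n + Z n\<bar> \<le> 4" using Y[of n] Z[of n] by linarith
          moreover have "3 / 4 * (2 + 2 * u + 2 * v) + v \<le> 22" if "u \<le> 7" "v \<le> 4" for u v :: real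
            using that by (simp add: field_simps)
          ultimately show ?thesis by (simp only: abs_mult abs_numeral)
        qed
      qed (use X[of n] in simp)
      also have "3 / 4 * (2 * \<bar>Y n + Z n\<bar> + \<bar>Y n * Z n + 2\<bar>) - \<bar>1\<bar> =
        3 * \<bar>cos (real n * \<alpha>) + cos (real n * \<beta>)\<bar> +
        3 / 2 * \<bar>1 + 2 * cos (real n * \<alpha>) * cos (real n * \<beta>)\<bar> - 1"
      proof -
        have "\<bar>Y n + Z n\<bar> = 2 * \<bar>cos (real n * \<alpha>) + cos (real n * \<beta>)\<bar>"
          unfolding Y_def Z_def distrib_left[symmetric] by (simp only: abs_mult abs_numeral)
        moreover have "Y n * Z n + 2 = 2 * (1 + 2 * cos (real n * \<alpha>) * cos (real n * \<beta>))"
          by (simp add: Y_def Z_def)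
        hence "\<bar>Y n * Z n + 2\<bar> = 2 * \<bar>1 + 2 * cos (real n * \<alpha>) * cos (real n * \<beta>)\<bar>"
          by (simp only: abs_mult abs_numeral)
        ultimately show ?thesis by (simp only: abs_one) (simp only: distrib_left mult.assoc[symmetric] numeral_times_numeral, simp)
      qed
      finally show "\<bar>r n - (3 * \<bar>cos (real n * \<alpha>) + cos (real n * \<beta>)\<bar> +
        3 / 2 * \<bar>1 + 2 * cos (real n * \<alpha>) * cos (real n * \<beta>)\<bar> - 1)\<bar> \<le> 22 / (\<tau> ^ n + inverse \<tau> ^ n)"
        unfolding X_def .
    qed simp
  qed
qed

section \<open>Equidistribution\<close>

text \<open>All conditions depend on the cosines only, so an angle may be folded into
  \<open>[0, pi]\<close>; normalised length there is the limit distribution of a folded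
  equidistributed angle.\<close>

definition angle_measure :: "real measure" where
  "angle_measure = uniform_measure lborel {0..pi}"

abbreviation torus :: "(real \<times> real) measure" where
  "torus \<equiv> angle_measure \<Otimes>\<^sub>M angle_measure"

definition cos2 :: "real \<times> real \<Rightarrow> real \<times> real" where
  "cos2 x = (cos (fst x), cos (snd x))"

lemma angle_measure_eq_density:
  "angle_measure = density lborel (\<lambda>x. ennreal (indicator {0..pi} x / pi))"
proof -
  have "indicator {0..pi} x / ennreal pi = ennreal (indicator {0..pi} x / pi)" for x :: real
    by (auto simp: indicator_def divide_ennreal[symmetric])
  thus ?thesis by (simp add: angle_measure_def uniform_measure_def)
qed

lemma sets_angle_measure [measurable_cong, simp]: "sets angle_measure = sets borel"
  and space_angle_measure [simp]: "space angle_measure = UNIV"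
  by (simp_all add: angle_measure_def)

lemma prob_space_angle_measure: "prob_space angle_measure"
  unfolding angle_measure_def by (rule prob_space_uniform_measure) auto

interpretation angle: prob_space angle_measure by (rule prob_space_angle_measure)
interpretation angle2: pair_prob_space angle_measure angle_measure ..

section \<open>Cosine polynomials in two angles\<close>

lemma integral_angle_measure_cos:
  "(\<integral>x. cos (real j * x) \<partial>angle_measure) = (if j = 0 then 1 else 0)"
proof (cases "j = 0")
  case True
  thus ?thesis using angle.prob_space by simp
next
  case False
  have "(\<integral>x. cos (real j * x) \<partial>angle_measure) = (\<integral>x. (indicator {0..pi} x / pi) *\<^sub>R cos (real j * x) \<partial>lborel)"
    unfolding angle_measure_eq_density by (intro integral_density) auto
  also have "\<dots> = (\<integral>x. (cos (real j * x) / pi) * indicator {0..pi} x \<partial>lborel)"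
    by (simp add: mult.commute)
  also have "\<dots> = sin (real j * pi) / (j * pi) - sin (real j * 0) / (j * pi)"
    using False by (intro integral_FTC_Icc_real) (auto intro!: derivative_eq_intros continuous_intros)
  also have "\<dots> = 0" by (simp add: sin_npi)
  finally show ?thesis using False by simp
qed

text \<open>The span of products of cosines is the algebra of polynomials in the two cosines,
  written in a basis on which both the torus integral and the orbit means can be computed.\<close>

inductive trig_poly :: "(real \<times> real \<Rightarrow> real) \<Rightarrow> bool" where
  basis: "trig_poly (\<lambda>x. cos (real j * fst x) * cos (real k * snd x))"
| scale: "trig_poly f \<Longrightarrow> trig_poly (\<lambda>x. c * f x)"
| add: "trig_poly f \<Longrightarrow> trig_poly g \<Longrightarrow> trig_poly (\<lambda>x. f x + g x)"

text \<open>The second frequency is the distance of \<open>j\<close> and \<open>k\<close>, a natural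
  number as the basis demands; evenness of the cosine allows this choice of sign.\<close>

lemma cos_times_cos_nat:
  "\<exists>m. \<forall>x. cos (real j * x) * cos (real k * x) = (cos (real (j + k) * x) + cos (real m * x)) / 2"
proof (intro exI allI)
  fix x
  have "\<bar>real j - real k\<bar> * x = real j * x - real k * x \<or>
      \<bar>real j - real k\<bar> * x = - (real j * x - real k * x)"
    by (cases "real j \<le> real k") (simp_all add: abs_if left_diff_distrib)
  hence "cos (\<bar>real j - real k\<bar> * x) = cos (real j * x - real k * x)"
    using cos_minus by metis
  moreover have "real (nat \<bar>int j - int k\<bar>) = \<bar>real j - real k\<bar>" by simp
  ultimately show "cos (real j * x) * cos (real k * x) =
      (cos (real (j + k) * x) + cos (real (nat \<bar>int j - int k\<bar>) * x)) / 2"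
    using cos_times_cos[of "real j * x" "real k * x"]
    by (simp only: of_nat_add distrib_right add.commute)
qed

lemma trig_poly_mult_basis:
  assumes "trig_poly g"
  shows "trig_poly (\<lambda>x. (cos (real j * fst x) * cos (real k * snd x)) * g x)"
  using assms
proof induction
  case (basis j' k')
  obtain m where m: "\<And>x. cos (real j * x) * cos (real j' * x) = (cos (real (j + j') * x) + cos (real m * x)) / 2"
    using cos_times_cos_nat by blast
  obtain n where n: "\<And>x. cos (real k * x) * cos (real k' * x) = (cos (real (k + k') * x) + cos (real n * x)) / 2"
    using cos_times_cos_nat by blast
  have "(\<lambda>x. (cos (real j * fst x) * cos (real k * snd x)) * (cos (real j' * fst x) * cos (real k' * snd x))) =
    (\<lambda>x. 1 / 4 * ((cos (real (j + j') * fst x) * cos (real (k + k') * snd x) +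
                 cos (real (j + j') * fst x) * cos (real n * snd x)) +
                (cos (real m * fst x) * cos (real (k + k') * snd x) +
                 cos (real m * fst x) * cos (real n * snd x))))" (is "?l = ?r")
  proof
    fix x
    have "?l x = (cos (real j * fst x) * cos (real j' * fst x)) * (cos (real k * snd x) * cos (real k' * snd x))"
      by (simp add: mult_ac)
    moreover have "((a + b) / 2) * ((c + d) / 2) = 1 / 4 * ((a * c + a * d) + (b * c + b * d))"
      for a b c d :: real
      by (simp add: algebra_simps)
    ultimately show "?l x = ?r x" unfolding m n by (simp only:)
  qed
  moreover have "trig_poly ?r" by (intro trig_poly.intros)
  ultimately show ?case by simp
next
  case (scale f c)
  from trig_poly.scale[OF scale.IH, of c] show ?case by (simp add: mult_ac)
next
  case (add f g)
  from trig_poly.add[OF add.IH] show ?case by (simp add: algebra_simps)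
qed

lemma trig_poly_mult:
  assumes "trig_poly f" "trig_poly g"
  shows "trig_poly (\<lambda>x. f x * g x)"
  using assms(1)
proof induction
  case (basis j k)
  show ?case using trig_poly_mult_basis[OF assms(2)] .
next
  case (scale f c)
  from trig_poly.scale[OF scale.IH, of c] show ?case by (simp add: mult_ac)
next
  case (add f1 f2)
  from trig_poly.add[OF add.IH] show ?case by (simp add: algebra_simps)
qed

lemma trig_poly_const: "trig_poly (\<lambda>x. c)"
  using trig_poly.scale[OF trig_poly.basis[of 0 0], of c] by simp

text \<open>Connects Stone-Weierstrass, which supplies polynomials in the cosines, with the basis on
  which the means are known. Linear maps on the plane contribute the frequencies
  \<open>(1, 0)\<close> and \<open>(0, 1)\<close>.\<close>

lemma trig_poly_real_polynomial_function:
  assumes "real_polynomial_function p"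
  shows "trig_poly (\<lambda>x. p (cos2 x))"
  using assms
proof induction
  case (linear f)
  interpret bounded_linear f by fact
  have lin: "f (a, b) = f (1, 0) * a + f (0, 1) * b" for a b
  proof -
    have "(a, b) = a *\<^sub>R (1, 0) + b *\<^sub>R (0, 1)" by simp
    hence "f (a, b) = f (a *\<^sub>R (1, 0) + b *\<^sub>R (0, 1))" by (rule arg_cong)
    thus ?thesis by (simp only: add scaleR) (simp add: mult.commute)
  qed
  have "f (cos2 x) = f (1, 0) * (cos (real 1 * fst x) * cos (real 0 * snd x)) +
      f (0, 1) * (cos (real 0 * fst x) * cos (real 1 * snd x))" for x
    unfolding cos2_def of_nat_0 of_nat_1 mult_zero_left cos_zero mult_1 mult_1_right by (rule lin)
  thus ?case by (simp only: trig_poly.intros)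
next
  case (mult f g)
  thus ?case using trig_poly_mult by blast
qed (simp_all add: trig_poly_const trig_poly.add)

lemma integral_trig_basis:
  "integral\<^sup>L torus (\<lambda>x. cos (real j * fst x) * cos (real k * snd x)) =
     (if j = 0 \<and> k = 0 then 1 else 0)"
  and integrable_trig_basis:
  "integrable torus (\<lambda>x. cos (real j * fst x) * cos (real k * snd x))"
proof -
  have "norm (cos a * cos b) \<le> 1" for a b :: real
    using mult_mono[of "\<bar>cos a\<bar>" 1 "\<bar>cos b\<bar>" 1] by (simp add: abs_mult)
  thus int: "integrable torus (\<lambda>x. cos (real j * fst x) * cos (real k * snd x))"
    by (intro angle2.integrable_const_bound[where B = 1]) (auto simp: measurable_pair_swap)
  have "integral\<^sup>L torus (\<lambda>x. cos (real j * fst x) * cos (real k * snd x)) =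
      (\<integral>s. (\<integral>t. cos (real j * s) * cos (real k * t) \<partial>angle_measure) \<partial>angle_measure)"
    using angle2.integral_fst'[OF int] by simp
  also have "\<dots> = (if j = 0 \<and> k = 0 then 1 else 0)"
    by (simp add: integral_angle_measure_cos)
  finally show "integral\<^sup>L torus (\<lambda>x. cos (real j * fst x) * cos (real k * snd x)) =
     (if j = 0 \<and> k = 0 then 1 else 0)" .
qed

section \<open>Means along the orbit\<close>

definition mean_upto :: "(nat \<Rightarrow> real) \<Rightarrow> nat \<Rightarrow> real" where
  "mean_upto f N = (\<Sum>n = 1..N. f n) / real N"

lemma mean_upto_add: "mean_upto (\<lambda>n. f n + g n) N = mean_upto f N + mean_upto g N"
  and mean_upto_cmult: "mean_upto (\<lambda>n. c * f n) N = c * mean_upto f N"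
  and mean_upto_diff: "mean_upto (\<lambda>n. f n - g n) N = mean_upto f N - mean_upto g N"
  by (simp_all add: mean_upto_def sum.distrib sum_subtractf add_divide_distrib diff_divide_distrib
        flip: sum_distrib_left)

lemma mean_upto_mono: "(\<And>n. n > 0 \<Longrightarrow> f n \<le> g n) \<Longrightarrow> mean_upto f N \<le> mean_upto g N"
  unfolding mean_upto_def by (intro divide_right_mono sum_mono) auto

text \<open>The sum is the real part of a geometric sum, whose modulus is at most
  \<open>2 / norm (1 - cis \<omega>)\<close> however large \<open>N\<close> is; dividing by
  \<open>N\<close> sends it to 0.\<close>

lemma mean_upto_cos_tendsto_0:
  assumes "cos \<omega> \<noteq> 1"
  shows "mean_upto (\<lambda>n. cos (real n * \<omega>)) \<longlonglongrightarrow> 0"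
proof (rule Lim_null_comparison)
  have z: "cis \<omega> \<noteq> 1" using assms by (auto simp: complex_eq_iff)
  define C where "C = 2 / norm (1 - cis \<omega>)"
  show "\<forall>\<^sub>F N in sequentially. norm (mean_upto (\<lambda>n. cos (real n * \<omega>)) N) \<le> C * inverse (real N)"
  proof (intro always_eventually allI)
    fix N
    have "(\<Sum>n = 1..N. cos (real n * \<omega>)) = Re (\<Sum>n = 1..N. cis \<omega> ^ n)"
      by (simp add: Complex.DeMoivre)
    hence "\<bar>\<Sum>n = 1..N. cos (real n * \<omega>)\<bar> \<le> norm (\<Sum>n = 1..N. cis \<omega> ^ n)"
      using abs_Re_le_cmod by metis
    also have "(\<Sum>n = 1..N. cis \<omega> ^ n) = cis \<omega> * (\<Sum>n<N. cis \<omega> ^ n)"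
      by (simp add: sum_distrib_left sum.atLeast1_atMost_eq)
    also have "\<dots> = cis \<omega> * ((1 - cis \<omega> ^ N) / (1 - cis \<omega>))"
      using z by (simp add: sum_gp_strict)
    also have "norm \<dots> \<le> C"
    proof -
      have "norm (1 - cis \<omega> ^ N) \<le> 2"
        using norm_triangle_ineq4[of 1 "cis \<omega> ^ N"] by (simp add: norm_power)
      thus ?thesis by (simp add: norm_mult norm_divide C_def divide_right_mono)
    qed
    finally show "norm (mean_upto (\<lambda>n. cos (real n * \<omega>)) N) \<le> C * inverse (real N)"
      by (simp add: mean_upto_def divide_inverse abs_mult mult_right_mono)
  qed
  show "(\<lambda>N. C * inverse (real N)) \<longlonglongrightarrow> 0"
    using lim_inverse_n by (rule tendsto_mult_right_zero)
qed

lemma cos_add_eq_1_imp: "cos (x + y) = 1 \<Longrightarrow> cos x = cos (y :: real)"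
  using cos_diff[of "x + y" y] cos_one_sin_zero[of "x + y"] by simp

text \<open>Along the orbit a basis function is the mean of two cosines with frequencies
  \<open>j * \<alpha> + k * \<beta>\<close> and \<open>j * \<alpha> - k * \<beta>\<close>;
  independence says that neither is a multiple of \<open>2 * pi\<close> unless
  \<open>j = k = 0\<close>.\<close>

lemma trig_poly_equidistributed:
  assumes indep: "\<And>a b. a > 0 \<or> b > 0 \<Longrightarrow> cos (real a * \<alpha>) \<noteq> cos (real b * \<beta>)"
    and "trig_poly f"
  shows "integrable torus f \<and>
    mean_upto (\<lambda>n. f (real n * \<alpha>, real n * \<beta>)) \<longlonglongrightarrow> integral\<^sup>L torus f"
  using assms(2)
proof induction
  case (basis j k)
  have "mean_upto (\<lambda>n. cos (real j * (real n * \<alpha>)) * cos (real k * (real n * \<beta>)))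
      \<longlonglongrightarrow> (if j = 0 \<and> k = 0 then 1 else 0)"
  proof (cases "j = 0 \<and> k = 0")
    case True
    have "\<forall>\<^sub>F N in sequentially. mean_upto (\<lambda>n. 1) N = 1"
      using eventually_gt_at_top[of 0] by eventually_elim (simp add: mean_upto_def)
    thus ?thesis using True by (simp add: tendsto_eventually)
  next
    case False
    have 1: "cos (real j * \<alpha> + real k * \<beta>) \<noteq> 1" "cos (real j * \<alpha> - real k * \<beta>) \<noteq> 1"
      using indep[of j k] False cos_add_eq_1_imp[of "real j * \<alpha>" "real k * \<beta>"]
        cos_add_eq_1_imp[of "real j * \<alpha>" "- (real k * \<beta>)"] by auto
    have "(\<lambda>N. 1 / 2 * (mean_upto (\<lambda>n. cos (real n * (real j * \<alpha> - real k * \<beta>))) N +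
        mean_upto (\<lambda>n. cos (real n * (real j * \<alpha> + real k * \<beta>))) N)) \<longlonglongrightarrow> 1 / 2 * (0 + 0)"
      by (intro tendsto_intros mean_upto_cos_tendsto_0 1)
    also have "(\<lambda>N. 1 / 2 * (mean_upto (\<lambda>n. cos (real n * (real j * \<alpha> - real k * \<beta>))) N +
        mean_upto (\<lambda>n. cos (real n * (real j * \<alpha> + real k * \<beta>))) N)) =
      mean_upto (\<lambda>n. cos (real j * (real n * \<alpha>)) * cos (real k * (real n * \<beta>)))"
      unfolding mean_upto_add[symmetric] mean_upto_cmult[symmetric] cos_times_cos
      by (simp add: algebra_simps add_divide_distrib)
    finally show ?thesis using False by auto
  qed
  thus ?case using integral_trig_basis[of j k] integrable_trig_basis[of j k] by simp
next
  case (scale f c)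
  thus ?case by (simp add: mean_upto_cmult tendsto_mult_left)
next
  case (add f g)
  thus ?case by (simp add: mean_upto_add tendsto_add)
qed

text \<open>Approximation by a polynomial within \<open>e / 3\<close>, uniform on a square
  containing all values of \<open>cos2\<close>, moves the orbit mean and the integral by at most
  \<open>e / 3\<close> each.\<close>

lemma continuous_equidistributed:
  fixes F :: "real \<times> real \<Rightarrow> real"
  assumes indep: "\<And>a b. a > 0 \<or> b > 0 \<Longrightarrow> cos (real a * \<alpha>) \<noteq> cos (real b * \<beta>)"
    and cont: "continuous_on UNIV F"
  shows "integrable torus (\<lambda>x. F (cos2 x))"
    and "mean_upto (\<lambda>n. F (cos2 (real n * \<alpha>, real n * \<beta>))) \<longlonglongrightarrow> (\<integral>x. F (cos2 x) \<partial>torus)"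
proof -
  define S where "S = {-1..1::real} \<times> {-1..1::real}"
  have "compact S" unfolding S_def by (intro compact_Times compact_Icc)
  have S: "cos2 x \<in> S" for x by (simp add: cos2_def S_def)
  have contS: "continuous_on S F" using cont continuous_on_subset by blast
  have cos2_meas: "cos2 \<in> borel_measurable torus"
  proof -
    have "(\<lambda>x. (cos (fst x), cos (snd x))) \<in> measurable torus (borel \<Otimes>\<^sub>M borel)"
      by measurable
    thus ?thesis by (simp add: borel_prod cos2_def[abs_def])
  qed
  have meas: "(\<lambda>x. F (cos2 x)) \<in> borel_measurable torus"
    using borel_measurable_continuous_onI[OF cont] cos2_meas by (rule measurable_compose_rev)
  obtain B where B: "\<And>y. y \<in> S \<Longrightarrow> \<bar>F y\<bar> \<le> B"
    using compact_imp_bounded[OF compact_continuous_image[OF contS \<open>compact S\<close>]]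
    by (auto simp: bounded_iff)
  show int: "integrable torus (\<lambda>x. F (cos2 x))"
    using meas B S by (intro angle2.integrable_const_bound[where B = B]) auto
  let ?x = "\<lambda>n. cos2 (real n * \<alpha>, real n * \<beta>)"
  let ?I = "\<lambda>f. (\<integral>x. f (cos2 x) \<partial>torus)"
  show "mean_upto (\<lambda>n. F (?x n)) \<longlonglongrightarrow> ?I F"
  proof (rule LIMSEQ_I)
    fix e :: real assume "e > 0"
    obtain p where p: "real_polynomial_function p" "\<And>x. x \<in> S \<Longrightarrow> \<bar>F x - p x\<bar> < e / 3"
      using Stone_Weierstrass_real_polynomial_function[OF \<open>compact S\<close> contS, of "e / 3"] \<open>e > 0\<close> by auto
    note tp = trig_poly_equidistributed[OF indep trig_poly_real_polynomial_function[OF p(1)]]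
    have 1: "\<bar>?I F - ?I p\<bar> \<le> e / 3"
    proof -
      have "?I F - ?I p = (\<integral>x. F (cos2 x) - p (cos2 x) \<partial>torus)"
        using int tp by simp
      also have "\<bar>\<dots>\<bar> \<le> (\<integral>x. \<bar>F (cos2 x) - p (cos2 x)\<bar> \<partial>torus)"
        by (rule integral_abs_bound)
      also have "\<dots> \<le> (\<integral>x. e / 3 \<partial>torus)"
        using int tp p(2)[OF S] by (intro integral_mono) (auto intro: less_imp_le)
      also have "\<dots> = e / 3" by (simp add: angle2.prob_space)
      finally show ?thesis .
    qed
    have 2: "\<bar>mean_upto (\<lambda>n. F (?x n)) N - mean_upto (\<lambda>n. p (?x n)) N\<bar> \<le> e / 3" for N
    proof -
      have c: "mean_upto (\<lambda>n. c) N \<le> c" if "c \<ge> 0" for c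
        using that by (cases "N = 0") (simp_all add: mean_upto_def)
      have "mean_upto (\<lambda>n. F (?x n) - p (?x n)) N \<le> mean_upto (\<lambda>n. e / 3) N"
        "mean_upto (\<lambda>n. (-1) * (F (?x n) - p (?x n))) N \<le> mean_upto (\<lambda>n. e / 3) N"
        using p(2)[OF S] by (intro mean_upto_mono; smt (verit))+
      moreover have "mean_upto (\<lambda>n. e / 3) N \<le> e / 3" using \<open>e > 0\<close> by (intro c) simp
      ultimately show ?thesis
        unfolding mean_upto_cmult mean_upto_diff abs_le_iff by simp
    qed
    obtain N0 where 3: "\<And>N. N \<ge> N0 \<Longrightarrow> \<bar>mean_upto (\<lambda>n. p (?x n)) N - ?I p\<bar> < e / 3"
      using LIMSEQ_D[OF conjunct2[OF tp], of "e / 3"] \<open>e > 0\<close> by auto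
    have tri: "\<bar>a - b\<bar> < e" if "\<bar>b - c\<bar> \<le> e / 3" "\<bar>a - d\<bar> \<le> e / 3" "\<bar>d - c\<bar> < e / 3" for a b c d
      using that by linarith
    show "\<exists>N0. \<forall>N\<ge>N0. norm (mean_upto (\<lambda>n. F (?x n)) N - ?I F) < e"
      unfolding real_norm_def by (intro exI[of _ N0] allI impI) (rule tri[OF 1 2 3])
  qed
qed

lemma borel_measurable_cos2 [measurable]: "cos2 \<in> borel_measurable torus"
proof -
  have "(\<lambda>x. (cos (fst x), cos (snd x))) \<in> measurable torus (borel \<Otimes>\<^sub>M borel)"
    by measurable
  thus ?thesis by (simp add: borel_prod cos2_def[abs_def])
qed

text \<open>A lower bound can be had from a continuous function below the indicator of the region;
  the upper bound will follow from the same statement for \<open>- g\<close> and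
  \<open>- r\<close>.\<close>

lemma eventually_mean_indicator_ge:
  fixes g :: "real \<times> real \<Rightarrow> real"
  assumes indep: "\<And>a b. a > 0 \<or> b > 0 \<Longrightarrow> cos (real a * \<alpha>) \<noteq> cos (real b * \<beta>)"
    and cont: "continuous_on UNIV g"
    and lim: "(\<lambda>n. r n - g (cos2 (real n * \<alpha>, real n * \<beta>))) \<longlonglongrightarrow> 0"
    and e: "e > 0"
  shows "\<forall>\<^sub>F N in sequentially.
    mean_upto (indicator {n. r n < 0}) N > measure torus {x. g (cos2 x) < 0} - e"
proof -
  \<comment> \<open>A ramp that is 0 for \<open>y \<ge> -1 / (k + 1)\<close> and 1 for
    \<open>y \<le> -2 / (k + 1)\<close>. The strip between \<open>-1 / (k + 1)\<close> and 0 leaves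
    room for the difference between \<open>r n\<close> and \<open>g\<close>.\<close>
  define \<phi> :: "nat \<Rightarrow> real \<Rightarrow> real" where "\<phi> k y = max 0 (min 1 (- y * real (Suc k) - 1))" for k y
  have cont_\<phi>: "continuous_on UNIV (\<lambda>x. \<phi> k (g x))" for k
    unfolding \<phi>_def by (intro continuous_intros cont)
  note equi = continuous_equidistributed[OF indep cont_\<phi>]
  have g_meas [measurable]: "(\<lambda>x. g (cos2 x)) \<in> borel_measurable torus"
    using borel_measurable_continuous_onI[OF cont] borel_measurable_cos2 by (rule measurable_compose_rev)
  define A where "A = {x. g (cos2 x) < 0}"
  have "{x \<in> space torus. g (cos2 x) < 0} \<in> sets torus" by measurable
  hence A [measurable]: "A \<in> sets torus" by (simp add: A_def space_pair_measure)
  have "(\<lambda>k. \<integral>x. \<phi> k (g (cos2 x)) \<partial>torus) \<longlonglongrightarrow> (\<integral>x. indicator A x \<partial>torus)"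
  proof (rule integral_dominated_convergence[where w = "\<lambda>_. 1"])
    show "AE x in torus. (\<lambda>k. \<phi> k (g (cos2 x))) \<longlonglongrightarrow> indicator A x"
    proof (rule AE_I2)
      fix x
      define y where "y = g (cos2 x)"
      have "\<forall>\<^sub>F k in sequentially. \<phi> k y = indicator A x"
      proof (cases "y < 0")
        case True
        have "\<forall>\<^sub>F k in sequentially. real (Suc k) \<ge> 2 / (- y)"
          by (rule eventually_sequentiallyI[of "nat \<lceil>2 / (- y)\<rceil>"]) linarith
        thus ?thesis
        proof eventually_elim
          case (elim k)
          hence "- y * real (Suc k) \<ge> 2" using True by (simp add: field_simps)
          hence "\<phi> k y = 1" unfolding \<phi>_def by linarith
          thus ?case using True by (simp add: A_def y_def)
        qed
      next
        case False
        hence "\<phi> k y = 0" for k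
        proof -
          have "- y * real (Suc k) \<le> 0" using False by (intro mult_nonpos_nonneg) auto
          thus ?thesis unfolding \<phi>_def by linarith
        qed
        thus ?thesis using False by (simp add: A_def y_def)
      qed
      thus "(\<lambda>k. \<phi> k (g (cos2 x))) \<longlonglongrightarrow> indicator A x"
        unfolding y_def by (rule tendsto_eventually)
    qed
    show "AE x in torus. norm (\<phi> k (g (cos2 x))) \<le> 1" for k
      by (rule AE_I2) (simp add: \<phi>_def)
    show "(\<lambda>x. \<phi> k (g (cos2 x))) \<in> borel_measurable torus" for k
      unfolding \<phi>_def by measurable
  qed auto
  hence "(\<lambda>k. \<integral>x. \<phi> k (g (cos2 x)) \<partial>torus) \<longlonglongrightarrow> measure torus A"
    using A by simp
  hence "\<forall>\<^sub>F k in sequentially. (\<integral>x. \<phi> k (g (cos2 x)) \<partial>torus) > measure torus A - e / 3"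
    using e by (intro order_tendstoD(1)[where y = "measure torus A"]) auto
  then obtain k where k: "(\<integral>x. \<phi> k (g (cos2 x)) \<partial>torus) > measure torus A - e / 3"
    by (auto simp: eventually_sequentially)
  let ?x = "\<lambda>n. cos2 (real n * \<alpha>, real n * \<beta>)"
  have ev1: "\<forall>\<^sub>F N in sequentially. mean_upto (\<lambda>n. \<phi> k (g (?x n))) N > measure torus A - 2 * e / 3"
    using k e by (intro order_tendstoD(1)[OF equi(2)[of k]]) auto
  obtain n0 where n0: "\<And>n. n \<ge> n0 \<Longrightarrow> \<bar>r n - g (?x n)\<bar> < 1 / real (Suc k)"
    using LIMSEQ_D[OF lim, of "1 / real (Suc k)"] by auto
  \<comment> \<open>Finitely many \<open>n < n0\<close> may violate the closeness; they are paid for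
    by a second indicator whose mean tends to 0.\<close>
  have le: "\<phi> k (g (?x n)) \<le> indicator {n. r n < 0} n + indicator {..<n0} n" for n
  proof (cases "n < n0 \<or> r n < 0")
    case False
    hence "g (?x n) > - (1 / real (Suc k))" using n0[of n] by linarith
    hence "- g (?x n) * real (Suc k) < 1" by (simp add: field_simps)
    hence "\<phi> k (g (?x n)) = 0" unfolding \<phi>_def by linarith
    thus ?thesis by simp
  next
    case True
    have "\<phi> k (g (?x n)) \<le> 1" by (simp add: \<phi>_def)
    thus ?thesis using True by (auto simp: indicator_def)
  qed
  have "mean_upto (indicator {..<n0}) N \<le> real n0 * inverse (real N)" for N
  proof -
    have "(\<Sum>n = 1..N. indicator {..<n0} n) = real (card ({1..N} \<inter> {..<n0}))"
      by (simp add: indicator_def sum.If_cases lessThan_def)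
    also have "\<dots> \<le> real (card {..<n0})"
      by (intro of_nat_mono card_mono) auto
    finally show ?thesis by (simp add: mean_upto_def divide_inverse mult_right_mono)
  qed
  moreover have "(\<lambda>N. real n0 * inverse (real N)) \<longlonglongrightarrow> 0"
    using lim_inverse_n by (rule tendsto_mult_right_zero)
  hence "\<forall>\<^sub>F N in sequentially. real n0 * inverse (real N) < e / 3"
    using e by (intro order_tendstoD(2)) auto
  ultimately have ev2: "\<forall>\<^sub>F N in sequentially. mean_upto (indicator {..<n0}) N < e / 3"
    using eventually_mono le_less_trans by (metis (mono_tags, lifting))
  from ev1 ev2 show ?thesis
  proof eventually_elim
    case (elim N)
    have "mean_upto (\<lambda>n. \<phi> k (g (?x n))) N \<le>
        mean_upto (indicator {n. r n < 0}) N + mean_upto (indicator {..<n0}) N"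
      unfolding mean_upto_add[symmetric] by (intro mean_upto_mono le)
    thus ?case using elim unfolding A_def by linarith
  qed
qed

text \<open>The two bounds on \<open>L\<close> force the boundary, where \<open>g\<close> vanishes,
  to be a null set. The complement of the non-strict region is the strict region of
  \<open>- g\<close>, which supplies the upper estimate.\<close>

lemma has_natural_density_of_equidistributed:
  fixes g :: "real \<times> real \<Rightarrow> real"
  assumes indep: "\<And>a b. a > 0 \<or> b > 0 \<Longrightarrow> cos (real a * \<alpha>) \<noteq> cos (real b * \<beta>)"
    and cont: "continuous_on UNIV g"
    and lim: "(\<lambda>n. r n - g (cos2 (real n * \<alpha>, real n * \<beta>))) \<longlonglongrightarrow> 0"
    and P: "\<And>n. n > 0 \<Longrightarrow> P n \<longleftrightarrow> r n < 0"
    and L: "L \<le> measure torus {x. g (cos2 x) < 0}"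
      "measure torus {x. g (cos2 x) \<le> 0} \<le> L"
  shows "has_natural_density {n. P n} L"
proof -
  have g_meas [measurable]: "(\<lambda>x. g (cos2 x)) \<in> borel_measurable torus"
    using borel_measurable_continuous_onI[OF cont] borel_measurable_cos2 by (rule measurable_compose_rev)
  have "{x \<in> space torus. g (cos2 x) \<le> 0} \<in> sets torus" by measurable
  hence "{x. g (cos2 x) \<le> 0} \<in> sets torus" by (simp add: space_pair_measure)
  from angle2.prob_compl[OF this]
  have compl: "measure torus {x. - g (cos2 x) < 0} = 1 - measure torus {x. g (cos2 x) \<le> 0}"
    by (simp add: space_pair_measure Compl_eq not_le flip: Compl_eq_Diff_UNIV)
  have lim': "(\<lambda>n. - r n - - g (cos2 (real n * \<alpha>, real n * \<beta>))) \<longlonglongrightarrow> 0"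
    using tendsto_minus[OF lim] by simp
  have cont': "continuous_on UNIV (\<lambda>x. - g x)" using cont by (intro continuous_intros)
  have card_eq: "real (card ({n. P n} \<inter> {1..N})) / real N = mean_upto (indicator {n. r n < 0}) N" for N
  proof -
    have "{n. P n} \<inter> {1..N} = {1..N} \<inter> {n. r n < 0}" using P by force
    thus ?thesis by (simp add: mean_upto_def indicator_def sum.If_cases)
  qed
  have "mean_upto (indicator {n. r n < 0}) \<longlonglongrightarrow> L"
  proof (rule order_tendstoI)
    fix y assume "y < L"
    hence "\<forall>\<^sub>F N in sequentially. mean_upto (indicator {n. r n < 0}) N >
        measure torus {x. g (cos2 x) < 0} - (L - y)"
      by (intro eventually_mean_indicator_ge[OF indep cont lim]) auto
    thus "\<forall>\<^sub>F N in sequentially. y < mean_upto (indicator {n. r n < 0}) N"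
      by eventually_elim (use L in linarith)
  next
    fix y assume "L < y"
    hence "\<forall>\<^sub>F N in sequentially. mean_upto (indicator {n. - r n < 0}) N >
        measure torus {x. - g (cos2 x) < 0} - (y - L)"
      by (intro eventually_mean_indicator_ge[OF indep cont' lim']) auto
    thus "\<forall>\<^sub>F N in sequentially. mean_upto (indicator {n. r n < 0}) N < y"
      using eventually_gt_at_top[of 0]
    proof eventually_elim
      case (elim N)
      \<comment> \<open>Indices with \<open>r n = 0\<close> are counted by neither indicator, hence
        an inequality.\<close>
      have "mean_upto (indicator {n. r n < 0}) N + mean_upto (indicator {n. - r n < 0}) N \<le> mean_upto (\<lambda>_. 1) N"
        unfolding mean_upto_add[symmetric] by (intro mean_upto_mono) (auto simp: indicator_def)
      also have "\<dots> = 1" using elim by (simp add: mean_upto_def)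
      finally show ?case using elim L compl by linarith
    qed
  qed
  thus ?thesis unfolding has_natural_density_def card_eq .
qed

text \<open>Completing a single angle to an independent pair reduces equidistribution on the circle
  to the two-dimensional case.\<close>

lemma exists_independent_angle:
  assumes "\<And>a. a > 0 \<Longrightarrow> cos (real a * \<theta>) \<noteq> 1"
  obtains \<beta> where "\<And>a b. a > 0 \<or> b > 0 \<Longrightarrow> cos (real a * \<theta>) \<noteq> cos (real b * \<beta>)"
proof -
  \<comment> \<open>All solutions \<open>\<beta>\<close> of a forbidden equation; for
    \<open>b = 0\<close> the convention for division adds only the number 0. The set is countable,
    so some real lies outside.\<close>
  define B where "B = (\<Union>a. \<Union>b. \<Union>k. {(2 * real_of_int k * pi + real a * \<theta>) / real b,
    (2 * real_of_int k * pi - real a * \<theta>) / real b} :: real set)"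
  have "countable B" unfolding B_def by (intro countable_UN) auto
  hence "B \<noteq> UNIV" using uncountable_UNIV_real by auto
  then obtain \<beta> where \<beta>: "\<beta> \<notin> B" by auto
  show ?thesis
  proof (rule that)
    fix a b :: nat assume ab: "a > 0 \<or> b > 0"
    show "cos (real a * \<theta>) \<noteq> cos (real b * \<beta>)"
    proof (cases "b = 0")
      case False
      show ?thesis
      proof
        assume "cos (real a * \<theta>) = cos (real b * \<beta>)"
        hence "cos (real b * \<beta>) = cos (real a * \<theta>)" by simp
        then obtain k where "real b * \<beta> = real a * \<theta> + 2 * real_of_int k * pi \<or>
            real b * \<beta> = - (real a * \<theta>) + 2 * real_of_int k * pi"
          unfolding cos_eq by (elim bexE Ints_cases) blast
        hence "\<beta> = (2 * real_of_int k * pi + real a * \<theta>) / real b \<or>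
            \<beta> = (2 * real_of_int k * pi - real a * \<theta>) / real b"
          using False by (simp add: field_simps)
        hence "\<beta> \<in> B" unfolding B_def by blast
        thus False using \<beta> by contradiction
      qed
    qed (use ab assms in auto)
  qed
qed

section \<open>The region of the sextic case\<close>

lemma emeasure_angle_measure:
  "A \<in> sets borel \<Longrightarrow> emeasure angle_measure A = emeasure lborel ({0..pi} \<inter> A) / ennreal pi"
  by (simp add: angle_measure_def)

lemma emeasure_angle_measure_interval:
  assumes "0 \<le> a" "a \<le> b" "b \<le> pi"
  shows "emeasure angle_measure {a..b} = ennreal ((b - a) / pi)"
    and "emeasure angle_measure {a<..<b} = ennreal ((b - a) / pi)"
proof -
  have "{0..pi} \<inter> {a..b} = {a..b}" "{0..pi} \<inter> {a<..<b} = {a<..<b}" using assms by auto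
  thus "emeasure angle_measure {a..b} = ennreal ((b - a) / pi)"
    "emeasure angle_measure {a<..<b} = ennreal ((b - a) / pi)"
    using assms by (simp_all add: emeasure_angle_measure divide_ennreal)
qed

text \<open>Fubini: the area is the integral of the slice lengths. The slices at \<open>a\<close>
  and \<open>b\<close> are left unspecified, as a null set, so that the statement serves open and
  closed regions alike.\<close>

lemma measure_angle2_region:
  assumes ab: "0 \<le> a" "a \<le> b" "b \<le> pi"
    and cont: "continuous_on {a..b} l" and nonneg: "\<And>t. t \<in> {a..b} \<Longrightarrow> l t \<ge> 0"
    and A: "A \<in> sets torus"
    and inside: "\<And>t. t \<in> {a<..<b} \<Longrightarrow> emeasure angle_measure (Pair t -` A) = ennreal (l t / pi)"
    and outside: "\<And>t. t \<notin> {a..b} \<Longrightarrow> Pair t -` A = {}"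
  shows "measure torus A = integral {a..b} l / pi\<^sup>2"
proof -
  define l' where "l' t = l t / pi\<^sup>2" for t
  have meas: "(\<lambda>t. emeasure angle_measure (Pair t -` A)) \<in> borel_measurable angle_measure"
    using A by (rule angle.measurable_emeasure_Pair)
  have "emeasure torus A = (\<integral>\<^sup>+ t. emeasure angle_measure (Pair t -` A) \<partial>angle_measure)"
    using A by (rule angle.emeasure_pair_measure_alt)
  also have "\<dots> = (\<integral>\<^sup>+ t. ennreal (indicator {0..pi} t / pi) * emeasure angle_measure (Pair t -` A) \<partial>lborel)"
    using meas unfolding angle_measure_eq_density by (subst nn_integral_density) auto
  also have "\<dots> = (\<integral>\<^sup>+ t. indicator {a..b} t * ennreal (l' t) \<partial>lborel)"
  proof (rule nn_integral_cong_AE)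
    have "AE t in lborel. t \<noteq> a \<and> t \<noteq> b"
      using AE_lborel_singleton[of a] AE_lborel_singleton[of b] by eventually_elim auto
    thus "AE t in lborel. ennreal (indicator {0..pi} t / pi) * emeasure angle_measure (Pair t -` A) =
        indicator {a..b} t * ennreal (l' t)"
    proof eventually_elim
      case (elim t)
      show ?case
      proof (cases "t \<in> {a..b}")
        case True
        hence "t \<in> {a<..<b}" "t \<in> {0..pi}" using elim ab by auto
        thus ?thesis using True inside[of t] nonneg[of t]
          by (simp add: l'_def power2_eq_square flip: ennreal_mult')
      qed (simp add: outside)
    qed
  qed
  also have "\<dots> = ennreal (integral {a..b} l / pi\<^sup>2)"
  proof -
    have "l' integrable_on {a..b}"
      unfolding l'_def by (intro integrable_continuous_interval continuous_intros cont) auto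
    moreover have "integral {a..b} l' = integral {a..b} l / pi\<^sup>2"
      by (simp add: l'_def[abs_def] integral_divide)
    ultimately have hi: "(l' has_integral integral {a..b} l / pi\<^sup>2) {a..b}"
      using integrable_integral by metis
    have "l' t \<ge> 0" if "t \<in> {a..b}" for t using nonneg[OF that] by (simp add: l'_def)
    from nn_integral_has_integral_lebesgue'[OF this hi] show ?thesis by (simp add: mult.commute)
  qed
  finally have "emeasure torus A = ennreal (integral {a..b} l / pi\<^sup>2)" .
  moreover have "integral {a..b} l / pi\<^sup>2 \<ge> 0"
    using nonneg by (intro divide_nonneg_nonneg integral_nonneg integrable_continuous_interval cont) auto
  ultimately show ?thesis by (simp add: measure_def)
qed

lemma distr_angle_measure_reflect: "distr angle_measure angle_measure (\<lambda>x. pi - x) = angle_measure"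
proof (rule measure_eqI)
  fix A assume "A \<in> sets (distr angle_measure angle_measure (\<lambda>x. pi - x))"
  hence A: "A \<in> sets borel" by simp
  have meas: "(\<lambda>x. pi - x) \<in> borel_measurable lborel" by measurable
  have refl: "distr lborel borel (\<lambda>x. pi - x) = (lborel :: real measure)"
    using lborel_real_affine[of "-1" pi] by (simp add: density_1)
  have pre: "(\<lambda>x. pi - x) -` A \<in> sets borel"
    using measurable_sets[OF meas, of A] A by simp
  have "emeasure lborel ({0..pi} \<inter> A) = emeasure (distr lborel borel (\<lambda>x. pi - x)) ({0..pi} \<inter> A)"
    by (simp only: refl)
  also have "\<dots> = emeasure lborel ((\<lambda>x. pi - x) -` ({0..pi} \<inter> A))"
    using A by (subst emeasure_distr) auto
  also have "(\<lambda>x. pi - x) -` ({0..pi} \<inter> A) = {0..pi} \<inter> (\<lambda>x. pi - x) -` A" by auto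
  finally show "emeasure (distr angle_measure angle_measure (\<lambda>x. pi - x)) A = emeasure angle_measure A"
    using A pre by (subst emeasure_distr) (auto simp: emeasure_angle_measure)
qed simp

lemma measure_angle2_swap:
  assumes "A \<in> sets torus"
  shows "prod.swap -` A \<in> sets torus"
    and "measure torus (prod.swap -` A) = measure torus A"
proof -
  have meas: "prod.swap \<in> measurable torus torus"
    unfolding prod.swap_def[abs_def] by measurable
  show "prod.swap -` A \<in> sets torus"
    using measurable_sets[OF meas assms] by (simp add: space_pair_measure)
  have "torus = distr torus torus prod.swap"
    using angle2.distr_pair_swap by (simp add: prod.swap_def[abs_def] case_prod_beta')
  hence "measure torus A = measure (distr torus torus prod.swap) A" by simp
  also have "\<dots> = measure torus (prod.swap -` A)"
    using measure_distr[OF meas assms] by (simp add: space_pair_measure)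
  finally show "measure torus (prod.swap -` A) = measure torus A" ..
qed

definition reflect2 :: "real \<times> real \<Rightarrow> real \<times> real" where
  "reflect2 x = (pi - fst x, pi - snd x)"

lemma measure_angle2_reflect:
  assumes "A \<in> sets torus"
  shows "reflect2 -` A \<in> sets torus"
    and "measure torus (reflect2 -` A) = measure torus A"
proof -
  have m1: "(\<lambda>x. pi - x) \<in> measurable angle_measure angle_measure" by measurable
  have meas: "reflect2 \<in> measurable torus torus"
    unfolding reflect2_def[abs_def] by measurable
  show "reflect2 -` A \<in> sets torus"
    using measurable_sets[OF meas assms] by (simp add: space_pair_measure)
  have "torus = distr torus torus reflect2"
    using pair_measure_distr[OF m1 m1]
    by (simp add: distr_angle_measure_reflect angle.sigma_finite_measure_axioms
        reflect2_def[abs_def] case_prod_beta')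
  hence "measure torus A = measure (distr torus torus reflect2) A" by simp
  also have "\<dots> = measure torus (reflect2 -` A)"
    using measure_distr[OF meas assms] by (simp add: space_pair_measure)
  finally show "measure torus (reflect2 -` A) = measure torus A" ..
qed

text \<open>The measure is carried by the square, so a region may be cut down to it before the
  cosine is inverted.\<close>

lemma measure_angle2_square:
  assumes "A \<in> sets torus"
  shows "measure torus A = measure torus (A \<inter> {0..pi} \<times> {0..pi})"
proof -
  have "{0..pi} \<times> {0..pi} \<in> sets torus" by (intro pair_measureI) auto
  moreover have "measure torus ({0..pi} \<times> {0..pi}) = 1"
    using emeasure_angle_measure_interval(1)[of 0 pi]
    by (simp add: measure_def angle.emeasure_pair_measure_Times)
  ultimately show ?thesis
    using assms angle2.prob_eq_1[of "{0..pi} \<times> {0..pi}"]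
    by (intro angle2.finite_measure_eq_AE) auto
qed

text \<open>On \<open>[0, pi]\<close> the condition \<open>\<bar>cos t\<bar> < 1 / 2\<close> holds
  between \<open>pi / 3\<close> and \<open>2 * pi / 3\<close>, a third of the length; the open and
  the closed interval give the two bounds.\<close>

lemma measure_angle2_cos_fst:
  shows "1 / 3 \<le> measure torus {x. 2 * \<bar>fst (cos2 x)\<bar> - 1 < 0}"
    and "measure torus {x. 2 * \<bar>fst (cos2 x)\<bar> - 1 \<le> 0} \<le> 1 / 3"
proof -
  have m: "measure torus (S \<times> UNIV) = measure angle_measure S" if "S \<in> sets borel" for S
    using that angle.emeasure_space_1
    by (simp add: measure_def angle.emeasure_pair_measure_Times)
  have c: "cos (pi / 3) = 1 / 2" "cos (2 * pi / 3) = - (1 / 2)"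
    using cos_60 cos_120 by auto
  have cos_iff: "cos x < cos y \<longleftrightarrow> y < x" "cos x \<le> cos y \<longleftrightarrow> y \<le> x"
    if "0 \<le> x" "x \<le> pi" "0 \<le> y" "y \<le> pi" for x y
    using that by (auto simp: cos_mono_less_eq cos_mono_le_eq)
  have "1 / 3 = measure angle_measure {pi / 3<..<2 * pi / 3}"
    using emeasure_angle_measure_interval(2)[of "pi / 3" "2 * pi / 3"] by (simp add: measure_def)
  also have "\<dots> = measure torus ({pi / 3<..<2 * pi / 3} \<times> UNIV)" by (rule m[symmetric]) simp
  also have "\<dots> \<le> measure torus {x. 2 * \<bar>fst (cos2 x)\<bar> - 1 < 0}"
  proof (rule angle2.finite_measure_mono)
    have "{x \<in> space torus. 2 * \<bar>fst (cos2 x)\<bar> - 1 < 0} \<in> sets torus"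
      unfolding cos2_def by measurable
    thus "{x. 2 * \<bar>fst (cos2 x)\<bar> - 1 < 0} \<in> sets torus" by (simp add: space_pair_measure)
    show "{pi / 3<..<2 * pi / 3} \<times> UNIV \<subseteq> {x. 2 * \<bar>fst (cos2 x)\<bar> - 1 < 0}"
    proof safe
      fix t s :: real assume t: "t \<in> {pi / 3<..<2 * pi / 3}"
      hence "0 \<le> t" "t \<le> pi" using pi_gt_zero by (auto simp: field_simps)
      hence "cos t < 1 / 2" "- (1 / 2) < cos t"
        using t cos_iff(1)[of t "pi / 3"] cos_iff(1)[of "2 * pi / 3" t] c by auto
      thus "2 * \<bar>fst (cos2 (t, s))\<bar> - 1 < 0" by (simp add: cos2_def abs_if)
    qed
  qed
  finally show "1 / 3 \<le> measure torus {x. 2 * \<bar>fst (cos2 x)\<bar> - 1 < 0}" .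
  have meas: "{x \<in> space torus. 2 * \<bar>fst (cos2 x)\<bar> - 1 \<le> 0} \<in> sets torus"
    unfolding cos2_def by measurable
  hence "measure torus {x. 2 * \<bar>fst (cos2 x)\<bar> - 1 \<le> 0} =
      measure torus ({x. 2 * \<bar>fst (cos2 x)\<bar> - 1 \<le> 0} \<inter> {0..pi} \<times> {0..pi})"
    by (intro measure_angle2_square) (simp add: space_pair_measure)
  also have "\<dots> \<le> measure torus ({pi / 3..2 * pi / 3} \<times> UNIV)"
  proof (rule angle2.finite_measure_mono)
    show "{pi / 3..2 * pi / 3} \<times> UNIV \<in> sets torus" by (intro pair_measureI) auto
    show "{x. 2 * \<bar>fst (cos2 x)\<bar> - 1 \<le> 0} \<inter> {0..pi} \<times> {0..pi} \<subseteq> {pi / 3..2 * pi / 3} \<times> UNIV"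
    proof
      fix x assume x: "x \<in> {x. 2 * \<bar>fst (cos2 x)\<bar> - 1 \<le> 0} \<inter> {0..pi} \<times> {0..pi}"
      hence t: "2 * \<bar>cos (fst x)\<bar> - 1 \<le> 0" "fst x \<in> {0..pi}" by (auto simp: cos2_def)
      hence "cos (fst x) \<le> 1 / 2" "- (1 / 2) \<le> cos (fst x)" by linarith+
      hence "fst x \<in> {pi / 3..2 * pi / 3}"
        using t(2) cos_iff(2)[of "fst x" "pi / 3"] cos_iff(2)[of "2 * pi / 3" "fst x"] c by auto
      thus "x \<in> {pi / 3..2 * pi / 3} \<times> UNIV" by (cases x) simp
    qed
  qed
  also have "\<dots> = measure angle_measure {pi / 3..2 * pi / 3}" by (rule m) simp
  also have "\<dots> = 1 / 3"
    using emeasure_angle_measure_interval(1)[of "pi / 3" "2 * pi / 3"] by (simp add: measure_def)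
  finally show "measure torus {x. 2 * \<bar>fst (cos2 x)\<bar> - 1 \<le> 0} \<le> 1 / 3" .
qed

lemma measure_angle2_between:
  fixes f h :: "real \<Rightarrow> real"
  assumes ab: "0 \<le> a" "a \<le> b" "b \<le> pi"
    and cont: "continuous_on {a..b} f" "continuous_on {a..b} h"
    and le: "\<And>t. t \<in> {a..b} \<Longrightarrow> 0 \<le> f t \<and> f t \<le> h t \<and> h t \<le> pi"
  shows "{(t, s). t \<in> {a<..<b} \<and> f t < s \<and> s < h t} \<in> sets torus" (is "?O \<in> _")
    and "{(t, s). t \<in> {a..b} \<and> f t \<le> s \<and> s \<le> h t} \<in> sets torus" (is "?C \<in> _")
    and "measure torus {(t, s). t \<in> {a<..<b} \<and> f t < s \<and> s < h t} =
      integral {a..b} (\<lambda>t. h t - f t) / pi\<^sup>2"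
    and "measure torus {(t, s). t \<in> {a..b} \<and> f t \<le> s \<and> s \<le> h t} =
      integral {a..b} (\<lambda>t. h t - f t) / pi\<^sup>2"
proof -
  \<comment> \<open>Continuity is given on \<open>{a..b}\<close> only; composing with the clamp
    \<open>c\<close> yields functions measurable on the whole line with the same values on the
    interval.\<close>
  define c where "c t = max a (min b t)" for t
  have c: "continuous_on UNIV c" "\<And>t. c t \<in> {a..b}" "\<And>t. t \<in> {a..b} \<Longrightarrow> c t = t"
    using ab unfolding c_def by (auto intro!: continuous_intros)
  have [measurable]: "(\<lambda>t. f (c t)) \<in> borel_measurable borel" "(\<lambda>t. h (c t)) \<in> borel_measurable borel"
    by (intro borel_measurable_continuous_onI continuous_on_compose2[OF cont(1) c(1)]
        continuous_on_compose2[OF cont(2) c(1)]; use c(2) in blast)+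
  have "?O = {x \<in> space torus. fst x \<in> {a<..<b} \<and> f (c (fst x)) < snd x \<and> snd x < h (c (fst x))}"
    using c(3) by (auto simp: space_pair_measure)
  also have "\<dots> \<in> sets torus" by measurable
  finally show O: "?O \<in> sets torus" .
  have "?C = {x \<in> space torus. fst x \<in> {a..b} \<and> f (c (fst x)) \<le> snd x \<and> snd x \<le> h (c (fst x))}"
    using c(3) by (auto simp: space_pair_measure)
  also have "\<dots> \<in> sets torus" by measurable
  finally show C: "?C \<in> sets torus" .
  have cont': "continuous_on {a..b} (\<lambda>t. h t - f t)" by (intro continuous_intros cont)
  show "measure torus ?O = integral {a..b} (\<lambda>t. h t - f t) / pi\<^sup>2"
  proof (rule measure_angle2_region[OF ab cont' _ O])
    fix t assume "t \<in> {a<..<b}"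
    moreover from this have "Pair t -` ?O = {f t<..<h t}" by auto
    ultimately show "emeasure angle_measure (Pair t -` ?O) = ennreal ((h t - f t) / pi)"
      using le[of t] emeasure_angle_measure_interval(2)[of "f t" "h t"] by simp
  qed (use le in auto)
  show "measure torus ?C = integral {a..b} (\<lambda>t. h t - f t) / pi\<^sup>2"
  proof (rule measure_angle2_region[OF ab cont' _ C])
    fix t assume "t \<in> {a<..<b}"
    moreover from this have "Pair t -` ?C = {f t..h t}" by auto
    ultimately show "emeasure angle_measure (Pair t -` ?C) = ennreal ((h t - f t) / pi)"
      using le[of t] emeasure_angle_measure_interval(1)[of "f t" "h t"] by simp
  qed (use le in auto)
qed

section \<open>The limiting condition in degree 6\<close>

definition sextic_form :: "real \<times> real \<Rightarrow> real" where
  "sextic_form x = 3 * \<bar>fst x + snd x\<bar> + 3 / 2 * \<bar>1 + 2 * fst x * snd x\<bar> - 1"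

text \<open>Resolving the absolute value of \<open>1 - 2 * (v * w)\<close> leaves two conditions
  linear in \<open>w\<close>. In the case of equality the first describes the second arc of the
  integrals, and the second describes the first arc.\<close>

lemma sextic_form_iff:
  assumes "v \<le> w"
  shows "sextic_form (v, - w) < 0 \<longleftrightarrow> w * (6 - 6 * v) < 6 * v - 1 \<and> w * (6 + 6 * v) < 5 + 6 * v"
    and "sextic_form (v, - w) \<le> 0 \<longleftrightarrow> w * (6 - 6 * v) \<le> 6 * v - 1 \<and> w * (6 + 6 * v) \<le> 5 + 6 * v"
proof -
  have "\<bar>v - w\<bar> = w - v" using assms by simp
  hence eq: "sextic_form (v, - w) = 3 * (w - v) + 3 / 2 * \<bar>1 - 2 * (v * w)\<bar> - 1"
    by (simp add: sextic_form_def mult.assoc)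
  have "sextic_form (v, - w) < 0 \<longleftrightarrow> \<bar>1 - 2 * (v * w)\<bar> < 2 / 3 - 2 * (w - v)"
    unfolding eq by (auto simp: field_simps)
  thus "sextic_form (v, - w) < 0 \<longleftrightarrow> w * (6 - 6 * v) < 6 * v - 1 \<and> w * (6 + 6 * v) < 5 + 6 * v"
    unfolding abs_less_iff by (auto simp: algebra_simps)
  have "sextic_form (v, - w) \<le> 0 \<longleftrightarrow> \<bar>1 - 2 * (v * w)\<bar> \<le> 2 / 3 - 2 * (w - v)"
    unfolding eq by (auto simp: field_simps)
  thus "sextic_form (v, - w) \<le> 0 \<longleftrightarrow> w * (6 - 6 * v) \<le> 6 * v - 1 \<and> w * (6 + 6 * v) \<le> 5 + 6 * v"
    unfolding abs_le_iff by (auto simp: algebra_simps)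
qed

lemma arccos_less_iff: "0 \<le> t \<Longrightarrow> t \<le> pi \<Longrightarrow> -1 \<le> c \<Longrightarrow> c \<le> 1 \<Longrightarrow> t < arccos c \<longleftrightarrow> c < cos t"
  and less_arccos_iff: "0 \<le> t \<Longrightarrow> t \<le> pi \<Longrightarrow> -1 \<le> c \<Longrightarrow> c \<le> 1 \<Longrightarrow> arccos c < t \<longleftrightarrow> cos t < c"
  using cos_mono_less_eq[of t "arccos c"] cos_mono_less_eq[of "arccos c" t]
  by (simp_all add: cos_arccos arccos_lbound arccos_ubound)

section \<open>Antiderivatives\<close>

text \<open>The central binomial coefficients divided by \<open>4 ^ n\<close>, that is, the Taylor
  coefficients of \<open>1 / sqrt (1 - w)\<close>.\<close>

fun cbin :: "nat \<Rightarrow> real" where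
  "cbin 0 = 1"
| "cbin (Suc n) = cbin n * (2 * real n + 1) / (2 * real n + 2)"

lemma cbin_pos: "cbin n > 0"
  by (induction n) simp_all

text \<open>The Taylor polynomial with one further term whose coefficient \<open>D\<close> is free:
  \<open>D = 0\<close> gives a lower bound, and a \<open>D\<close> sufficiently above the true
  coefficient gives an upper bound on an interval.\<close>

definition invsqrt_poly :: "nat \<Rightarrow> real \<Rightarrow> real \<Rightarrow> real" where
  "invsqrt_poly M D w = (\<Sum>n\<le>M. cbin n * w ^ n) + D * w ^ Suc M"

definition arcsin_poly :: "nat \<Rightarrow> real \<Rightarrow> real \<Rightarrow> real" where
  "arcsin_poly M D z = (\<Sum>n\<le>M. cbin n / (2 * real n + 1) * z ^ (2 * n + 1)) + D / (2 * real M + 3) * z ^ (2 * M + 3)"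

text \<open>\<open>1 / sqrt (1 - w)\<close> solves \<open>2 * (1 - w) * q' = q\<close>. The
  recursion of \<open>cbin\<close> cancels all lower terms, so only the top ones remain as a
  defect.\<close>

lemma invsqrt_poly_ode:
  "2 * (1 - w) * ((\<Sum>n\<le>M. cbin n * (real n * w ^ (n - 1))) + D * (real (Suc M) * w ^ M)) - invsqrt_poly M D w =
     w ^ M * (D * (2 * real M + 2) - (2 * real M + 1) * cbin M - D * (2 * real M + 3) * w)"
proof -
  have "2 * (1 - w) * (\<Sum>n\<le>M. cbin n * (real n * w ^ (n - 1))) - (\<Sum>n\<le>M. cbin n * w ^ n) =
      - ((2 * real M + 1) * cbin M * w ^ M)"
  proof (induction M)
    case (Suc M)
    have c: "(2 * real M + 2) * cbin (Suc M) = (2 * real M + 1) * cbin M" by simp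
    have "2 * (1 - w) * (\<Sum>n\<le>Suc M. cbin n * (real n * w ^ (n - 1))) - (\<Sum>n\<le>Suc M. cbin n * w ^ n) =
        - ((2 * real M + 1) * cbin M * w ^ M) + ((2 * real M + 2) * cbin (Suc M)) * w ^ M -
        (2 * real M + 3) * cbin (Suc M) * w ^ Suc M"
      unfolding Suc.IH[symmetric] by (simp add: algebra_simps del: cbin.simps)
    also have "\<dots> = - ((2 * real (Suc M) + 1) * cbin (Suc M) * w ^ Suc M)"
      unfolding c by (simp add: algebra_simps del: cbin.simps)
    finally show ?case .
  qed simp
  moreover have "2 * (1 - w) * (a + D * (real (Suc M) * w ^ M)) - (b + D * w ^ Suc M) =
      (2 * (1 - w) * a - b) + w ^ M * (D * (2 * real M + 2) - D * (2 * real M + 3) * w)" for a b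
    by (simp add: algebra_simps)
  ultimately show ?thesis unfolding invsqrt_poly_def by (simp add: algebra_simps)
qed

lemma has_real_derivative_power: "((\<lambda>x. x ^ Suc n) has_real_derivative real (Suc n) * z ^ n) (at z)"
  using DERIV_pow[of "Suc n" z UNIV] by (simp del: power_Suc)

text \<open>With the exact function in place of the polynomial the product would be constantly 1.
  Its derivative is the defect of the differential equation over \<open>2 * sqrt (1 - w)\<close>,
  whose sign for \<open>w > 0\<close> is that of a factor linear in \<open>w\<close>.\<close>

lemma invsqrt_poly_deriv:
  assumes "w < 1"
  shows "((\<lambda>w. invsqrt_poly M D w * sqrt (1 - w)) has_real_derivative
    w ^ M * (D * (2 * real M + 2) - (2 * real M + 1) * cbin M - D * (2 * real M + 3) * w) / (2 * sqrt (1 - w))) (at w)"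
proof -
  define q' where "q' = (\<Sum>n\<le>M. cbin n * (real n * w ^ (n - 1))) + D * (real (Suc M) * w ^ M)"
  have s: "sqrt (1 - w) > 0" "sqrt (1 - w) * sqrt (1 - w) = 1 - w" using assms by simp_all
  have "((\<lambda>w. invsqrt_poly M D w) has_real_derivative q') (at w)"
    unfolding invsqrt_poly_def q'_def
    using DERIV_pow by (intro DERIV_add DERIV_sum DERIV_cmult has_real_derivative_power) simp
  hence "((\<lambda>w. invsqrt_poly M D w * sqrt (1 - w)) has_real_derivative
      q' * sqrt (1 - w) + (- 1 * (inverse (sqrt (1 - w)) / 2)) * invsqrt_poly M D w) (at w)"
    using assms by (intro DERIV_mult DERIV_chain2[OF DERIV_real_sqrt]) (auto intro!: derivative_eq_intros)
  also have "q' * sqrt (1 - w) + (- 1 * (inverse (sqrt (1 - w)) / 2)) * invsqrt_poly M D w =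
      (2 * (sqrt (1 - w) * sqrt (1 - w)) * q' - invsqrt_poly M D w) / (2 * sqrt (1 - w))"
    using s(1) by (simp add: field_simps)
  also have "\<dots> = w ^ M * (D * (2 * real M + 2) - (2 * real M + 1) * cbin M - D * (2 * real M + 3) * w) / (2 * sqrt (1 - w))"
    unfolding s(2) q'_def invsqrt_poly_ode ..
  finally show ?thesis .
qed

lemma invsqrt_poly_0: "invsqrt_poly M D 0 = 1"
  by (simp add: invsqrt_poly_def power_0_left if_distrib[of "\<lambda>x. _ * x"] cong: if_cong)

lemma invsqrt_poly_le:
  assumes "0 \<le> w" "w < 1" "0 \<le> D" "D * (2 * real M + 2) \<le> (2 * real M + 1) * cbin M"
  shows "invsqrt_poly M D w \<le> 1 / sqrt (1 - w)"
proof -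
  have "invsqrt_poly M D w * sqrt (1 - w) \<le> invsqrt_poly M D 0 * sqrt (1 - 0)"
  proof (rule DERIV_nonpos_imp_nonincreasing[OF assms(1)])
    fix x assume x: "0 \<le> x" "x \<le> w"
    have "D * (2 * real M + 3) * x \<ge> 0" using x assms by simp
    hence "D * (2 * real M + 2) - (2 * real M + 1) * cbin M - D * (2 * real M + 3) * x \<le> 0"
      using assms(4) by linarith
    hence "x ^ M * (D * (2 * real M + 2) - (2 * real M + 1) * cbin M - D * (2 * real M + 3) * x) / (2 * sqrt (1 - x)) \<le> 0"
      using x assms(2) by (intro divide_nonpos_nonneg mult_nonneg_nonpos) auto
    thus "\<exists>y. ((\<lambda>w. invsqrt_poly M D w * sqrt (1 - w)) has_real_derivative y) (at x) \<and> y \<le> 0"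
      using invsqrt_poly_deriv[of x M D] x assms(2) by auto
  qed
  thus ?thesis using assms by (simp add: invsqrt_poly_0 field_simps)
qed

text \<open>For \<open>D \<ge> 0\<close> the linear factor decreases in \<open>w\<close>, so its
  sign has to be checked only at the right end \<open>W\<close>.\<close>

lemma invsqrt_poly_ge:
  assumes "0 \<le> w" "w \<le> W" "W < 1" "0 \<le> D"
    and "(2 * real M + 1) * cbin M \<le> D * (2 * real M + 2) - D * (2 * real M + 3) * W"
  shows "1 / sqrt (1 - w) \<le> invsqrt_poly M D w"
proof -
  have "invsqrt_poly M D 0 * sqrt (1 - 0) \<le> invsqrt_poly M D w * sqrt (1 - w)"
  proof (rule DERIV_nonneg_imp_nondecreasing[OF assms(1)])
    fix x assume x: "0 \<le> x" "x \<le> w"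
    have "D * (2 * real M + 3) * x \<le> D * (2 * real M + 3) * W"
      using x assms by (intro mult_left_mono) auto
    hence "D * (2 * real M + 2) - (2 * real M + 1) * cbin M - D * (2 * real M + 3) * x \<ge> 0"
      using assms(5) by linarith
    hence "x ^ M * (D * (2 * real M + 2) - (2 * real M + 1) * cbin M - D * (2 * real M + 3) * x) / (2 * sqrt (1 - x)) \<ge> 0"
      using x assms(2,3) by (intro divide_nonneg_nonneg mult_nonneg_nonneg) auto
    thus "\<exists>y. ((\<lambda>w. invsqrt_poly M D w * sqrt (1 - w)) has_real_derivative y) (at x) \<and> y \<ge> 0"
      using invsqrt_poly_deriv[of x M D] x assms(2,3) by auto
  qed
  thus ?thesis using assms by (simp add: invsqrt_poly_0 field_simps)
qed

lemma arcsin_poly_deriv: "(arcsin_poly M D has_real_derivative invsqrt_poly M D (z\<^sup>2)) (at z)"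
proof -
  have "((\<lambda>z. cbin n / (2 * real n + 1) * z ^ (2 * n + 1)) has_real_derivative cbin n * (z\<^sup>2) ^ n) (at z)" for n
  proof -
    have "((\<lambda>z. cbin n / (2 * real n + 1) * z ^ (2 * n + 1)) has_real_derivative
      cbin n / (2 * real n + 1) * (real (2 * n + 1) * z ^ (2 * n))) (at z)"
      using has_real_derivative_power[of "2 * n"] by (intro DERIV_cmult) simp
    moreover have "cbin n / (2 * real n + 1) * (real (2 * n + 1) * z ^ (2 * n)) = cbin n * (z\<^sup>2) ^ n"
      unfolding power_mult by (simp add: add.commute)
    ultimately show ?thesis by simp
  qed
  moreover have "((\<lambda>z. D / (2 * real M + 3) * z ^ (2 * M + 3)) has_real_derivative D * (z\<^sup>2) ^ Suc M) (at z)"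
  proof -
    have "((\<lambda>z. D / (2 * real M + 3) * z ^ (2 * M + 3)) has_real_derivative
      D / (2 * real M + 3) * (real (2 * M + 3) * z ^ (2 * Suc M))) (at z)"
      using has_real_derivative_power[of "2 * Suc M"] by (intro DERIV_cmult) (simp add: numeral_eq_Suc)
    moreover have "D / (2 * real M + 3) * (real (2 * M + 3) * z ^ (2 * Suc M)) = D * (z\<^sup>2) ^ Suc M"
      unfolding power_mult by simp
    ultimately show ?thesis by (simp only:)
  qed
  ultimately show ?thesis unfolding arcsin_poly_def[abs_def] invsqrt_poly_def
    by (intro DERIV_add DERIV_sum)
qed

lemma arcsin_poly_0: "arcsin_poly M D 0 = 0"
  by (simp add: arcsin_poly_def)

lemma arcsin_diff_deriv:
  assumes "0 \<le> z" "z < 1"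
  shows "((\<lambda>z. arcsin z - arcsin_poly M D z) has_real_derivative
    1 / sqrt (1 - z\<^sup>2) - invsqrt_poly M D (z\<^sup>2)) (at z)"
  using assms by (auto intro!: derivative_eq_intros arcsin_poly_deriv simp: divide_inverse)

lemma arcsin_poly_le:
  assumes "0 \<le> z" "z < 1" "0 \<le> D" "D * (2 * real M + 2) \<le> (2 * real M + 1) * cbin M"
  shows "arcsin_poly M D z \<le> arcsin z"
proof -
  have "arcsin 0 - arcsin_poly M D 0 \<le> arcsin z - arcsin_poly M D z"
  proof (rule DERIV_nonneg_imp_nondecreasing[OF assms(1)])
    fix x assume x: "0 \<le> x" "x \<le> z"
    hence "x\<^sup>2 < 1" using assms by (simp add: power_less_one_iff abs_square_less_1)
    thus "\<exists>y. ((\<lambda>z. arcsin z - arcsin_poly M D z) has_real_derivative y) (at x) \<and> y \<ge> 0"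
      using arcsin_diff_deriv[of x M D] invsqrt_poly_le[of "x\<^sup>2" D M] x assms by force
  qed
  thus ?thesis by (simp add: arcsin_poly_0)
qed

lemma arcsin_poly_ge:
  assumes "0 \<le> z" "z\<^sup>2 \<le> W" "W < 1" "0 \<le> D"
    and "(2 * real M + 1) * cbin M \<le> D * (2 * real M + 2) - D * (2 * real M + 3) * W"
  shows "arcsin z \<le> arcsin_poly M D z"
proof -
  have "arcsin z - arcsin_poly M D z \<le> arcsin 0 - arcsin_poly M D 0"
  proof (rule DERIV_nonpos_imp_nonincreasing[OF assms(1)])
    fix x assume x: "0 \<le> x" "x \<le> z"
    hence "x\<^sup>2 \<le> z\<^sup>2" by (intro power_mono)
    hence "x\<^sup>2 \<le> W" using assms(2) by (rule order_trans)
    moreover from this have "x < 1" using assms(3) x by (smt (verit) one_le_power)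
    ultimately show "\<exists>y. ((\<lambda>z. arcsin z - arcsin_poly M D z) has_real_derivative y) (at x) \<and> y \<le> 0"
      using arcsin_diff_deriv[of x M D] invsqrt_poly_ge[of "x\<^sup>2" W D M] x assms by force
  qed
  thus ?thesis by (simp add: arcsin_poly_0)
qed

text \<open>Antiderivatives of the odd powers of the secant, as functions of
  \<open>u = sin x\<close>, \<open>y = 1 / cos\<^sup>2 x\<close> and \<open>L = artanh (sin x)\<close>.\<close>

fun sec_int :: "nat \<Rightarrow> real \<Rightarrow> real \<Rightarrow> real \<Rightarrow> real" where
  "sec_int 0 u y L = L"
| "sec_int (Suc n) u y L = u * y ^ Suc n / (2 * real n + 2) + (2 * real n + 1) / (2 * real n + 2) * sec_int n u y L"

lemma sec_int_nonneg: "0 \<le> u \<Longrightarrow> 0 \<le> y \<Longrightarrow> 0 \<le> L \<Longrightarrow> 0 \<le> sec_int n u y L"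
  by (induction n) simp_all

abbreviation sec_int_at :: "nat \<Rightarrow> real \<Rightarrow> real" where
  "sec_int_at n x \<equiv> sec_int n (sin x) (1 / (cos x)\<^sup>2) (artanh (sin x))"

text \<open>The reduction formula for the secant: the derivative of
  \<open>sin x / cos x ^ (2 * n + 2)\<close> is \<open>(2 * n + 2) / cos x ^ (2 * n + 3)\<close>
  minus \<open>(2 * n + 1) / cos x ^ (2 * n + 1)\<close>.\<close>

lemma sec_int_deriv:
  assumes "cos x > 0"
  shows "(sec_int_at n has_real_derivative 1 / cos x ^ (2 * n + 1)) (at x)"
proof (induction n)
  case 0
  have "(cos x)\<^sup>2 > 0" using assms by simp
  hence "(sin x)\<^sup>2 < 1" using sin_cos_squared_add[of x] by linarith
  hence s: "\<bar>sin x\<bar> < 1" by (simp only: abs_square_less_1)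
  have "((\<lambda>x. artanh (sin x)) has_real_derivative 1 / (1 - (sin x)\<^sup>2) * cos x) (at x)"
    using s by (intro DERIV_chain2[OF artanh_real_has_field_derivative[THEN DERIV_subset]]) (auto intro!: derivative_eq_intros)
  moreover have "1 / (1 - (sin x)\<^sup>2) * cos x = 1 / cos x ^ (2 * 0 + 1)"
    unfolding cos_squared_eq[symmetric] using assms by (simp add: power2_eq_square)
  ultimately show ?case by simp
next
  case (Suc n)
  have c: "(cos x)\<^sup>2 = 1 - (sin x)\<^sup>2" by (rule cos_squared_eq)
  have "((\<lambda>x. sin x / cos x ^ (2 * Suc n)) has_real_derivative
      (cos x * cos x ^ (2 * Suc n) - sin x * (real (2 * Suc n) * cos x ^ (2 * n + 1) * - sin x)) /
      (cos x ^ (2 * Suc n) * cos x ^ (2 * Suc n))) (at x)"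
  proof (intro DERIV_divide DERIV_sin)
    show "((\<lambda>x. cos x ^ (2 * Suc n)) has_real_derivative real (2 * Suc n) * cos x ^ (2 * n + 1) * - sin x) (at x)"
      using DERIV_chain2[OF has_real_derivative_power[of "2 * n + 1"] DERIV_cos[of x]]
      by (simp del: power_Suc)
  qed (use assms in simp)
  also have "(cos x * cos x ^ (2 * Suc n) - sin x * (real (2 * Suc n) * cos x ^ (2 * n + 1) * - sin x)) /
      (cos x ^ (2 * Suc n) * cos x ^ (2 * Suc n)) =
      (real (2 * n + 2) - real (2 * n + 1) * (cos x)\<^sup>2) / cos x ^ (2 * n + 3)"
  proof -
    define C where "C = cos x"
    have s2: "sin x * sin x = 1 - C * C" using c by (simp add: C_def power2_eq_square)
    have "C * C ^ (2 * Suc n) - sin x * (real (2 * Suc n) * C ^ (2 * n + 1) * - sin x) =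
        C ^ (2 * n + 1) * (C * C + real (2 * Suc n) * (sin x * sin x))"
      by (simp add: power_add algebra_simps)
    also have "\<dots> = C ^ (2 * n + 1) * (real (2 * n + 2) - real (2 * n + 1) * C\<^sup>2)"
      unfolding s2 by (simp add: algebra_simps power2_eq_square)
    finally have "C * C ^ (2 * Suc n) - sin x * (real (2 * Suc n) * C ^ (2 * n + 1) * - sin x) =
      C ^ (2 * n + 1) * (real (2 * n + 2) - real (2 * n + 1) * C\<^sup>2)" .
    moreover have "C ^ (2 * Suc n) * C ^ (2 * Suc n) = C ^ (2 * n + 1) * C ^ (2 * n + 3)"
      unfolding power_add[symmetric] by (simp add: numeral_eq_Suc)
    ultimately show ?thesis using assms unfolding C_def[symmetric] by simp
  qed
  finally have d: "((\<lambda>x. sin x / cos x ^ (2 * Suc n)) has_real_derivative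
      (real (2 * n + 2) - real (2 * n + 1) * (cos x)\<^sup>2) / cos x ^ (2 * n + 3)) (at x)" .
  have "((\<lambda>x. sin x / cos x ^ (2 * Suc n) / (2 * real n + 2) + (2 * real n + 1) / (2 * real n + 2) * sec_int_at n x)
     has_real_derivative
      (real (2 * n + 2) - real (2 * n + 1) * (cos x)\<^sup>2) / cos x ^ (2 * n + 3) / (2 * real n + 2) +
      (2 * real n + 1) / (2 * real n + 2) * (1 / cos x ^ (2 * n + 1))) (at x)"
    by (intro DERIV_add DERIV_cdivide d DERIV_cmult Suc)
  also have "(\<lambda>x. sin x / cos x ^ (2 * Suc n) / (2 * real n + 2) + (2 * real n + 1) / (2 * real n + 2) * sec_int_at n x) =
      sec_int_at (Suc n)"
    unfolding sec_int.simps power_mult power_one_over by simp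
  also have "(real (2 * n + 2) - real (2 * n + 1) * (cos x)\<^sup>2) / cos x ^ (2 * n + 3) / (2 * real n + 2) +
      (2 * real n + 1) / (2 * real n + 2) * (1 / cos x ^ (2 * n + 1)) = 1 / cos x ^ (2 * Suc n + 1)"
  proof -
    define C where "C = cos x"
    have "C > 0" using assms by (simp add: C_def)
    hence "1 / C ^ (2 * n + 1) = C\<^sup>2 / C ^ (2 * n + 3)"
      by (simp add: power_add field_simps numeral_eq_Suc)
    moreover have "(a - b * c) / q / a + b / a * (c / q) = 1 / q" if "q > 0" "a > 0" for a b c q :: real
      using that by (simp add: field_simps)
    from this[of "C ^ (2 * n + 3)" "2 * real n + 2" "2 * real n + 1" "C\<^sup>2"]
    have "(real (2 * n + 2) - real (2 * n + 1) * C\<^sup>2) / C ^ (2 * n + 3) / (2 * real n + 2) +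
      (2 * real n + 1) / (2 * real n + 2) * (C\<^sup>2 / C ^ (2 * n + 3)) = 1 / C ^ (2 * n + 3)"
      using \<open>C > 0\<close> by (simp add: add.commute)
    ultimately show ?thesis using \<open>C > 0\<close> unfolding C_def[symmetric] by (simp add: numeral_eq_Suc)
  qed
  finally show ?case .
qed

text \<open>Termwise antiderivative of \<open>arcsin_poly M D (k / cos x) / k\<close>, with
  \<open>\<kappa>\<close> for \<open>k\<^sup>2\<close>, which is rational in the application
  although \<open>k\<close> is a square root.\<close>

definition sec_series :: "real \<Rightarrow> nat \<Rightarrow> real \<Rightarrow> real \<Rightarrow> real \<Rightarrow> real \<Rightarrow> real" where
  "sec_series \<kappa> M D u y L = (\<Sum>n\<le>M. cbin n / (2 * real n + 1) * \<kappa> ^ n * sec_int n u y L) +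
     D / (2 * real M + 3) * \<kappa> ^ Suc M * sec_int (Suc M) u y L"

definition arcsin_sec_int :: "real \<Rightarrow> nat \<Rightarrow> real \<Rightarrow> real \<Rightarrow> real" where
  "arcsin_sec_int k M D x = k * sec_series (k\<^sup>2) M D (sin x) (1 / (cos x)\<^sup>2) (artanh (sin x))"

lemma arcsin_sec_int_deriv:
  assumes "cos x > 0"
  shows "(arcsin_sec_int k M D has_real_derivative arcsin_poly M D (k / cos x)) (at x)"
proof -
  have "(arcsin_sec_int k M D has_real_derivative
    k * ((\<Sum>n\<le>M. cbin n / (2 * real n + 1) * (k\<^sup>2) ^ n * (1 / cos x ^ (2 * n + 1))) +
      D / (2 * real M + 3) * (k\<^sup>2) ^ Suc M * (1 / cos x ^ (2 * Suc M + 1)))) (at x)"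
    unfolding arcsin_sec_int_def[abs_def] sec_series_def
    by (intro DERIV_cmult DERIV_add DERIV_sum sec_int_deriv assms)
  also have "k * ((\<Sum>n\<le>M. cbin n / (2 * real n + 1) * (k\<^sup>2) ^ n * (1 / cos x ^ (2 * n + 1))) +
      D / (2 * real M + 3) * (k\<^sup>2) ^ Suc M * (1 / cos x ^ (2 * Suc M + 1))) = arcsin_poly M D (k / cos x)"
  proof -
    have eq: "k * (c * (k\<^sup>2) ^ n * (1 / cos x ^ (2 * n + 1))) = c * (k / cos x) ^ (2 * n + 1)" for c n
      by (simp add: power_divide power_mult)
    have e: "2 * M + 3 = 2 * Suc M + 1" by simp
    show ?thesis
      unfolding arcsin_poly_def distrib_left sum_distrib_left eq e ..
  qed
  finally show ?thesis .
qed

section \<open>Half angles and bounds for integrals\<close>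

lemma half_angle_squares:
  fixes t :: real
  shows "(cos (t / 2))\<^sup>2 = (1 + cos t) / 2" "(sin (t / 2))\<^sup>2 = (1 - cos t) / 2"
  using cos_double_cos[of "t / 2"] cos_double_sin[of "t / 2"] by simp_all

lemma arccos_eq_double_arcsin:
  assumes "0 \<le> q" "q \<le> 1"
  shows "arccos (1 - 2 * q\<^sup>2) = 2 * arcsin q"
proof -
  have "cos (2 * arcsin q) = 1 - 2 * q\<^sup>2" using assms by (simp add: cos_double_sin)
  moreover have "0 \<le> arcsin q" "arcsin q \<le> pi / 2"
    using assms arcsin_le_mono[of 0 q] arcsin_ubound[of q] by auto
  ultimately show ?thesis by (metis arccos_cos mult_2 field_sum_of_halves add_mono zero_le_mult_iff zero_le_numeral)
qed

lemma arccos_eq_double_arccos: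
  assumes "0 \<le> q" "q \<le> 1"
  shows "arccos (2 * q\<^sup>2 - 1) = 2 * arccos q"
proof -
  have "cos (2 * arccos q) = 2 * q\<^sup>2 - 1" using assms by (simp add: cos_double_cos)
  moreover have "0 \<le> arccos q" "arccos q \<le> pi / 2"
    using assms arccos_lbound[of q] arccos_le_pi2[of q] by auto
  ultimately show ?thesis by (metis arccos_cos mult_2 field_sum_of_halves add_mono zero_le_mult_iff zero_le_numeral)
qed

text \<open>\<open>\<Phi>\<close> is an antiderivative of some function on one side of
  \<open>f\<close>; in the application that function comes from a polynomial bound for the
  arcsine.\<close>

lemma integral_bound_antideriv:
  fixes f \<Phi> :: "real \<Rightarrow> real"
  assumes "a \<le> b" "continuous_on {a..b} f"
  shows "(\<And>t. t \<in> {a..b} \<Longrightarrow> \<exists>d. (\<Phi> has_real_derivative d) (at t) \<and> f t \<le> d) \<Longrightarrow>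
      integral {a..b} f \<le> \<Phi> b - \<Phi> a"
    and "(\<And>t. t \<in> {a..b} \<Longrightarrow> \<exists>d. (\<Phi> has_real_derivative d) (at t) \<and> d \<le> f t) \<Longrightarrow>
      \<Phi> b - \<Phi> a \<le> integral {a..b} f"
proof -
  have f: "(f has_integral integral {a..b} f) {a..b}"
    using assms(2) by (intro integrable_integral integrable_continuous_interval)
  have ftc: "(\<phi> has_integral (\<Phi> b - \<Phi> a)) {a..b}"
    if "\<And>t. t \<in> {a..b} \<Longrightarrow> (\<Phi> has_real_derivative \<phi> t) (at t)" for \<phi>
    using that assms(1)
    by (intro fundamental_theorem_of_calculus)
       (auto simp: has_real_derivative_iff_has_vector_derivative[symmetric] intro: DERIV_subset)
  show "integral {a..b} f \<le> \<Phi> b - \<Phi> a"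
    if "\<And>t. t \<in> {a..b} \<Longrightarrow> \<exists>d. (\<Phi> has_real_derivative d) (at t) \<and> f t \<le> d"
  proof -
    have "\<forall>t\<in>{a..b}. \<exists>d. (\<Phi> has_real_derivative d) (at t) \<and> f t \<le> d" using that by blast
    from bchoice[OF this] obtain \<phi> where
      "\<And>t. t \<in> {a..b} \<Longrightarrow> (\<Phi> has_real_derivative \<phi> t) (at t) \<and> f t \<le> \<phi> t" by blast
    thus ?thesis using has_integral_le[OF f ftc] by blast
  qed
  show "\<Phi> b - \<Phi> a \<le> integral {a..b} f"
    if "\<And>t. t \<in> {a..b} \<Longrightarrow> \<exists>d. (\<Phi> has_real_derivative d) (at t) \<and> d \<le> f t"
  proof -
    have "\<forall>t\<in>{a..b}. \<exists>d. (\<Phi> has_real_derivative d) (at t) \<and> d \<le> f t" using that by blast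
    from bchoice[OF this] obtain \<phi> where
      "\<And>t. t \<in> {a..b} \<Longrightarrow> (\<Phi> has_real_derivative \<phi> t) (at t) \<and> \<phi> t \<le> f t" by blast
    thus ?thesis using has_integral_le[OF ftc f] by blast
  qed
qed

section \<open>The boundary curves\<close>

context
  fixes x y z t0 t1 t2 :: real and h1 h2 :: "real \<Rightarrow> real" and k1 k2 :: real and g :: "real \<Rightarrow> real"
  defines "x \<equiv> sqrt 30 / 6" and "y \<equiv> sqrt 6 / 6" and "z \<equiv> (sqrt 19 - 1) / 6"
    and "t0 \<equiv> arccos x" and "t1 \<equiv> arccos z" and "t2 \<equiv> arccos y"
    and "h1 \<equiv> \<lambda>t. arccos ((- 5 - 6 * cos t) / (6 + 6 * cos t))"
    and "h2 \<equiv> \<lambda>t. arccos ((1 - 6 * cos t) / (6 - 6 * cos t))"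
    and "k1 \<equiv> sqrt (1 / 24)" and "k2 \<equiv> sqrt (5 / 24)"
    and "g \<equiv> \<lambda>b. arccos (k2 / sin b)"
begin

text \<open>In terms of \<open>v = cos t\<close>, the first arc meets the line
  \<open>t + s = pi\<close> where \<open>v\<^sup>2 = 5 / 6\<close>, the second where
  \<open>v\<^sup>2 = 1 / 6\<close>, and the arcs cross where
  \<open>6 * v\<^sup>2 + 2 * v = 3\<close>. The solutions are \<open>x\<close>, \<open>y\<close> and
  \<open>z\<close>.\<close>

lemma endpoint_facts:
  shows "x\<^sup>2 = 5 / 6" "y\<^sup>2 = 1 / 6" "6 * z\<^sup>2 + 2 * z = 3"
    and "0 < y" "y < z" "z < 7 / 12" "z < x" "x < 1"
proof -
  show "x\<^sup>2 = 5 / 6" "y\<^sup>2 = 1 / 6" by (simp_all add: x_def y_def power_divide)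
  show "6 * z\<^sup>2 + 2 * z = 3" by (simp add: z_def power2_eq_square field_simps)
  show "0 < y" by (simp add: y_def)
  have "sqrt 6 < 3" "4 < sqrt 19" "sqrt 19 < 4.5" "5 < sqrt 30" "sqrt 30 < 6"
    by (rule real_less_lsqrt real_less_rsqrt; simp add: power2_eq_square)+
  thus "y < z" "z < 7 / 12" "z < x" "x < 1" by (simp_all add: x_def y_def z_def)
qed

lemma endpoint_angles: "0 < t0" "t0 < t1" "t1 < t2" "t2 < pi / 2"
  using endpoint_facts arccos_less_arccos[of z x] arccos_less_arccos[of y z]
    arccos_less_arccos[of 0 y] arccos_less_arccos[of x 1]
  by (auto simp: t0_def t1_def t2_def)

lemma cos_endpoint_iff:
  assumes "0 \<le> t" "t \<le> pi"
  shows "t0 < t \<longleftrightarrow> cos t < x" "t < t1 \<longleftrightarrow> z < cos t" "t1 < t \<longleftrightarrow> cos t < z" "t < t2 \<longleftrightarrow> y < cos t"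
    "t0 \<le> t \<longleftrightarrow> cos t \<le> x" "t \<le> t1 \<longleftrightarrow> z \<le> cos t" "t1 \<le> t \<longleftrightarrow> cos t \<le> z" "t \<le> t2 \<longleftrightarrow> y \<le> cos t"
  using arccos_less_iff[OF assms, of x] arccos_less_iff[OF assms, of y] arccos_less_iff[OF assms, of z]
    less_arccos_iff[OF assms, of x] less_arccos_iff[OF assms, of y] less_arccos_iff[OF assms, of z]
    endpoint_facts
  by (simp_all add: t0_def t1_def t2_def flip: not_less)

text \<open>The last bound places the arc on or above the line \<open>t + s = pi\<close>; multiplied
  out it is \<open>v\<^sup>2 \<le> x\<^sup>2\<close>.\<close>

lemma first_branch:
  assumes "t \<in> {t0..t1}"
  defines "v \<equiv> cos t"
  shows "z \<le> v" "v \<le> x" "-1 \<le> (- 5 - 6 * v) / (6 + 6 * v)" "(- 5 - 6 * v) / (6 + 6 * v) \<le> - v"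
proof -
  have t: "0 \<le> t" "t \<le> pi" using assms endpoint_angles pi_gt_zero by auto
  show v: "z \<le> v" "v \<le> x" using assms cos_endpoint_iff[OF t] by auto
  hence pos: "v > 0" using endpoint_facts by linarith
  show "-1 \<le> (- 5 - 6 * v) / (6 + 6 * v)" using pos by (simp add: field_simps)
  have "v\<^sup>2 \<le> x\<^sup>2" using v pos by (intro power_mono) auto
  thus "(- 5 - 6 * v) / (6 + 6 * v) \<le> - v"
    using pos endpoint_facts(1) by (simp add: field_simps power2_eq_square)
qed

lemma second_branch:
  assumes "t \<in> {t1..t2}"
  defines "v \<equiv> cos t"
  shows "y \<le> v" "v \<le> z" "-1 \<le> (1 - 6 * v) / (6 - 6 * v)" "(1 - 6 * v) / (6 - 6 * v) \<le> - v"
proof -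
  have t: "0 \<le> t" "t \<le> pi" using assms endpoint_angles pi_gt_zero by auto
  show v: "y \<le> v" "v \<le> z" using assms cos_endpoint_iff[OF t] by auto
  hence pos: "v > 0" "v < 7 / 12" using endpoint_facts by linarith+
  show "-1 \<le> (1 - 6 * v) / (6 - 6 * v)" using pos by (simp add: field_simps)
  have "y\<^sup>2 \<le> v\<^sup>2" using v endpoint_facts by (intro power_mono) auto
  thus "(1 - 6 * v) / (6 - 6 * v) \<le> - v"
    using pos endpoint_facts(2) by (simp add: field_simps power2_eq_square)
qed

lemma branch_bounds:
  shows "t \<in> {t0..t1} \<Longrightarrow> 0 \<le> pi - t \<and> pi - t \<le> h1 t \<and> h1 t \<le> pi"
    and "t \<in> {t1..t2} \<Longrightarrow> 0 \<le> pi - t \<and> pi - t \<le> h2 t \<and> h2 t \<le> pi"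
proof -
  have le: "pi - t \<le> arccos c" if "0 \<le> t" "t \<le> pi / 2" "-1 \<le> c" "c \<le> - cos t" for t c
  proof -
    have "c \<le> 1" using that cos_ge_zero[of t] by linarith
    thus ?thesis using less_arccos_iff[of "pi - t" c] that pi_gt_zero by (simp add: not_less[symmetric])
  qed
  show "0 \<le> pi - t \<and> pi - t \<le> h1 t \<and> h1 t \<le> pi" if t: "t \<in> {t0..t1}"
    using le[of t "(- 5 - 6 * cos t) / (6 + 6 * cos t)"] first_branch[OF t] t endpoint_angles pi_gt_zero
      arccos_ubound[of "(- 5 - 6 * cos t) / (6 + 6 * cos t)"] cos_ge_zero[of t]
    unfolding h1_def by fastforce
  show "0 \<le> pi - t \<and> pi - t \<le> h2 t \<and> h2 t \<le> pi" if t: "t \<in> {t1..t2}"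
    using le[of t "(1 - 6 * cos t) / (6 - 6 * cos t)"] second_branch[OF t] t endpoint_angles pi_gt_zero
      arccos_ubound[of "(1 - 6 * cos t) / (6 - 6 * cos t)"] cos_ge_zero[of t]
    unfolding h2_def by fastforce
qed

lemma branch_continuous: "continuous_on {t0..t1} h1" "continuous_on {t1..t2} h2"
proof -
  show "continuous_on {t0..t1} h1" unfolding h1_def
  proof (intro continuous_on_arccos' continuous_intros ballI)
    fix t assume t: "t \<in> {t0..t1}"
    note f = first_branch[OF t] endpoint_facts
    show "6 + 6 * cos t \<noteq> 0" using f by auto
    show "- 1 \<le> (- 5 - 6 * cos t) / (6 + 6 * cos t) \<and> (- 5 - 6 * cos t) / (6 + 6 * cos t) \<le> 1"
      using f by linarith
  qed
  show "continuous_on {t1..t2} h2" unfolding h2_def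
  proof (intro continuous_on_arccos' continuous_intros ballI)
    fix t assume t: "t \<in> {t1..t2}"
    note f = second_branch[OF t] endpoint_facts
    show "6 - 6 * cos t \<noteq> 0" using f by auto
    show "- 1 \<le> (1 - 6 * cos t) / (6 - 6 * cos t) \<and> (1 - 6 * cos t) / (6 - 6 * cos t) \<le> 1"
      using f by linarith
  qed
qed

text \<open>The lower of the two arcs bounds the region, and which one is lower depends on the
  position of \<open>cos t\<close> relative to the crossing \<open>z\<close>. So the assumption on
  one arc implies the condition belonging to the other.\<close>

lemma sextic_form_neg:
  assumes "(t0 < t \<and> t < t1 \<and> pi - t < s \<and> s < h1 t) \<or> (t1 < t \<and> t < t2 \<and> pi - t < s \<and> s < h2 t)"
  shows "sextic_form (cos t, cos s) < 0"
proof -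
  define v w where "v = cos t" and "w = - cos s"
  note ep = endpoint_facts endpoint_angles
  have t: "0 \<le> t" "t \<le> pi" "t < pi / 2" using assms ep pi_gt_zero by auto
  have s: "pi - t < s" "s \<le> pi"
    using assms branch_bounds[of t] by auto
  have "cos s < cos (pi - t)" using s t by (subst cos_mono_less_eq) auto
  hence vw: "v < w" by (simp add: v_def w_def)
  from assms have "w * (6 - 6 * v) < 6 * v - 1 \<and> w * (6 + 6 * v) < 5 + 6 * v"
  proof
    assume *: "t0 < t \<and> t < t1 \<and> pi - t < s \<and> s < h1 t"
    hence "t \<in> {t0..t1}" by auto
    note f = first_branch[OF this, folded v_def]
    have v: "0 < v" "v < 1" using f ep by linarith+
    have "(- 5 - 6 * v) / (6 + 6 * v) < cos s"
      using * s t f v arccos_less_iff[of s "(- 5 - 6 * v) / (6 + 6 * v)"] by (auto simp: h1_def v_def)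
    hence 1: "w * (6 + 6 * v) < 5 + 6 * v" using v by (simp add: w_def field_simps)
    have "z\<^sup>2 \<le> v\<^sup>2" using f ep by (intro power_mono) auto
    hence "6 * v\<^sup>2 + 2 * v \<ge> 3" using ep(3) f(1) by linarith
    \<comment> \<open>The comparison of the two arcs with denominators cleared.\<close>
    hence "(5 + 6 * v) * (6 - 6 * v) \<le> (6 * v - 1) * (6 + 6 * v)"
      by (simp add: algebra_simps power2_eq_square)
    moreover have "w * (6 + 6 * v) * (6 - 6 * v) < (5 + 6 * v) * (6 - 6 * v)"
      using 1 v by (intro mult_strict_right_mono) auto
    ultimately have "(w * (6 - 6 * v)) * (6 + 6 * v) < (6 * v - 1) * (6 + 6 * v)"
      by (simp only: mult_ac)
    with 1 v show ?thesis by (auto simp: mult_less_cancel_right)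
  next
    assume *: "t1 < t \<and> t < t2 \<and> pi - t < s \<and> s < h2 t"
    hence "t \<in> {t1..t2}" by auto
    note f = second_branch[OF this, folded v_def]
    have v: "0 < v" "v < 1" using f ep by linarith+
    have "(1 - 6 * v) / (6 - 6 * v) < cos s"
      using * s t f v arccos_less_iff[of s "(1 - 6 * v) / (6 - 6 * v)"] by (auto simp: h2_def v_def)
    hence 1: "w * (6 - 6 * v) < 6 * v - 1" using v by (simp add: w_def field_simps)
    have "v\<^sup>2 \<le> z\<^sup>2" using f v by (intro power_mono) auto
    hence "6 * v\<^sup>2 + 2 * v \<le> 3" using ep(3) f(2) by linarith
    hence "(6 * v - 1) * (6 + 6 * v) \<le> (5 + 6 * v) * (6 - 6 * v)"
      by (simp add: algebra_simps power2_eq_square)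
    moreover have "w * (6 - 6 * v) * (6 + 6 * v) < (6 * v - 1) * (6 + 6 * v)"
      using 1 v by (intro mult_strict_right_mono) auto
    ultimately have "(w * (6 + 6 * v)) * (6 - 6 * v) < (5 + 6 * v) * (6 - 6 * v)"
      by (simp only: mult_ac)
    with 1 v show ?thesis by (auto simp: mult_less_cancel_right)
  qed
  thus ?thesis using sextic_form_iff(1)[of v w] vw by (simp add: v_def w_def)
qed

text \<open>Inserting \<open>v \<le> w\<close> into the two linear conditions yields
  \<open>v \<le> x\<close> and \<open>y \<le> v\<close>, which places \<open>t\<close> between
  \<open>t0\<close> and \<open>t2\<close>; the position of \<open>v\<close> relative to
  \<open>z\<close> then selects the arc.\<close>

lemma sextic_form_nonpos:
  assumes t: "0 \<le> t" "t \<le> pi" and s: "0 \<le> s" "s \<le> pi"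
    and "cos t > 0" "cos t \<le> - cos s" "sextic_form (cos t, cos s) \<le> 0"
  shows "(t \<in> {t0..t1} \<and> pi - t \<le> s \<and> s \<le> h1 t) \<or> (t \<in> {t1..t2} \<and> pi - t \<le> s \<and> s \<le> h2 t)"
proof -
  define v w where "v = cos t" and "w = - cos s"
  note ep = endpoint_facts endpoint_angles
  have v: "0 < v" and vw: "v \<le> w" using assms by (auto simp: v_def w_def)
  have "sextic_form (v, - w) \<le> 0" using assms by (simp add: v_def w_def)
  hence ineq: "w * (6 - 6 * v) \<le> 6 * v - 1" "w * (6 + 6 * v) \<le> 5 + 6 * v"
    using sextic_form_iff(2)[OF vw] by auto
  have "v * (6 + 6 * v) \<le> w * (6 + 6 * v)" using vw v by (intro mult_right_mono) auto
  hence "v\<^sup>2 \<le> x\<^sup>2" using ineq(2) ep(1) by (simp add: algebra_simps power2_eq_square)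
  hence vx: "v \<le> x" using ep by (intro power2_le_imp_le[of v x]) auto
  hence v1: "v < 1" using ep by linarith
  have "v * (6 - 6 * v) \<le> w * (6 - 6 * v)" using vw v1 by (intro mult_right_mono) auto
  hence "y\<^sup>2 \<le> v\<^sup>2" using ineq(1) ep(2) by (simp add: algebra_simps power2_eq_square)
  hence vy: "y \<le> v" using v by (intro power2_le_imp_le[of y v]) auto
  have "cos s \<le> cos (pi - t)" using assms by simp
  hence ps: "pi - t \<le> s" using s t by (subst (asm) cos_mono_le_eq) auto
  show ?thesis
  proof (cases "z \<le> v")
    case True
    hence tt: "t \<in> {t0..t1}" using vx cos_endpoint_iff[OF t] by (simp add: v_def)
    note f = first_branch[OF tt, folded v_def]
    have "(- 5 - 6 * v) / (6 + 6 * v) \<le> cos s" using ineq v by (simp add: w_def field_simps)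
    hence "s \<le> h1 t"
      using less_arccos_iff[OF s, of "(- 5 - 6 * v) / (6 + 6 * v)"] f v
      by (simp add: h1_def v_def not_less[symmetric])
    thus ?thesis using tt ps by simp
  next
    case False
    hence tt: "t \<in> {t1..t2}" using vy cos_endpoint_iff[OF t] by (simp add: v_def)
    note f = second_branch[OF tt, folded v_def]
    have "(1 - 6 * v) / (6 - 6 * v) \<le> cos s" using ineq v v1 by (simp add: w_def field_simps)
    hence "s \<le> h2 t"
      using less_arccos_iff[OF s, of "(1 - 6 * v) / (6 - 6 * v)"] f v
      by (simp add: h2_def v_def not_less[symmetric])
    thus ?thesis using tt ps by simp
  qed
qed

lemma p6_value_eq:
  "p6_value = 4 * (integral {t0..t1} (\<lambda>t. h1 t - (pi - t)) / pi\<^sup>2 + integral {t1..t2} (\<lambda>t. h2 t - (pi - t)) / pi\<^sup>2)"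
  by (simp add: p6_value_def x_def y_def z_def t0_def t1_def t2_def h1_def h2_def add_divide_distrib)

text \<open>The closed pieces overlap over \<open>t1\<close>, and subadditivity gives the upper
  bound wanted for them; the open pieces are disjoint, so their areas add up exactly.\<close>

lemma sextic_region:
  defines "Op \<equiv> {(t, s). t \<in> {t0<..<t1} \<and> pi - t < s \<and> s < h1 t} \<union>
      {(t, s). t \<in> {t1<..<t2} \<and> pi - t < s \<and> s < h2 t}"
    and "Cl \<equiv> {(t, s). t \<in> {t0..t1} \<and> pi - t \<le> s \<and> s \<le> h1 t} \<union>
      {(t, s). t \<in> {t1..t2} \<and> pi - t \<le> s \<and> s \<le> h2 t}"
  shows "Op \<in> sets torus" "measure torus Op = p6_value / 4"
    and "Cl \<in> sets torus" "measure torus Cl \<le> p6_value / 4"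
proof -
  note ep = endpoint_angles
  have cont: "continuous_on S (\<lambda>t. pi - t)" for S :: "real set" by (intro continuous_intros)
  have o: "0 \<le> t0" "t0 \<le> t1" "t1 \<le> pi" "0 \<le> t1" "t1 \<le> t2" "t2 \<le> pi"
    using ep pi_gt_zero by linarith+
  note m1 = measure_angle2_between[OF o(1-3) cont branch_continuous(1) branch_bounds(1)]
  note m2 = measure_angle2_between[OF o(4-6) cont branch_continuous(2) branch_bounds(2)]
  show "Op \<in> sets torus" unfolding Op_def using m1(1) m2(1) by (rule sets.Un)
  show "Cl \<in> sets torus" unfolding Cl_def using m1(2) m2(2) by (rule sets.Un)
  have val: "p6_value / 4 = integral {t0..t1} (\<lambda>t. h1 t - (pi - t)) / pi\<^sup>2 +
      integral {t1..t2} (\<lambda>t. h2 t - (pi - t)) / pi\<^sup>2"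
    unfolding p6_value_eq by (rule nonzero_mult_div_cancel_left) simp
  have "{(t, s). t \<in> {t0<..<t1} \<and> pi - t < s \<and> s < h1 t} \<inter>
      {(t, s). t \<in> {t1<..<t2} \<and> pi - t < s \<and> s < h2 t} = {}" by auto
  from angle2.finite_measure_Union[OF m1(1) m2(1) this]
  have "measure torus Op = integral {t0..t1} (\<lambda>t. h1 t - (pi - t)) / pi\<^sup>2 +
      integral {t1..t2} (\<lambda>t. h2 t - (pi - t)) / pi\<^sup>2"
    unfolding Op_def by (rule trans[OF _ arg_cong2[where f = "(+)", OF m1(3) m2(3)]])
  thus "measure torus Op = p6_value / 4" unfolding val .
  from measure_Un_le[OF m1(2) m2(2)]
  have "measure torus Cl \<le> integral {t0..t1} (\<lambda>t. h1 t - (pi - t)) / pi\<^sup>2 +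
      integral {t1..t2} (\<lambda>t. h2 t - (pi - t)) / pi\<^sup>2"
    unfolding Cl_def by (rule order_trans[OF _ eq_refl[OF arg_cong2[where f = "(+)", OF m1(4) m2(4)]]])
  thus "measure torus Cl \<le> p6_value / 4" unfolding val .
qed

text \<open>The form is invariant under exchanging the angles and under replacing both by their
  supplements. The open copies are told apart by which angle exceeds \<open>pi / 2\<close> and by
  the sign of \<open>fst p + snd p - pi\<close>; the closed copies cover the region by cases on
  which cosine is positive and which dominates.\<close>

lemma measure_sextic_form:
  shows "p6_value \<le> measure torus {p. sextic_form (cos2 p) < 0}"
    and "measure torus {p. sextic_form (cos2 p) \<le> 0} \<le> p6_value"
proof -
  define Op where "Op = {(t, s). t \<in> {t0<..<t1} \<and> pi - t < s \<and> s < h1 t} \<union>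
      {(t, s). t \<in> {t1<..<t2} \<and> pi - t < s \<and> s < h2 t}"
  define Cl where "Cl = {(t, s). t \<in> {t0..t1} \<and> pi - t \<le> s \<and> s \<le> h1 t} \<union>
      {(t, s). t \<in> {t1..t2} \<and> pi - t \<le> s \<and> s \<le> h2 t}"
  note OC = sextic_region[folded Op_def Cl_def]
  have form_swap: "sextic_form (cos2 (prod.swap p)) = sextic_form (cos2 p)" for p
    by (simp add: sextic_form_def cos2_def algebra_simps)
  have form_reflect: "sextic_form (cos2 (reflect2 p)) = sextic_form (cos2 p)" for p
    by (simp add: sextic_form_def cos2_def reflect2_def abs_minus_commute add.commute)
  have "continuous_on UNIV sextic_form" unfolding sextic_form_def[abs_def] by (intro continuous_intros)
  hence [measurable]: "(\<lambda>p. sextic_form (cos2 p)) \<in> borel_measurable torus"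
    by (intro measurable_compose_rev[OF borel_measurable_continuous_onI borel_measurable_cos2])
  have "{p \<in> space torus. sextic_form (cos2 p) < 0} \<in> sets torus"
    "{p \<in> space torus. sextic_form (cos2 p) \<le> 0} \<in> sets torus" by measurable
  hence meas: "{p. sextic_form (cos2 p) < 0} \<in> sets torus"
    "{p. sextic_form (cos2 p) \<le> 0} \<in> sets torus" by (simp_all add: space_pair_measure)
  let ?S = "\<lambda>A. prod.swap -` A" and ?R = "\<lambda>A. reflect2 -` A"
  have copies: "?S A \<in> sets torus" "?R A \<in> sets torus" "?R (?S A) \<in> sets torus"
    "measure torus (?S A) = measure torus A"
    "measure torus (?R A) = measure torus A"
    "measure torus (?R (?S A)) = measure torus A" if "A \<in> sets torus" for A
    using measure_angle2_swap[OF that] measure_angle2_reflect[OF that]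
      measure_angle2_reflect[OF measure_angle2_swap(1)[OF that]] by (simp_all only:)
  note O4 = OC(1) copies[OF OC(1)] and C4 = OC(3) copies[OF OC(3)]
  have O_neg: "sextic_form (cos2 p) < 0" if "p \<in> Op" for p
    using that sextic_form_neg[of "fst p" "snd p"] by (cases p) (auto simp: Op_def cos2_def)
  have O_pos: "fst p < pi / 2 \<and> snd p > pi / 2 \<and> fst p + snd p > pi" if "p \<in> Op" for p
    using that endpoint_angles by (cases p) (auto simp: Op_def)
  have "p6_value = measure torus Op + measure torus (?S Op) +
      (measure torus (?R Op) + measure torus (?R (?S Op)))"
    unfolding O4 OC(2) by simp
  also have "\<dots> = measure torus (Op \<union> ?S Op) + measure torus (?R Op \<union> ?R (?S Op))"
  proof -
    have "prod.swap p \<notin> Op" if "p \<in> Op" for p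
      using that O_pos[of p] O_pos[of "prod.swap p"] by auto
    hence "Op \<inter> ?S Op = {}" "?R Op \<inter> ?R (?S Op) = {}" by auto
    thus ?thesis
      using angle2.finite_measure_Union[OF O4(1,2)] angle2.finite_measure_Union[OF O4(3,4)] by simp
  qed
  also have "\<dots> = measure torus ((Op \<union> ?S Op) \<union> (?R Op \<union> ?R (?S Op)))"
  proof (rule angle2.finite_measure_Union[symmetric])
    have "fst p + snd p > pi" if "p \<in> Op \<union> ?S Op" for p
      using that O_pos[of p] O_pos[of "prod.swap p"] by auto
    moreover have "fst p + snd p < pi" if "p \<in> ?R Op \<union> ?R (?S Op)" for p
      using that O_pos[of "reflect2 p"] O_pos[of "prod.swap (reflect2 p)"] by (auto simp: reflect2_def)
    ultimately show "(Op \<union> ?S Op) \<inter> (?R Op \<union> ?R (?S Op)) = {}" by fastforce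
  qed (intro sets.Un O4)+
  also have "\<dots> \<le> measure torus {p. sextic_form (cos2 p) < 0}"
  proof (rule angle2.finite_measure_mono[OF _ meas(1)])
    show "(Op \<union> ?S Op) \<union> (?R Op \<union> ?R (?S Op)) \<subseteq> {p. sextic_form (cos2 p) < 0}"
    proof (intro subsetI CollectI)
      fix p assume "p \<in> (Op \<union> ?S Op) \<union> (?R Op \<union> ?R (?S Op))"
      hence "p \<in> Op \<or> prod.swap p \<in> Op \<or> reflect2 p \<in> Op \<or> prod.swap (reflect2 p) \<in> Op" by auto
      thus "sextic_form (cos2 p) < 0" using O_neg form_swap form_reflect by metis
    qed
  qed
  finally show "p6_value \<le> measure torus {p. sextic_form (cos2 p) < 0}" .
  have sub: "{p. sextic_form (cos2 p) \<le> 0} \<inter> {0..pi} \<times> {0..pi} \<subseteq> (Cl \<union> ?S Cl) \<union> (?R Cl \<union> ?R (?S Cl))"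
  proof
    fix p assume p: "p \<in> {p. sextic_form (cos2 p) \<le> 0} \<inter> {0..pi} \<times> {0..pi}"
    obtain t s where ts: "p = (t, s)" by (cases p)
    define v u where "v = cos t" and "u = cos s"
    have t: "0 \<le> t" "t \<le> pi" and s: "0 \<le> s" "s \<le> pi" and neg: "sextic_form (v, u) \<le> 0"
      using p by (auto simp: ts v_def u_def cos2_def)
    have Cl_I: "(a, b) \<in> Cl" if "0 \<le> a" "a \<le> pi" "0 \<le> b" "b \<le> pi" "cos a > 0" "cos a \<le> - cos b"
      "sextic_form (cos a, cos b) \<le> 0" for a b
      using sextic_form_nonpos[OF that] by (simp add: Cl_def)
    \<comment> \<open>For cosines not of opposite sign
      \<open>\<bar>1 + 2 * v * u\<bar> \<ge> 1\<close>, so the form is at least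
      \<open>1 / 2\<close>.\<close>
    have "v * u < 0"
    proof (rule ccontr)
      assume "\<not> v * u < 0"
      hence "\<bar>1 + 2 * v * u\<bar> \<ge> 1" by (simp add: mult.assoc)
      moreover have "\<bar>v + u\<bar> \<ge> 0" by simp
      moreover have "3 * \<bar>v + u\<bar> + 3 / 2 * \<bar>1 + 2 * v * u\<bar> - 1 \<le> 0"
        using neg by (simp only: sextic_form_def fst_conv snd_conv)
      moreover have False if "a \<ge> 0" "b \<ge> 1" "3 * a + 3 / 2 * b - 1 \<le> 0" for a b :: real
        using that by linarith
      ultimately show False by blast
    qed
    hence "v > 0 \<and> u < 0 \<or> v < 0 \<and> u > 0" by (auto simp: mult_less_0_iff)
    then consider "v > 0" "v \<le> - u" | "- u > 0" "- u \<le> v" | "u > 0" "u \<le> - v" | "- v > 0" "- v \<le> u"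
      by linarith
    thus "p \<in> (Cl \<union> ?S Cl) \<union> (?R Cl \<union> ?R (?S Cl))"
    proof cases
      case 1
      hence "(t, s) \<in> Cl" using t s neg by (intro Cl_I) (auto simp: v_def u_def)
      thus ?thesis by (simp add: ts)
    next
      case 2
      have "sextic_form (- u, - v) \<le> 0" using neg by (simp add: sextic_form_def algebra_simps abs_minus_commute)
      hence "(pi - s, pi - t) \<in> Cl" using t s 2 by (intro Cl_I) (auto simp: v_def u_def)
      thus ?thesis by (simp add: ts reflect2_def)
    next
      case 3
      have "sextic_form (u, v) \<le> 0" using neg by (simp add: sextic_form_def algebra_simps)
      hence "(s, t) \<in> Cl" using t s 3 by (intro Cl_I) (auto simp: v_def u_def)
      thus ?thesis by (simp add: ts)
    next
      case 4
      have "sextic_form (- v, - u) \<le> 0" using neg by (simp add: sextic_form_def abs_minus_commute add.commute)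
      hence "(pi - t, pi - s) \<in> Cl" using t s 4 by (intro Cl_I) (auto simp: v_def u_def)
      thus ?thesis by (simp add: ts reflect2_def)
    qed
  qed
  have "measure torus {p. sextic_form (cos2 p) \<le> 0} =
      measure torus ({p. sextic_form (cos2 p) \<le> 0} \<inter> {0..pi} \<times> {0..pi})"
    by (rule measure_angle2_square[OF meas(2)])
  also have "\<dots> \<le> measure torus ((Cl \<union> ?S Cl) \<union> (?R Cl \<union> ?R (?S Cl)))"
    by (intro angle2.finite_measure_mono sub sets.Un C4)
  also have "\<dots> \<le> measure torus (Cl \<union> ?S Cl) + measure torus (?R Cl \<union> ?R (?S Cl))"
    by (intro measure_Un_le sets.Un C4)
  also have "\<dots> \<le> (measure torus Cl + measure torus (?S Cl)) +
      (measure torus (?R Cl) + measure torus (?R (?S Cl)))"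
    by (intro add_mono measure_Un_le C4)
  also have "\<dots> \<le> p6_value" unfolding C4 using OC(4) by simp
  finally show "measure torus {p. sextic_form (cos2 p) \<le> 0} \<le> p6_value" .
qed

text \<open>In the half angles \<open>a = (pi - s) / 2\<close> and \<open>b = t / 2\<close> the two branches of the boundary read
  \<open>sin a * cos b = k1\<close> and \<open>cos a * sin b = k2\<close>. The first is solved for \<open>a\<close>, and the second is
  integrated as an inverse function, so that both integrals reduce to the function
  \<open>arcsin (k / cos x)\<close> on an interval where its argument stays well below \<open>1\<close>.\<close>

lemma k_sq: "k1\<^sup>2 = 1 / 24" "k2\<^sup>2 = 5 / 24" "k1 > 0" "k2 > 0"
  by (simp_all add: k1_def k2_def)

lemma first_branch_half:
  assumes "t \<in> {t0..t1}"
  shows "cos (t / 2) > 0" "0 \<le> k1 / cos (t / 2)" "(k1 / cos (t / 2))\<^sup>2 \<le> 0.054"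
    and "h1 t = pi - 2 * arcsin (k1 / cos (t / 2))"
proof -
  define q where "q = k1 / cos (t / 2)"
  have v: "z \<le> cos t" "cos t \<le> x" using first_branch[OF assms] by auto
  have z: "z > 0.55"
  proof -
    have "sqrt 19 > 4.31" by (rule real_less_rsqrt) (simp add: power2_eq_square)
    thus ?thesis by (simp add: z_def)
  qed
  show c: "cos (t / 2) > 0" using assms endpoint_angles pi_gt_zero by (intro cos_gt_zero_pi) auto
  thus q0: "0 \<le> k1 / cos (t / 2)" using k_sq by simp
  have q2: "q\<^sup>2 = 1 / (12 * (1 + cos t))"
    by (simp add: q_def power_divide k_sq half_angle_squares)
  \<comment> \<open>By \<open>z > 0.55\<close>; the value is about 0.0538 and is rounded up to
    0.054.\<close>
  also have "\<dots> \<le> 1 / (12 * (1 + 0.55))"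
    using v z by (intro divide_left_mono mult_left_mono add_left_mono mult_pos_pos) auto
  also have "\<dots> \<le> 0.054" by simp
  finally show q2_le: "(k1 / cos (t / 2))\<^sup>2 \<le> 0.054" by (simp add: q_def)
  hence "q \<le> 1" using power2_le_imp_le[of q 1] by (simp add: q_def)
  moreover have "(- 5 - 6 * cos t) / (6 + 6 * cos t) = - (1 - 2 * q\<^sup>2)"
    unfolding q2 using v z by (simp add: field_simps)
  moreover have "- 1 \<le> 1 - 2 * q\<^sup>2 \<and> 1 - 2 * q\<^sup>2 \<le> 1" using q2_le by (simp add: q_def)
  ultimately have "h1 t = pi - arccos (1 - 2 * q\<^sup>2)" unfolding h1_def by (simp only: arccos_minus)
  thus "h1 t = pi - 2 * arcsin (k1 / cos (t / 2))"
    using arccos_eq_double_arcsin[of q] \<open>q \<le> 1\<close> q0 by (simp add: q_def)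
qed

text \<open>Since \<open>k2 / sin (t / 2)\<close> comes close to 1, the series will be applied to
  \<open>sin (t / 2)\<close>, the argument of the arcsine after inversion. The constant bounding its
  square is \<open>(1 - 0.408) / 2\<close>.\<close>

lemma second_branch_half:
  assumes "t \<in> {t1..t2}"
  shows "sin (t / 2) > 0" "0 < k2 / sin (t / 2)" "k2 / sin (t / 2) < 1" "(sin (t / 2))\<^sup>2 \<le> 0.296"
    and "h2 t = pi - 2 * g (t / 2)"
proof -
  define q where "q = k2 / sin (t / 2)"
  have v: "y \<le> cos t" "cos t \<le> z" using second_branch[OF assms] by auto
  show s: "sin (t / 2) > 0" using assms endpoint_angles pi_gt_zero by (intro sin_gt_zero) auto
  thus q0: "0 < k2 / sin (t / 2)" using k_sq by simp
  have q2: "q\<^sup>2 = 5 / (12 * (1 - cos t))"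
    by (simp add: q_def power_divide k_sq half_angle_squares)
  have "q\<^sup>2 < 1" unfolding q2 using v endpoint_facts by (simp add: field_simps)
  hence q1: "q < 1" using power2_less_imp_less[of q 1] by simp
  thus "k2 / sin (t / 2) < 1" by (simp add: q_def)
  have "sqrt 6 > 2.448" by (rule real_less_rsqrt) (simp add: power2_eq_square)
  hence "y > 0.408" by (simp add: y_def)
  thus "(sin (t / 2))\<^sup>2 \<le> 0.296" using v by (simp add: half_angle_squares)
  have "(1 - 6 * cos t) / (6 - 6 * cos t) = - (2 * q\<^sup>2 - 1)"
    unfolding q2 using v endpoint_facts by (simp add: field_simps)
  moreover have "- 1 \<le> 2 * q\<^sup>2 - 1 \<and> 2 * q\<^sup>2 - 1 \<le> 1" using \<open>q\<^sup>2 < 1\<close> by simp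
  ultimately have "h2 t = pi - arccos (2 * q\<^sup>2 - 1)" unfolding h2_def by (simp only: arccos_minus)
  thus "h2 t = pi - 2 * g (t / 2)"
    using arccos_eq_double_arccos[of q] q0 q1 by (simp add: q_def g_def)
qed

lemma first_antideriv:
  assumes "t \<in> {t0..t1}"
  shows "((\<lambda>t. t\<^sup>2 / 2 - 4 * arcsin_sec_int k1 M D (t / 2)) has_real_derivative
    t - 2 * arcsin_poly M D (k1 / cos (t / 2))) (at t)"
proof -
  have "((\<lambda>t. arcsin_sec_int k1 M D (t / 2)) has_real_derivative arcsin_poly M D (k1 / cos (t / 2)) * (1 / 2)) (at t)"
    by (intro DERIV_chain2[OF arcsin_sec_int_deriv] first_branch_half(1) assms)
       (auto intro!: derivative_eq_intros)
  from DERIV_cmult[OF this, of 4]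
  have "((\<lambda>t. 4 * arcsin_sec_int k1 M D (t / 2)) has_real_derivative 2 * arcsin_poly M D (k1 / cos (t / 2))) (at t)"
    by simp
  moreover have "((\<lambda>t. t\<^sup>2 / 2) has_real_derivative t) (at t)" by (auto intro!: derivative_eq_intros)
  ultimately show ?thesis by (intro DERIV_diff)
qed

lemma g_deriv:
  assumes "t \<in> {t1..t2}"
  obtains d where "d \<ge> 0" "(g has_real_derivative d) (at (t / 2))"
proof -
  define b where "b = t / 2"
  note h = second_branch_half[OF assms, folded b_def]
  have "cos b \<ge> 0" using assms endpoint_angles unfolding b_def by (intro cos_ge_zero) auto
  have "((\<lambda>b. k2 / sin b) has_real_derivative - (k2 * cos b / (sin b)\<^sup>2)) (at b)"
    using h by (auto intro!: derivative_eq_intros simp: power2_eq_square)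
  hence "(g has_real_derivative inverse (- sqrt (1 - (k2 / sin b)\<^sup>2)) * - (k2 * cos b / (sin b)\<^sup>2)) (at b)"
    unfolding g_def using h by (intro DERIV_chain2[OF DERIV_arccos]) auto
  moreover have "inverse (- sqrt (1 - (k2 / sin b)\<^sup>2)) * - (k2 * cos b / (sin b)\<^sup>2) \<ge> 0"
  proof -
    have "(k2 / sin b)\<^sup>2 \<le> 1" using h by (simp add: power_le_one)
    thus ?thesis using h k_sq \<open>cos b \<ge> 0\<close>
      by (intro mult_nonpos_nonpos) (auto simp: divide_nonneg_nonneg)
  qed
  ultimately show ?thesis using that unfolding b_def by blast
qed

text \<open>Integration of an inverse function: an antiderivative of \<open>g\<close> at
  \<open>b\<close> is \<open>b * g b\<close> minus an antiderivative of
  \<open>arcsin (k2 / cos a)\<close> at \<open>a = g b\<close>, where the arcsine is replaced by the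
  polynomial. The error enters with the factor \<open>d \<ge> 0\<close>, the derivative of
  \<open>g\<close>, so its sign is controlled by the polynomial.\<close>

lemma second_antideriv:
  assumes "t \<in> {t1..t2}"
  obtains d where "d \<ge> 0"
    "((\<lambda>t. t\<^sup>2 / 2 - 4 * (t / 2 * g (t / 2) - arcsin_sec_int k2 M D (g (t / 2)))) has_real_derivative
    t - 2 * g (t / 2) - 2 * d * (arcsin (sin (t / 2)) - arcsin_poly M D (sin (t / 2)))) (at t)"
proof -
  define b where "b = t / 2"
  note h = second_branch_half[OF assms, folded b_def]
  obtain d where d: "d \<ge> 0" "(g has_real_derivative d) (at b)" using g_deriv[OF assms] b_def by metis
  have cg: "cos (g b) = k2 / sin b" using h by (simp add: g_def cos_arccos)
  have asb: "arcsin (sin b) = b" using assms endpoint_angles by (intro arcsin_sin) (auto simp: b_def)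
  have gt: "((\<lambda>t. g (t / 2)) has_real_derivative d * (1 / 2)) (at t)"
    by (rule DERIV_chain2[where f = g and g = "\<lambda>t. t / 2", OF d(2)[unfolded b_def]])
       (auto intro!: derivative_eq_intros)
  have "(arcsin_sec_int k2 M D has_real_derivative arcsin_poly M D (k2 / cos (g b))) (at (g b))"
    by (intro arcsin_sec_int_deriv) (simp only: cg h)
  from DERIV_chain2[where f = "arcsin_sec_int k2 M D" and g = "\<lambda>t. g (t / 2)", OF this[unfolded b_def] gt]
  have "((\<lambda>t. arcsin_sec_int k2 M D (g (t / 2))) has_real_derivative
      arcsin_poly M D (k2 / cos (g b)) * (d * (1 / 2))) (at t)"
    unfolding b_def .
  moreover have "k2 / cos (g b) = sin b" using cg h k_sq by simp
  ultimately have G: "((\<lambda>t. arcsin_sec_int k2 M D (g (t / 2))) has_real_derivative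
      arcsin_poly M D (sin b) * (d * (1 / 2))) (at t)" by simp
  have half: "((\<lambda>t. t / 2) has_real_derivative 1 / 2) (at t)" by (auto intro!: derivative_eq_intros)
  have sq: "((\<lambda>t. t\<^sup>2 / 2) has_real_derivative t) (at t)" by (auto intro!: derivative_eq_intros)
  have "((\<lambda>t. t\<^sup>2 / 2 - 4 * (t / 2 * g (t / 2) - arcsin_sec_int k2 M D (g (t / 2)))) has_real_derivative
    t - 4 * ((1 / 2 * g (t / 2) + d * (1 / 2) * (t / 2)) - arcsin_poly M D (sin b) * (d * (1 / 2)))) (at t)"
    by (intro DERIV_diff DERIV_cmult G DERIV_mult half gt sq)
  also have "t - 4 * ((1 / 2 * g (t / 2) + d * (1 / 2) * (t / 2)) - arcsin_poly M D (sin b) * (d * (1 / 2))) =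
      t - 2 * g (t / 2) - 2 * d * (arcsin (sin (t / 2)) - arcsin_poly M D (sin (t / 2)))"
    using asb by (simp add: b_def algebra_simps)
  finally show ?thesis using that d(1) by blast
qed

lemma first_integral_bounds:
  fixes M :: nat
  defines "I \<equiv> integral {t0..t1} (\<lambda>t. h1 t - (pi - t))"
    and "\<Phi> \<equiv> \<lambda>D t. t\<^sup>2 / 2 - 4 * arcsin_sec_int k1 M D (t / 2)"
  shows "0 \<le> D \<Longrightarrow> D * (2 * real M + 2) \<le> (2 * real M + 1) * cbin M \<Longrightarrow> I \<le> \<Phi> D t1 - \<Phi> D t0"
    and "0 \<le> D \<Longrightarrow> (2 * real M + 1) * cbin M \<le> D * (2 * real M + 2) - D * (2 * real M + 3) * 0.054 \<Longrightarrow>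
      \<Phi> D t1 - \<Phi> D t0 \<le> I"
proof -
  have cont: "continuous_on {t0..t1} (\<lambda>t. h1 t - (pi - t))" by (intro continuous_intros branch_continuous)
  have f: "h1 t - (pi - t) = t - 2 * arcsin (k1 / cos (t / 2))" if "t \<in> {t0..t1}" for t
    using first_branch_half(4)[OF that] by simp
  have le: "t0 \<le> t1" using endpoint_angles by simp
  show "I \<le> \<Phi> D t1 - \<Phi> D t0" if D: "0 \<le> D" "D * (2 * real M + 2) \<le> (2 * real M + 1) * cbin M"
    unfolding I_def
  proof (rule integral_bound_antideriv(1)[OF le cont])
    fix t assume t: "t \<in> {t0..t1}"
    have "(k1 / cos (t / 2))\<^sup>2 < 1\<^sup>2" using first_branch_half(3)[OF t] by simp
    hence "k1 / cos (t / 2) < 1" by (rule power2_less_imp_less) simp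
    hence "arcsin_poly M D (k1 / cos (t / 2)) \<le> arcsin (k1 / cos (t / 2))"
      using first_branch_half(2)[OF t] D by (intro arcsin_poly_le)
    thus "\<exists>d. (\<Phi> D has_real_derivative d) (at t) \<and> h1 t - (pi - t) \<le> d"
      unfolding f[OF t] \<Phi>_def using first_antideriv[OF t, of M D] by (intro exI conjI) auto
  qed
  show "\<Phi> D t1 - \<Phi> D t0 \<le> I"
    if D: "0 \<le> D" "(2 * real M + 1) * cbin M \<le> D * (2 * real M + 2) - D * (2 * real M + 3) * 0.054"
    unfolding I_def
  proof (rule integral_bound_antideriv(2)[OF le cont])
    fix t assume t: "t \<in> {t0..t1}"
    have "arcsin (k1 / cos (t / 2)) \<le> arcsin_poly M D (k1 / cos (t / 2))"
      using first_branch_half(2,3)[OF t] D by (intro arcsin_poly_ge[where W = "0.054"]) auto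
    thus "\<exists>d. (\<Phi> D has_real_derivative d) (at t) \<and> d \<le> h1 t - (pi - t)"
      unfolding f[OF t] \<Phi>_def using first_antideriv[OF t, of M D] by (intro exI conjI) auto
  qed
qed

text \<open>Compared with the first integral, the lower and upper polynomials exchange their roles,
  because the arcsine now belongs to the inverse function.\<close>

lemma second_integral_bounds:
  fixes M :: nat
  defines "I \<equiv> integral {t1..t2} (\<lambda>t. h2 t - (pi - t))"
    and "\<Phi> \<equiv> \<lambda>D t. t\<^sup>2 / 2 - 4 * (t / 2 * g (t / 2) - arcsin_sec_int k2 M D (g (t / 2)))"
  shows "0 \<le> D \<Longrightarrow> D * (2 * real M + 2) \<le> (2 * real M + 1) * cbin M \<Longrightarrow> \<Phi> D t2 - \<Phi> D t1 \<le> I"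
    and "0 \<le> D \<Longrightarrow> (2 * real M + 1) * cbin M \<le> D * (2 * real M + 2) - D * (2 * real M + 3) * 0.296 \<Longrightarrow>
      I \<le> \<Phi> D t2 - \<Phi> D t1"
proof -
  have cont: "continuous_on {t1..t2} (\<lambda>t. h2 t - (pi - t))" by (intro continuous_intros branch_continuous)
  have f: "h2 t - (pi - t) = t - 2 * g (t / 2)" if "t \<in> {t1..t2}" for t
    using second_branch_half(5)[OF that] by simp
  have le: "t1 \<le> t2" using endpoint_angles by simp
  show "\<Phi> D t2 - \<Phi> D t1 \<le> I" if D: "0 \<le> D" "D * (2 * real M + 2) \<le> (2 * real M + 1) * cbin M"
    unfolding I_def
  proof (rule integral_bound_antideriv(2)[OF le cont])
    fix t assume t: "t \<in> {t1..t2}"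
    have "(sin (t / 2))\<^sup>2 < 1\<^sup>2" using second_branch_half(4)[OF t] by simp
    hence "sin (t / 2) < 1" by (rule power2_less_imp_less) simp
    hence le: "arcsin_poly M D (sin (t / 2)) \<le> arcsin (sin (t / 2))"
      using second_branch_half(1)[OF t] D by (intro arcsin_poly_le) auto
    obtain d where d: "d \<ge> 0" "(\<Phi> D has_real_derivative
      t - 2 * g (t / 2) - 2 * d * (arcsin (sin (t / 2)) - arcsin_poly M D (sin (t / 2)))) (at t)"
      using second_antideriv[OF t, of M D] unfolding \<Phi>_def by blast
    have "2 * d * (arcsin (sin (t / 2)) - arcsin_poly M D (sin (t / 2))) \<ge> 0"
      using d(1) le by (intro mult_nonneg_nonneg) auto
    thus "\<exists>d. (\<Phi> D has_real_derivative d) (at t) \<and> d \<le> h2 t - (pi - t)"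
      unfolding f[OF t] using d(2) by (intro exI conjI) auto
  qed
  show "I \<le> \<Phi> D t2 - \<Phi> D t1"
    if D: "0 \<le> D" "(2 * real M + 1) * cbin M \<le> D * (2 * real M + 2) - D * (2 * real M + 3) * 0.296"
    unfolding I_def
  proof (rule integral_bound_antideriv(1)[OF le cont])
    fix t assume t: "t \<in> {t1..t2}"
    have le: "arcsin (sin (t / 2)) \<le> arcsin_poly M D (sin (t / 2))"
      using second_branch_half(1,4)[OF t] D by (intro arcsin_poly_ge[where W = "0.296"]) auto
    obtain d where d: "d \<ge> 0" "(\<Phi> D has_real_derivative
      t - 2 * g (t / 2) - 2 * d * (arcsin (sin (t / 2)) - arcsin_poly M D (sin (t / 2)))) (at t)"
      using second_antideriv[OF t, of M D] unfolding \<Phi>_def by blast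
    have "2 * d * (arcsin (sin (t / 2)) - arcsin_poly M D (sin (t / 2))) \<le> 0"
      using d(1) le by (intro mult_nonneg_nonpos) auto
    thus "\<exists>d. (\<Phi> D has_real_derivative d) (at t) \<and> h2 t - (pi - t) \<le> d"
      unfolding f[OF t] using d(2) by (intro exI conjI) auto
  qed
qed

text \<open>At \<open>t2\<close> the second arc meets the line \<open>t + s = pi\<close>, where the
  half angles agree, hence \<open>g (t2 / 2) = t2 / 2\<close>. At \<open>t1\<close> the arcs cross,
  so \<open>g (t1 / 2)\<close> also satisfies the relation \<open>sin a * cos b = k1\<close> of the
  first arc, which explains its sine. The last equation reflects
  \<open>x\<^sup>2 + y\<^sup>2 = 1\<close>.\<close>

lemma endpoint_values:
  shows "(sin (t0 / 2))\<^sup>2 = (1 - x) / 2" "(sin (t1 / 2))\<^sup>2 = (1 - z) / 2" "(sin (t2 / 2))\<^sup>2 = (1 - y) / 2"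
    and "g (t2 / 2) = t2 / 2" "(sin (g (t1 / 2)))\<^sup>2 = 1 / (12 * (1 + z))" "0 < g (t1 / 2)" "g (t1 / 2) < pi / 2"
    and "t0 + t2 = pi / 2"
proof -
  have cos: "cos t0 = x" "cos t1 = z" "cos t2 = y"
    using endpoint_facts by (auto simp: t0_def t1_def t2_def)
  thus "(sin (t0 / 2))\<^sup>2 = (1 - x) / 2" "(sin (t1 / 2))\<^sup>2 = (1 - z) / 2" "(sin (t2 / 2))\<^sup>2 = (1 - y) / 2"
    by (simp_all add: half_angle_squares)
  have sin_t2: "sin t2 = x"
  proof -
    have "(sin t2)\<^sup>2 = x\<^sup>2" using endpoint_facts cos by (simp add: sin_squared_eq)
    moreover have "sin t2 > 0" using endpoint_angles by (intro sin_gt_zero) auto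
    moreover have "x > 0" using endpoint_facts by linarith
    ultimately show ?thesis using power2_eq_imp_eq[of "sin t2" x] by simp
  qed
  have "cos (pi / 2 - t2) = x" using sin_t2 by (simp add: cos_diff)
  moreover have "arccos (cos (pi / 2 - t2)) = pi / 2 - t2" using endpoint_angles by (intro arccos_cos) auto
  ultimately have "t0 = pi / 2 - t2" by (simp only: t0_def)
  thus "t0 + t2 = pi / 2" by simp
  have "sin (t2 / 2) * cos (t2 / 2) = k2"
  proof -
    have "2 * (sin (t2 / 2) * cos (t2 / 2)) = x" using sin_double[of "t2 / 2"] sin_t2 by simp
    hence "sin (t2 / 2) * cos (t2 / 2) = x / 2" by linarith
    hence "(sin (t2 / 2) * cos (t2 / 2))\<^sup>2 = (x / 2)\<^sup>2" by (rule arg_cong)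
    also have "\<dots> = k2\<^sup>2" using endpoint_facts k_sq by (simp add: power_divide)
    finally have "(sin (t2 / 2) * cos (t2 / 2))\<^sup>2 = k2\<^sup>2" .
    moreover have "sin (t2 / 2) \<ge> 0" using endpoint_angles by (intro sin_ge_zero) auto
    moreover have "cos (t2 / 2) \<ge> 0" using endpoint_angles by (intro cos_ge_zero) auto
    ultimately show ?thesis using k_sq(4) power2_eq_imp_eq[of "sin (t2 / 2) * cos (t2 / 2)" k2] by simp
  qed
  moreover have "sin (t2 / 2) > 0" using endpoint_angles by (intro sin_gt_zero) auto
  ultimately have "k2 / sin (t2 / 2) = cos (t2 / 2)" by (simp add: field_simps)
  thus "g (t2 / 2) = t2 / 2" unfolding g_def using endpoint_angles by (simp add: arccos_cos)
  have h: "sin (t1 / 2) > 0" "0 < k2 / sin (t1 / 2)" "k2 / sin (t1 / 2) < 1"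
    using second_branch_half[of t1] endpoint_angles by auto
  show "0 < g (t1 / 2)" "g (t1 / 2) < pi / 2"
    using h arccos_less_arccos[of "k2 / sin (t1 / 2)" 1] arccos_less_arccos[of 0 "k2 / sin (t1 / 2)"]
    unfolding g_def by auto
  have "cos (g (t1 / 2)) = k2 / sin (t1 / 2)" using h by (simp add: g_def cos_arccos)
  hence "(sin (g (t1 / 2)))\<^sup>2 = 1 - 5 / (12 * (1 - z))"
    by (simp add: sin_squared_eq power_divide k_sq half_angle_squares cos add_divide_distrib diff_divide_distrib)
  also have "\<dots> = 1 / (12 * (1 + z))"
  proof -
    \<comment> \<open>Equivalent to the crossing equation \<open>6 * z\<^sup>2 + 2 * z = 3\<close>;
      it lets the factor \<open>7 - 12 * z\<close> cancel.\<close>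
    have "(7 - 12 * z) * (1 + z) = 1 - z" using endpoint_facts(3) by (simp add: algebra_simps power2_eq_square)
    moreover have "1 - z \<noteq> 0" "7 - 12 * z \<noteq> 0" using endpoint_facts(6) by auto
    moreover have "1 - 5 / (12 * w) = (12 * w - 5) / (12 * w)" if "w \<noteq> 0" for w :: real
      using that by (simp add: diff_divide_distrib)
    from this[of "1 - z"] have "1 - 5 / (12 * (1 - z)) = (7 - 12 * z) / (12 * (1 - z))"
      using \<open>1 - z \<noteq> 0\<close> by simp
    ultimately have "1 - 5 / (12 * (1 - z)) = (7 - 12 * z) / (12 * ((7 - 12 * z) * (1 + z)))" by (simp only:)
    also have "\<dots> = (7 - 12 * z) / ((7 - 12 * z) * (12 * (1 + z)))" by (simp only: mult.left_commute)
    also have "\<dots> = 1 / (12 * (1 + z))" using \<open>7 - 12 * z \<noteq> 0\<close> by simp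
    finally show ?thesis .
  qed
  finally show "(sin (g (t1 / 2)))\<^sup>2 = 1 / (12 * (1 + z))" .
qed

end

section \<open>Numerical evaluation\<close>

text \<open>The derivative \<open>1 / (1 - v\<^sup>2)\<close> is a geometric series; its tail after
  \<open>J\<close> terms is \<open>v ^ (2 * J) / (1 - v\<^sup>2)\<close>, estimated by the value of
  the denominator at \<open>u\<close>.\<close>

lemma artanh_bounds:
  fixes u :: real
  assumes "0 \<le> u" "u < 1"
  shows "(\<Sum>j<J. u ^ (2 * j + 1) / (2 * real j + 1)) \<le> artanh u"
    and "artanh u \<le> (\<Sum>j<J. u ^ (2 * j + 1) / (2 * real j + 1)) + u ^ (2 * J + 1) / ((2 * real J + 1) * (1 - u\<^sup>2))"
proof -
  define A where "A v = (\<Sum>j<J. v ^ (2 * j + 1) / (2 * real j + 1))" for v :: real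
  define B where "B v = v ^ (2 * J + 1) / (2 * real J + 1)" for v :: real
  define c where "c = 1 / (1 - u\<^sup>2)"
  have tm: "((\<lambda>v. v ^ (2 * j + 1) / (2 * real j + 1)) has_real_derivative (v\<^sup>2) ^ j) (at v)" for j :: nat and v
  proof -
    have "((\<lambda>v. v ^ (2 * j + 1) / (2 * real j + 1)) has_real_derivative real (Suc (2 * j)) * v ^ (2 * j) / (2 * real j + 1)) (at v)"
      using has_real_derivative_power[of "2 * j" v] by (intro DERIV_cdivide) simp
    moreover have "real (Suc (2 * j)) * v ^ (2 * j) / (2 * real j + 1) = (v\<^sup>2) ^ j"
      unfolding power_mult by (simp add: add.commute)
    ultimately show ?thesis by (simp only:)
  qed
  have geo: "(\<Sum>j<J. (v\<^sup>2) ^ j) = (1 - (v\<^sup>2) ^ J) / (1 - v\<^sup>2)" if "0 \<le> v" "v \<le> u" for v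
  proof -
    have "v\<^sup>2 < 1" using that assms by (simp add: abs_square_less_1)
    thus ?thesis by (simp add: sum_gp_strict)
  qed
  have dA: "(A has_real_derivative (\<Sum>j<J. (v\<^sup>2) ^ j)) (at v)" for v
    unfolding A_def by (intro DERIV_sum tm)
  have dB: "(B has_real_derivative (v\<^sup>2) ^ J) (at v)" for v
    unfolding B_def by (rule tm)
  have dT: "(artanh has_real_derivative 1 / (1 - v\<^sup>2)) (at v)" if "0 \<le> v" "v \<le> u" for v
    using that assms by (intro artanh_real_has_field_derivative) auto
  have "artanh 0 - A 0 \<le> artanh u - A u"
  proof (rule DERIV_nonneg_imp_nondecreasing[OF assms(1)])
    fix v assume v: "0 \<le> v" "v \<le> u"
    have "v\<^sup>2 < 1" using v assms by (simp add: abs_square_less_1)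
    hence "(1 - (v\<^sup>2) ^ J) / (1 - v\<^sup>2) \<le> 1 / (1 - v\<^sup>2)" by (intro divide_right_mono) auto
    hence "0 \<le> 1 / (1 - v\<^sup>2) - (\<Sum>j<J. (v\<^sup>2) ^ j)" using geo[OF v] by simp
    thus "\<exists>y. ((\<lambda>v. artanh v - A v) has_real_derivative y) (at v) \<and> 0 \<le> y"
      using DERIV_diff[OF dT[OF v] dA[of v]] by blast
  qed
  thus "(\<Sum>j<J. u ^ (2 * j + 1) / (2 * real j + 1)) \<le> artanh u" by (simp add: A_def)
  have "artanh u - (A u + B u * c) \<le> artanh 0 - (A 0 + B 0 * c)"
  proof (rule DERIV_nonpos_imp_nonincreasing[OF assms(1)])
    fix v assume v: "0 \<le> v" "v \<le> u"
    have v1: "v\<^sup>2 \<le> u\<^sup>2" "u\<^sup>2 < 1" using v assms by (auto simp: abs_square_less_1 intro: power_mono)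
    have "1 / (1 - v\<^sup>2) - (\<Sum>j<J. (v\<^sup>2) ^ j) = (v\<^sup>2) ^ J * (1 / (1 - v\<^sup>2))"
      using geo[OF v] by (simp add: diff_divide_distrib[symmetric])
    also have "\<dots> \<le> (v\<^sup>2) ^ J * c"
      unfolding c_def using v1 by (intro mult_left_mono divide_left_mono) auto
    finally have "1 / (1 - v\<^sup>2) - ((\<Sum>j<J. (v\<^sup>2) ^ j) + (v\<^sup>2) ^ J * c) \<le> 0" by simp
    moreover have "((\<lambda>v. B v * c) has_real_derivative (v\<^sup>2) ^ J * c) (at v)"
      using dB by (rule DERIV_cmult_right)
    ultimately show "\<exists>y. ((\<lambda>v. artanh v - (A v + B v * c)) has_real_derivative y) (at v) \<and> y \<le> 0"
      using DERIV_diff[OF dT[OF v] DERIV_add[OF dA[of v]]] by blast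
  qed
  thus "artanh u \<le> (\<Sum>j<J. u ^ (2 * j + 1) / (2 * real j + 1)) + u ^ (2 * J + 1) / ((2 * real J + 1) * (1 - u\<^sup>2))"
    by (simp add: A_def B_def c_def)
qed

text \<open>Fixed-point evaluation with scale \<open>S\<close>. The flag \<open>c\<close> selects the direction of rounding:
  \<open>0\<close> for lower bounds and \<open>1\<close> for upper bounds.\<close>

definition rdiv :: "int \<Rightarrow> int \<Rightarrow> int \<Rightarrow> int" where
  "rdiv c a b = (a + c * (b - 1)) div b"

text \<open>Nonnegativity is part of the relation so that products of bounds are bounds again. The
  flag is a number, so that a remainder can be switched off by multiplying with
  \<open>c\<close>.\<close>

definition fx_bound :: "int \<Rightarrow> int \<Rightarrow> int \<Rightarrow> real \<Rightarrow> bool" where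
  "fx_bound c S a x \<longleftrightarrow> 0 \<le> a \<and> 0 \<le> x \<and>
     (c = 0 \<and> real_of_int a \<le> real_of_int S * x \<or> c = 1 \<and> real_of_int S * x \<le> real_of_int a)"

lemma rdiv_bounds:
  assumes "b > 0"
  shows "real_of_int (rdiv 0 a b) \<le> a / b" "a / b \<le> real_of_int (rdiv 1 a b)"
    and "0 \<le> a \<Longrightarrow> 0 \<le> c \<Longrightarrow> 0 \<le> rdiv c a b"
proof -
  have *: "real_of_int (x div b) * b \<le> x" "real_of_int x - b < real_of_int (x div b) * b" for x
  proof -
    have "x = x div b * b + x mod b" by simp
    moreover have "0 \<le> x mod b" "x mod b < b" using assms by auto
    ultimately have "x div b * b \<le> x" "x - b < x div b * b" by linarith+
    thus "real_of_int (x div b) * b \<le> x" "real_of_int x - b < real_of_int (x div b) * b"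
      by (metis of_int_le_iff of_int_mult) (metis \<open>x - b < x div b * b\<close> of_int_diff of_int_less_iff of_int_mult)
  qed
  show "real_of_int (rdiv 0 a b) \<le> a / b"
    using *(1)[of a] assms by (simp add: rdiv_def field_simps)
  have "a \<le> (a + (b - 1)) div b * b"
  proof -
    have "a + (b - 1) = (a + (b - 1)) div b * b + (a + (b - 1)) mod b" by simp
    moreover have "(a + (b - 1)) mod b < b" using assms by simp
    ultimately show ?thesis by linarith
  qed
  hence "real_of_int a \<le> real_of_int ((a + (b - 1)) div b * b)" by (simp only: of_int_le_iff)
  thus "a / b \<le> real_of_int (rdiv 1 a b)"
    using assms by (simp add: rdiv_def field_simps)
  show "0 \<le> rdiv c a b" if "0 \<le> a" "0 \<le> c"
    using that assms by (simp add: rdiv_def pos_imp_zdiv_nonneg_iff)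
qed

lemma fx_bound_div:
  assumes "fx_bound c S a x" "b > 0"
  shows "fx_bound c S (rdiv c a b) (x / of_int b)"
  using assms rdiv_bounds[OF assms(2), of a] rdiv_bounds(3)[OF assms(2), of a c]
  unfolding fx_bound_def
  by (auto intro: order_trans divide_right_mono simp: pos_divide_le_eq pos_le_divide_eq field_simps)

lemma fx_bound_scale: "fx_bound c S a x \<Longrightarrow> 0 \<le> m \<Longrightarrow> fx_bound c S (m * a) (of_int m * x)"
proof -
  assume *: "fx_bound c S a x" "0 \<le> m"
  hence "real_of_int m \<ge> 0" by simp
  from mult_left_mono[OF _ this, of "of_int a" "of_int S * x"] mult_left_mono[OF _ this, of "of_int S * x" "of_int a"] *
  show ?thesis unfolding fx_bound_def by (auto simp: mult.left_commute)
qed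

lemma fx_bound_add: "fx_bound c S a x \<Longrightarrow> fx_bound c S b y \<Longrightarrow> fx_bound c S (a + b) (x + y)"
  unfolding fx_bound_def by (auto simp: distrib_left)

lemma fx_bound_mult:
  assumes "fx_bound c S a x" "fx_bound c S b y" "S > 0"
  shows "fx_bound c S (rdiv c (a * b) S) (x * y)"
proof -
  have S: "real_of_int S > 0" using assms by simp
  have "fx_bound c S (a * b) (real_of_int S * (x * y))"
  proof -
    have eq: "real_of_int S * (real_of_int S * (x * y)) = (real_of_int S * x) * (real_of_int S * y)" by simp
    show ?thesis
      using assms S unfolding fx_bound_def eq of_int_mult by (auto intro!: mult_mono mult_nonneg_nonneg)
  qed
  from fx_bound_div[OF this assms(3)] show ?thesis using S by simp
qed

lemma fx_bound_one: "c \<in> {0, 1} \<Longrightarrow> S > 0 \<Longrightarrow> fx_bound c S S 1"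
  by (auto simp: fx_bound_def)

text \<open>The tail of the series of \<open>artanh u / u\<close> from index \<open>j\<close>, with remainder \<open>E\<close>; \<open>W\<close> stands for \<open>u\<^sup>2\<close>.\<close>

fun fx_artanh :: "int \<Rightarrow> int \<Rightarrow> int \<Rightarrow> int \<Rightarrow> int \<Rightarrow> nat \<Rightarrow> int" where
  "fx_artanh c S W E j 0 = E"
| "fx_artanh c S W E j (Suc k) = rdiv c S (2 * j + 1) + rdiv c (W * fx_artanh c S W E (j + 1) k) S"

text \<open>Horner's scheme. All terms are nonnegative, so one direction of rounding is consistent
  throughout.\<close>

lemma fx_artanh_bound:
  assumes "c \<in> {0, 1}" "S > 0" "fx_bound c S W w" "fx_bound c S E e"
  shows "fx_bound c S (fx_artanh c S W E (int j) k) ((\<Sum>i<k. w ^ i / (2 * real (j + i) + 1)) + w ^ k * e)"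
proof (induction k arbitrary: j)
  case (Suc k)
  have "fx_bound c S (rdiv c S (2 * int j + 1)) (1 / of_int (2 * int j + 1))"
    using assms by (intro fx_bound_div fx_bound_one) auto
  moreover have "fx_bound c S (rdiv c (W * fx_artanh c S W E (int (Suc j)) k) S)
      (w * ((\<Sum>i<k. w ^ i / (2 * real (Suc j + i) + 1)) + w ^ k * e))"
    using assms Suc[of "Suc j"] by (intro fx_bound_mult)
  ultimately have "fx_bound c S (fx_artanh c S W E (int j) (Suc k))
     (1 / of_int (2 * int j + 1) + w * ((\<Sum>i<k. w ^ i / (2 * real (Suc j + i) + 1)) + w ^ k * e))"
    using fx_bound_add by (fastforce simp: add.commute)
  also have "1 / of_int (2 * int j + 1) + w * ((\<Sum>i<k. w ^ i / (2 * real (Suc j + i) + 1)) + w ^ k * e) =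
      (\<Sum>i<Suc k. w ^ i / (2 * real (j + i) + 1)) + w ^ Suc k * e"
    unfolding sum.lessThan_Suc_shift by (simp add: sum_distrib_left distrib_left)
  finally show ?case .
qed (use assms in simp)

lemma fx_bound_artanh:
  assumes c: "c \<in> {0, 1}" "S > 0" and u: "fx_bound c S U u" "u < 1" and y: "fx_bound c S Y (1 / (1 - u\<^sup>2))"
  shows "fx_bound c S (rdiv c (U * fx_artanh c S (rdiv c (U * U) S) (c * rdiv c Y (2 * int J + 1)) 0 J) S) (artanh u)"
proof -
  have u0: "0 \<le> u" using u by (simp add: fx_bound_def)
  have W: "fx_bound c S (rdiv c (U * U) S) (u\<^sup>2)"
    unfolding power2_eq_square using u(1) u(1) c(2) by (rule fx_bound_mult)
  \<comment> \<open>For \<open>c = 0\<close> the remainder vanishes, for \<open>c = 1\<close> it is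
    the geometric bound of the tail.\<close>
  have E: "fx_bound c S (c * rdiv c Y (2 * int J + 1)) (of_int c * (1 / (1 - u\<^sup>2) / of_int (2 * int J + 1)))"
    using c by (intro fx_bound_scale fx_bound_div y) auto
  define s where "s = (\<Sum>i<J. (u\<^sup>2) ^ i / (2 * real i + 1)) + (u\<^sup>2) ^ J * (of_int c * (1 / (1 - u\<^sup>2) / of_int (2 * int J + 1)))"
  have b: "fx_bound c S (rdiv c (U * fx_artanh c S (rdiv c (U * U) S) (c * rdiv c Y (2 * int J + 1)) 0 J) S) (u * s)"
    using fx_artanh_bound[OF c W E, of 0 J] unfolding s_def by (intro fx_bound_mult[OF u(1) _ c(2)]) simp
  have us: "u * s = (\<Sum>j<J. u ^ (2 * j + 1) / (2 * real j + 1)) +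
      of_int c * (u ^ (2 * J + 1) / ((2 * real J + 1) * (1 - u\<^sup>2)))"
  proof -
    have p: "u * (u\<^sup>2) ^ j = u ^ (2 * j + 1)" for j by (simp add: power_mult)
    have "u * ((u\<^sup>2) ^ J * (of_int c * (1 / (1 - u\<^sup>2) / of_int (2 * int J + 1)))) =
      of_int c * ((u * (u\<^sup>2) ^ J) / ((2 * real J + 1) * (1 - u\<^sup>2)))" by (simp add: mult_ac)
    moreover have "u * (\<Sum>i<J. (u\<^sup>2) ^ i / (2 * real i + 1)) = (\<Sum>i<J. (u * (u\<^sup>2) ^ i) / (2 * real i + 1))"
      by (simp add: sum_distrib_left)
    ultimately show ?thesis unfolding s_def p distrib_left by (simp only:)
  qed
  have "artanh u \<ge> 0" using artanh_bounds(1)[OF u0 u(2), of 0] by simp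
  show ?thesis
  proof (cases "c = 0")
    case True
    have "u * s \<le> artanh u" unfolding us using artanh_bounds(1)[OF u0 u(2), of J] True by simp
    hence "real_of_int S * (u * s) \<le> real_of_int S * artanh u" using c by (intro mult_left_mono) auto
    thus ?thesis using b True \<open>artanh u \<ge> 0\<close> by (auto simp: fx_bound_def)
  next
    case False
    hence c1: "c = 1" using c by simp
    have "artanh u \<le> u * s" unfolding us using artanh_bounds(2)[OF u0 u(2), of J] c1 by simp
    hence "real_of_int S * artanh u \<le> real_of_int S * (u * s)" using c by (intro mult_left_mono) auto
    thus ?thesis using b c1 \<open>artanh u \<ge> 0\<close> by (auto simp: fx_bound_def)
  qed
qed

text \<open>The series defining \<^const>\<open>sec_series\<close> from index \<open>n\<close> on, \<open>k\<close> further terms and a remainder;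
  \<open>b\<close>, \<open>p\<close> and \<open>r\<close> stand for \<open>cbin n * \<kappa>\<^sup>n\<close>, \<open>u * y\<^sup>n\<close> and \<^term>\<open>sec_int n u y L\<close>.\<close>

fun fx_sec :: "int \<Rightarrow> int \<Rightarrow> int \<Rightarrow> int \<Rightarrow> int \<Rightarrow> int \<Rightarrow> int \<Rightarrow> int \<Rightarrow> int \<Rightarrow> nat \<Rightarrow> int" where
  "fx_sec c S Y Kn Kd n b p r 0 = rdiv c (2 * c * rdiv c (b * r) S) (2 * n + 1)"
| "fx_sec c S Y Kn Kd n b p r (Suc k) = rdiv c (rdiv c (b * r) S) (2 * n + 1) +
     fx_sec c S Y Kn Kd (n + 1) (rdiv c ((2 * n + 1) * Kn * b) ((2 * n + 2) * Kd)) (rdiv c (p * Y) S)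
       (rdiv c (rdiv c (p * Y) S + (2 * n + 1) * r) (2 * n + 2)) k"

lemma fx_sec_bound:
  assumes c: "c \<in> {0, 1}" "S > 0" and K: "Kn \<ge> 0" "Kd > 0" "\<kappa> = of_int Kn / of_int Kd" and Y: "fx_bound c S Y y"
    and "fx_bound c S b (cbin n * \<kappa> ^ n)" "fx_bound c S p (u * y ^ n)" "fx_bound c S r (sec_int n u y L)"
  shows "fx_bound c S (fx_sec c S Y Kn Kd (int n) b p r k)
    ((\<Sum>i<k. cbin (n + i) * \<kappa> ^ (n + i) * sec_int (n + i) u y L / (2 * real (n + i) + 1)) +
      2 * of_int c * (cbin (n + k) * \<kappa> ^ (n + k) * sec_int (n + k) u y L) / (2 * real (n + k) + 1))"
  using assms(7-9)
proof (induction k arbitrary: n b p r)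
  case 0
  have "fx_bound c S (rdiv c (2 * c * rdiv c (b * r) S) (2 * int n + 1))
    (of_int (2 * c) * (cbin n * \<kappa> ^ n * sec_int n u y L) / of_int (2 * int n + 1))"
    using c 0 by (intro fx_bound_div fx_bound_scale fx_bound_mult) auto
  thus ?case by simp
next
  case (Suc k)
  let ?p = "rdiv c (p * Y) S" and ?b = "rdiv c ((2 * int n + 1) * Kn * b) ((2 * int n + 2) * Kd)"
  let ?r = "rdiv c (rdiv c (p * Y) S + (2 * int n + 1) * r) (2 * int n + 2)"
  have p: "fx_bound c S ?p (u * y ^ Suc n)"
    using fx_bound_mult[OF Suc.prems(2) Y c(2)] by (simp add: mult_ac)
  have b: "fx_bound c S ?b (cbin (Suc n) * \<kappa> ^ Suc n)"
  proof -
    have "fx_bound c S ?b (of_int ((2 * int n + 1) * Kn) * (cbin n * \<kappa> ^ n) / of_int ((2 * int n + 2) * Kd))"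
      using K by (intro fx_bound_div fx_bound_scale Suc.prems) auto
    also have "of_int ((2 * int n + 1) * Kn) * (cbin n * \<kappa> ^ n) / of_int ((2 * int n + 2) * Kd) =
        cbin (Suc n) * \<kappa> ^ Suc n" using K by (simp add: mult_ac)
    finally show ?thesis .
  qed
  have r: "fx_bound c S ?r (sec_int (Suc n) u y L)"
  proof -
    have "fx_bound c S ?r ((u * y ^ Suc n + of_int (2 * int n + 1) * sec_int n u y L) / of_int (2 * int n + 2))"
      by (intro fx_bound_div fx_bound_add fx_bound_scale p Suc.prems) auto
    also have "(u * y ^ Suc n + of_int (2 * int n + 1) * sec_int n u y L) / of_int (2 * int n + 2) =
        sec_int (Suc n) u y L"
    proof -
      have "real_of_int (2 * int n + 1) = 2 * real n + 1" "real_of_int (2 * int n + 2) = 2 * real n + 2" by simp_all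
      moreover have "(a + m * s) / d = a / d + m / d * s" for a m s d :: real
        by (simp add: add_divide_distrib)
      ultimately show ?thesis by (simp only: sec_int.simps)
    qed
    finally show ?thesis .
  qed
  have t: "fx_bound c S (rdiv c (rdiv c (b * r) S) (2 * int n + 1))
      (cbin n * \<kappa> ^ n * sec_int n u y L / of_int (2 * int n + 1))"
    using c Suc.prems by (intro fx_bound_div fx_bound_mult) auto
  have n1: "int n + 1 = int (Suc n)" by simp
  from fx_bound_add[OF t Suc.IH[OF b p r]]
  show ?case unfolding fx_sec.simps n1 sum.lessThan_Suc_shift
    by (simp add: add.assoc del: cbin.simps sec_int.simps)
qed

text \<open>\<open>D\<close> is 0 for \<open>c = 0\<close> and twice the first omitted Taylor
  coefficient for \<open>c = 1\<close>. The same \<open>Y\<close> serves the secant recursion and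
  the remainder of \<open>artanh (sin x)\<close>, as
  \<open>1 - (sin x)\<^sup>2 = (cos x)\<^sup>2\<close>.\<close>

lemma fx_bound_arcsin_sec_int:
  fixes c S M U Y K Kn Kd :: int
  assumes c: "c \<in> {0, 1}" "S > 0" and K: "Kn \<ge> 0" "Kd > 0" "k\<^sup>2 = of_int Kn / of_int Kd" "fx_bound c S K k"
    and u: "fx_bound c S U (sin x)" "cos x > 0" and y: "fx_bound c S Y (1 / (cos x)\<^sup>2)"
  shows "fx_bound c S
    (rdiv c (K * fx_sec c S Y Kn Kd 0 S U
       (rdiv c (U * fx_artanh c S (rdiv c (U * U) S) (c * rdiv c Y (2 * int J + 1)) 0 J) S) (Suc N)) S)
    (arcsin_sec_int k N (2 * of_int c * cbin (Suc N)) x)"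
proof -
  have u1: "sin x < 1"
  proof -
    have "(cos x)\<^sup>2 > 0" using u by simp
    hence "(sin x)\<^sup>2 < 1\<^sup>2" using sin_cos_squared_add[of x] unfolding one_power2 by linarith
    thus ?thesis by (rule power2_less_imp_less) simp
  qed
  have L: "fx_bound c S (rdiv c (U * fx_artanh c S (rdiv c (U * U) S) (c * rdiv c Y (2 * int J + 1)) 0 J) S)
      (artanh (sin x))"
    using y by (intro fx_bound_artanh c u(1) u1) (simp add: cos_squared_eq)
  have "fx_bound c S (fx_sec c S Y Kn Kd (int 0) S U
       (rdiv c (U * fx_artanh c S (rdiv c (U * U) S) (c * rdiv c Y (2 * int J + 1)) 0 J) S) (Suc N))
    (sec_series (k\<^sup>2) N (2 * of_int c * cbin (Suc N)) (sin x) (1 / (cos x)\<^sup>2) (artanh (sin x)))"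
  proof -
    have "(\<Sum>i<Suc N. cbin (0 + i) * (k\<^sup>2) ^ (0 + i) * sec_int_at (0 + i) x / (2 * real (0 + i) + 1)) +
      2 * of_int c * (cbin (0 + Suc N) * (k\<^sup>2) ^ (0 + Suc N) * sec_int_at (0 + Suc N) x) / (2 * real (0 + Suc N) + 1) =
      sec_series (k\<^sup>2) N (2 * of_int c * cbin (Suc N)) (sin x) (1 / (cos x)\<^sup>2) (artanh (sin x))"
      unfolding sec_series_def lessThan_Suc_atMost
      by (intro arg_cong2[where f = "(+)"] sum.cong) (simp_all del: cbin.simps sec_int.simps power_Suc add: add.commute mult.assoc)
    thus ?thesis
      using fx_sec_bound[OF c K(1-3) y, where n = 0 and b = S and p = U and u = "sin x" and L = "artanh (sin x)"
          and k = "Suc N"] fx_bound_one[OF c] u(1) L by (simp only: cbin.simps power_0 mult_1_right sec_int.simps)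
  qed
  thus ?thesis unfolding arcsin_sec_int_def using K(4) c(2) by (intro fx_bound_mult) simp_all
qed

text \<open>The series of \<open>arcsin u / u\<close> from index \<open>n\<close> on;
  \<open>W\<close> stands for \<open>u\<^sup>2\<close> and \<open>b\<close> for
  \<open>cbin n * u ^ (2 * n)\<close>. The last term carries the factor \<open>2 * c\<close> of the
  enlarged coefficient.\<close>

fun fx_arcsin :: "int \<Rightarrow> int \<Rightarrow> int \<Rightarrow> int \<Rightarrow> int \<Rightarrow> nat \<Rightarrow> int" where
  "fx_arcsin c S W n b 0 = rdiv c (2 * c * b) (2 * n + 1)"
| "fx_arcsin c S W n b (Suc k) = rdiv c b (2 * n + 1) +
     fx_arcsin c S W (n + 1) (rdiv c (rdiv c ((2 * n + 1) * b) (2 * n + 2) * W) S) k"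

lemma fx_arcsin_bound:
  assumes c: "c \<in> {0, 1}" "S > 0" and W: "fx_bound c S W w" and "fx_bound c S b (cbin n * w ^ n)"
  shows "fx_bound c S (fx_arcsin c S W (int n) b k)
    ((\<Sum>i<k. cbin (n + i) * w ^ (n + i) / (2 * real (n + i) + 1)) +
      2 * of_int c * (cbin (n + k) * w ^ (n + k)) / (2 * real (n + k) + 1))"
  using assms(4)
proof (induction k arbitrary: n b)
  case 0
  have "fx_bound c S (rdiv c (2 * c * b) (2 * int n + 1))
    (of_int (2 * c) * (cbin n * w ^ n) / of_int (2 * int n + 1))"
    using c 0 by (intro fx_bound_div fx_bound_scale) auto
  thus ?case by simp
next
  case (Suc k)
  let ?b = "rdiv c (rdiv c ((2 * int n + 1) * b) (2 * int n + 2) * W) S"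
  have "fx_bound c S ?b (of_int (2 * int n + 1) * (cbin n * w ^ n) / of_int (2 * int n + 2) * w)"
    using c by (intro fx_bound_mult fx_bound_div fx_bound_scale Suc.prems W) auto
  also have "of_int (2 * int n + 1) * (cbin n * w ^ n) / of_int (2 * int n + 2) * w = cbin (Suc n) * w ^ Suc n"
    by (simp add: mult_ac)
  finally have b: "fx_bound c S ?b (cbin (Suc n) * w ^ Suc n)" .
  have t: "fx_bound c S (rdiv c b (2 * int n + 1)) (cbin n * w ^ n / of_int (2 * int n + 1))"
    using Suc.prems by (intro fx_bound_div) auto
  have n1: "int n + 1 = int (Suc n)" by simp
  from fx_bound_add[OF t Suc.IH[OF b]]
  show ?case unfolding fx_arcsin.simps n1 sum.lessThan_Suc_shift
    by (simp add: add.assoc del: cbin.simps)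
qed

text \<open>For \<open>D = 2 * cbin (M + 1)\<close> the condition amounts to
  \<open>2 * (2 * M + 3) * W \<le> 2 * M + 2\<close>, and at \<open>W = 0.3\<close> the left side is
  \<open>1.2 * M + 1.8\<close>. This is the origin of the bound 0.3 on the squared sines.\<close>

lemma cbin_remainder:
  assumes "W \<le> 0.3"
  shows "(2 * real M + 1) * cbin M \<le>
    2 * cbin (Suc M) * (2 * real M + 2) - 2 * cbin (Suc M) * (2 * real M + 3) * W"
proof -
  have c: "(2 * real M + 2) * cbin (Suc M) = (2 * real M + 1) * cbin M" by simp
  have "(2 * real M + 3) * W \<le> (2 * real M + 3) * 0.3" using assms by (intro mult_left_mono) auto
  hence "2 * ((2 * real M + 3) * W) \<le> 2 * real M + 2" by simp
  hence "2 * ((2 * real M + 3) * W) * cbin (Suc M) \<le> (2 * real M + 2) * cbin (Suc M)"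
    using cbin_pos[of "Suc M"] by (intro mult_right_mono) auto
  thus ?thesis unfolding c[symmetric] by (simp add: algebra_simps del: cbin.simps)
qed

lemma fx_bound_angle:
  assumes c: "c \<in> {0, 1}" "S > 0" and b: "0 < b" "b < pi / 2" "(sin b)\<^sup>2 \<le> 0.3" and U: "fx_bound c S U (sin b)"
  shows "fx_bound c S (rdiv c (U * fx_arcsin c S (rdiv c (U * U) S) 0 S (Suc N)) S) b"
proof -
  have W: "fx_bound c S (rdiv c (U * U) S) ((sin b)\<^sup>2)"
    unfolding power2_eq_square using U U c(2) by (rule fx_bound_mult)
  define D where "D = 2 * of_int c * cbin (Suc N)"
  have "sin b * ((\<Sum>i<Suc N. cbin (0 + i) * ((sin b)\<^sup>2) ^ (0 + i) / (2 * real (0 + i) + 1)) +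
      2 * of_int c * (cbin (0 + Suc N) * ((sin b)\<^sup>2) ^ (0 + Suc N)) / (2 * real (0 + Suc N) + 1)) = arcsin_poly N D (sin b)"
  proof -
    have p: "sin b * (a * ((sin b)\<^sup>2) ^ j / d) = a / d * sin b ^ (2 * j + 1)" for a d j
      by (simp add: power_mult)
    have e: "2 * N + 3 = 2 * Suc N + 1" "2 * real N + 3 = 2 * real (Suc N) + 1" by simp_all
    show ?thesis
      unfolding arcsin_poly_def lessThan_Suc_atMost distrib_left sum_distrib_left add_0 e D_def
      by (simp only: p mult.assoc[symmetric])
  qed
  moreover have "fx_bound c S (rdiv c (U * fx_arcsin c S (rdiv c (U * U) S) (int 0) S (Suc N)) S)
     (sin b * ((\<Sum>i<Suc N. cbin (0 + i) * ((sin b)\<^sup>2) ^ (0 + i) / (2 * real (0 + i) + 1)) +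
      2 * of_int c * (cbin (0 + Suc N) * ((sin b)\<^sup>2) ^ (0 + Suc N)) / (2 * real (0 + Suc N) + 1)))"
    using fx_bound_one[OF c] by (intro fx_bound_mult[OF U _ c(2)] fx_arcsin_bound c W) simp
  ultimately have P: "fx_bound c S (rdiv c (U * fx_arcsin c S (rdiv c (U * U) S) 0 S (Suc N)) S) (arcsin_poly N D (sin b))"
    by simp
  have ab: "arcsin (sin b) = b" using b by (intro arcsin_sin) auto
  have s0: "sin b \<ge> 0" using U by (simp add: fx_bound_def)
  have "(sin b)\<^sup>2 < 1\<^sup>2" using b(3) by simp
  hence s1: "sin b < 1" by (rule power2_less_imp_less) simp
  show ?thesis
  proof (cases "c = 0")
    case True
    have "arcsin_poly N D (sin b) \<le> arcsin (sin b)"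
      using s0 s1 True cbin_pos[of N] by (intro arcsin_poly_le) (auto simp: D_def)
    hence "real_of_int S * arcsin_poly N D (sin b) \<le> real_of_int S * b"
      unfolding ab using c by (intro mult_left_mono) auto
    thus ?thesis using P True b(1) by (auto simp: fx_bound_def)
  next
    case False
    hence c1: "c = 1" using c by simp
    have "arcsin (sin b) \<le> arcsin_poly N D (sin b)"
      using s0 b(3) c1 cbin_remainder[of "0.3" N] cbin_pos[of "Suc N"]
      by (intro arcsin_poly_ge[where W = "0.3"]) (auto simp: D_def simp del: cbin.simps)
    hence "real_of_int S * b \<le> real_of_int S * arcsin_poly N D (sin b)"
      unfolding ab using c by (intro mult_left_mono) auto
    thus ?thesis using P c1 b(1) by (auto simp: fx_bound_def)
  qed
qed

text \<open>Square roots and reciprocals are supplied as candidate integers and certified by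
  squaring or multiplying out.\<close>

lemma fx_bound_sin_cos:
  assumes b: "0 < b" "b < pi / 2" and q: "ql \<le> (sin b)\<^sup>2" "(sin b)\<^sup>2 \<le> qh" "qh < 1" and S: "S > 0"
    and U: "0 \<le> U0" "0 \<le> U1" "(real_of_int U0)\<^sup>2 \<le> (of_int S)\<^sup>2 * ql" "(of_int S)\<^sup>2 * qh \<le> (real_of_int U1)\<^sup>2"
    and Y: "0 \<le> Y0" "0 \<le> Y1" "of_int Y0 * (1 - ql) \<le> of_int S" "of_int S \<le> of_int Y1 * (1 - qh)"
  shows "fx_bound 0 S U0 (sin b)" "fx_bound 1 S U1 (sin b)"
    and "fx_bound 0 S Y0 (1 / (cos b)\<^sup>2)" "fx_bound 1 S Y1 (1 / (cos b)\<^sup>2)"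
proof -
  have sin: "0 < sin b" using b by (intro sin_gt_zero) auto
  have S': "0 < real_of_int S" using S by simp
  have "(real_of_int U0)\<^sup>2 \<le> (of_int S * sin b)\<^sup>2"
    using U(3) mult_left_mono[OF q(1), of "(of_int S)\<^sup>2"] unfolding power_mult_distrib by simp
  hence "real_of_int U0 \<le> of_int S * sin b" using sin S' by (intro power2_le_imp_le[OF _ mult_nonneg_nonneg]) auto
  thus "fx_bound 0 S U0 (sin b)" using U sin by (simp add: fx_bound_def)
  have "(of_int S * sin b)\<^sup>2 \<le> (real_of_int U1)\<^sup>2"
    using U(4) mult_left_mono[OF q(2), of "(of_int S)\<^sup>2"] unfolding power_mult_distrib by simp
  hence "of_int S * sin b \<le> real_of_int U1" by (rule power2_le_imp_le) (use U(2) in simp)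
  thus "fx_bound 1 S U1 (sin b)" using U sin by (simp add: fx_bound_def)
  have cs: "(cos b)\<^sup>2 = 1 - (sin b)\<^sup>2" by (rule cos_squared_eq)
  have pos: "0 < 1 - (sin b)\<^sup>2" using q by simp
  have "of_int Y0 * (1 - (sin b)\<^sup>2) \<le> of_int Y0 * (1 - ql)" using q Y by (intro mult_left_mono) auto
  hence "of_int Y0 \<le> of_int S / (1 - (sin b)\<^sup>2)" using Y(3) pos by (simp add: pos_le_divide_eq)
  thus "fx_bound 0 S Y0 (1 / (cos b)\<^sup>2)" using Y pos by (simp add: fx_bound_def cs)
  have "of_int Y1 * (1 - qh) \<le> of_int Y1 * (1 - (sin b)\<^sup>2)" using q Y by (intro mult_left_mono) auto
  hence "of_int S / (1 - (sin b)\<^sup>2) \<le> of_int Y1" using Y(4) pos by (simp add: pos_divide_le_eq)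
  thus "fx_bound 1 S Y1 (1 / (cos b)\<^sup>2)" using Y pos by (simp add: fx_bound_def cs)
qed

text \<open>17 here, and 20 and 12 in \<open>fx_arcsin_sec_int\<close>, are truncation orders. With
  scale \<open>10 ^ 12\<close> the enclosures at the four angles come out narrower than
  \<open>10 ^ (-10)\<close>.\<close>

definition fx_angle :: "int \<Rightarrow> int \<Rightarrow> int \<Rightarrow> int" where
  "fx_angle c S U = rdiv c (U * fx_arcsin c S (rdiv c (U * U) S) 0 S (Suc 17)) S"

definition fx_arcsin_sec_int :: "int \<Rightarrow> int \<Rightarrow> int \<Rightarrow> int \<Rightarrow> int \<Rightarrow> int \<Rightarrow> int \<Rightarrow> int" where
  "fx_arcsin_sec_int c S K Kn Kd U Y = rdiv c (K * fx_sec c S Y Kn Kd 0 S U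
     (rdiv c (U * fx_artanh c S (rdiv c (U * U) S) (c * rdiv c Y (2 * int 20 + 1)) 0 20) S) (Suc 12)) S"

lemma fx_enclosure:
  assumes b: "0 < b" "b < pi / 2" and q: "ql \<le> (sin b)\<^sup>2" "(sin b)\<^sup>2 \<le> qh"
    and qh: "qh \<le> 0.3" and S: "S > 0"
    and U: "0 \<le> U0" "0 \<le> U1" "(real_of_int U0)\<^sup>2 \<le> (of_int S)\<^sup>2 * ql" "(of_int S)\<^sup>2 * qh \<le> (real_of_int U1)\<^sup>2"
    and Y: "0 \<le> Y0" "0 \<le> Y1" "of_int Y0 * (1 - ql) \<le> of_int S" "of_int S \<le> of_int Y1 * (1 - qh)"
    and K: "0 \<le> K0" "0 \<le> K1" "0 \<le> Kn" "0 < Kd" "(real_of_int K0)\<^sup>2 * of_int Kd \<le> (of_int S)\<^sup>2 * of_int Kn"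
      "(of_int S)\<^sup>2 * of_int Kn \<le> (real_of_int K1)\<^sup>2 * of_int Kd"
    and eval: "fx_angle 0 S U0 = A0" "fx_angle 1 S U1 = A1"
      "fx_arcsin_sec_int 0 S K0 Kn Kd U0 Y0 = V0" "fx_arcsin_sec_int 1 S K1 Kn Kd U1 Y1 = V1"
  shows "of_int A0 / of_int S \<le> b" "b \<le> of_int A1 / of_int S"
    and "of_int V0 / of_int S \<le> arcsin_sec_int (sqrt (of_int Kn / of_int Kd)) 12 0 b"
    and "arcsin_sec_int (sqrt (of_int Kn / of_int Kd)) 12 (2 * cbin 13) b \<le> of_int V1 / of_int S"
proof -
  let ?k = "sqrt (of_int Kn / of_int Kd)"
  have S': "0 < real_of_int S" and Kd': "0 < real_of_int Kd" using S K by simp_all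
  have qh1: "qh < 1" using qh by simp
  note sc = fx_bound_sin_cos[OF b q qh1 S U Y]
  have k2: "?k\<^sup>2 = of_int Kn / of_int Kd" "?k \<ge> 0" using K by simp_all
  have Sk: "(of_int S * ?k)\<^sup>2 = (of_int S)\<^sup>2 * of_int Kn / of_int Kd"
    unfolding power_mult_distrib k2 by simp
  have "(real_of_int K0)\<^sup>2 \<le> (of_int S * ?k)\<^sup>2"
    unfolding Sk using K(5) Kd' by (simp add: pos_le_divide_eq)
  hence "real_of_int K0 \<le> of_int S * ?k" by (rule power2_le_imp_le) (use S' k2 in simp)
  hence k0: "fx_bound 0 S K0 ?k" using K k2 by (simp add: fx_bound_def)
  have "(of_int S * ?k)\<^sup>2 \<le> (real_of_int K1)\<^sup>2"
    unfolding Sk using K(6) Kd' by (simp add: pos_divide_le_eq)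
  hence "of_int S * ?k \<le> real_of_int K1" by (rule power2_le_imp_le) (use K(2) in simp)
  hence k1: "fx_bound 1 S K1 ?k" using K k2 by (simp add: fx_bound_def)
  have sq: "(sin b)\<^sup>2 \<le> 0.3" using q qh by linarith
  have cos: "cos b > 0" using b by (intro cos_gt_zero_pi) auto
  have c: "(0::int) \<in> {0, 1}" "(1::int) \<in> {0, 1}" by simp_all
  note a = fx_bound_angle[OF c(1) S b sq sc(1), of 17] fx_bound_angle[OF c(2) S b sq sc(2), of 17]
  note g = fx_bound_arcsin_sec_int[OF c(1) S K(3,4) k2(1) k0 sc(1) cos sc(3), where J = 20 and N = 12]
    fx_bound_arcsin_sec_int[OF c(2) S K(3,4) k2(1) k1 sc(2) cos sc(4), where J = 20 and N = 12]
  show "of_int A0 / of_int S \<le> b" "b \<le> of_int A1 / of_int S"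
    using a[folded fx_angle_def] eval S' by (simp_all add: fx_bound_def field_simps)
  have "fx_bound 0 S V0 (arcsin_sec_int ?k 12 0 b)"
    using g(1)[folded fx_arcsin_sec_int_def] eval by simp
  thus "of_int V0 / of_int S \<le> arcsin_sec_int ?k 12 0 b"
    using S' by (simp add: fx_bound_def pos_divide_le_eq mult.commute)
  have "Suc 12 = 13" by simp
  hence "fx_bound 1 S V1 (arcsin_sec_int ?k 12 (2 * cbin 13) b)"
    using g(2)[folded fx_arcsin_sec_int_def] eval(4) by (simp del: cbin.simps)
  thus "arcsin_sec_int ?k 12 (2 * cbin 13) b \<le> of_int V1 / of_int S"
    using S' by (simp add: fx_bound_def pos_le_divide_eq mult.commute)
qed

section \<open>Evaluation at the half endpoints and at the crossing angle\<close>

lemma fx_eval_b0: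
  "fx_angle 0 1000000000000 208721190616 = 210267167640" "fx_angle 1 1000000000000 208721190617 = 210267167646"
  "fx_arcsin_sec_int 0 1000000000000 204124145231 1 24 208721190616 1045548849896 = 43551182523"
  "fx_arcsin_sec_int 1 1000000000000 204124145232 1 24 208721190617 1045548849897 = 43551182528"
  by code_simp+

lemma fx_eval_b1:
  "fx_angle 0 1000000000000 469139376630 = 488316004077" "fx_angle 1 1000000000000 469139376631 = 488316004088"
  "fx_arcsin_sec_int 0 1000000000000 204124145231 1 24 469139376630 1282202112918 = 104696037452"
  "fx_arcsin_sec_int 1 1000000000000 204124145232 1 24 469139376631 1282202112919 = 104696037457"
  by code_simp+

lemma fx_eval_b2:
  "fx_angle 0 1000000000000 543944716646 = 575130995748" "fx_angle 1 1000000000000 543944716647 = 575130995761"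
  "fx_arcsin_sec_int 0 1000000000000 456435464587 5 24 543944716646 1420204102886 = 290642597121"
  "fx_arcsin_sec_int 1 1000000000000 456435464588 5 24 543944716647 1420204102887 = 290642597189"
  by code_simp+

lemma fx_eval_a1:
  "fx_angle 0 1000000000000 231138677071 = 233247890194" "fx_angle 1 1000000000000 231138677072 = 233247890201"
  "fx_arcsin_sec_int 0 1000000000000 456435464587 5 24 231138677071 1056440422583 = 111658352153"
  "fx_arcsin_sec_int 1 1000000000000 456435464588 5 24 231138677072 1056440422584 = 111658352163"
  by code_simp+

text \<open>Meant for half of the smallest endpoint; the next two enclosures are for the halves of
  the middle and the largest endpoint, the last for the value of the inverse function at the
  crossing.\<close>

lemma enclosure_b0:
  assumes b: "0 < b" "b < pi / 2" and q: "0.043564535412361 \<le> (sin b)\<^sup>2" "(sin b)\<^sup>2 \<le> 0.043564535412362"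
  shows "0.21026716764 \<le> b" "b \<le> 0.210267167646"
    and "0.043551182523 \<le> arcsin_sec_int (sqrt (1 / 24)) 12 0 b"
    and "arcsin_sec_int (sqrt (1 / 24)) 12 (2 * cbin 13) b \<le> 0.043551182528"
  using fx_enclosure[OF b q, of 1000000000000 208721190616 208721190617 1045548849896 1045548849897 204124145231 204124145232 1 24 210267167640 210267167646 43551182523 43551182528]
    fx_eval_b0 by (simp_all add: power2_eq_square)

lemma enclosure_b1:
  assumes b: "0 < b" "b < pi / 2" and q: "0.220091754704943 \<le> (sin b)\<^sup>2" "(sin b)\<^sup>2 \<le> 0.220091754704944"
  shows "0.488316004077 \<le> b" "b \<le> 0.488316004088"
    and "0.104696037452 \<le> arcsin_sec_int (sqrt (1 / 24)) 12 0 b"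
    and "arcsin_sec_int (sqrt (1 / 24)) 12 (2 * cbin 13) b \<le> 0.104696037457"
  using fx_enclosure[OF b q, of 1000000000000 469139376630 469139376631 1282202112918 1282202112919 204124145231 204124145232 1 24 488316004077 488316004088 104696037452 104696037457]
    fx_eval_b1 by (simp_all add: power2_eq_square)

lemma enclosure_b2:
  assumes b: "0 < b" "b < pi / 2" and q: "0.295875854768068 \<le> (sin b)\<^sup>2" "(sin b)\<^sup>2 \<le> 0.295875854768069"
  shows "0.575130995748 \<le> b" "b \<le> 0.575130995761"
    and "0.290642597121 \<le> arcsin_sec_int (sqrt (5 / 24)) 12 0 b"
    and "arcsin_sec_int (sqrt (5 / 24)) 12 (2 * cbin 13) b \<le> 0.290642597189"
  using fx_enclosure[OF b q, of 1000000000000 543944716646 543944716647 1420204102886 1420204102887 456435464587 456435464588 5 24 575130995748 575130995761 290642597121 290642597189]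
    fx_eval_b2 by (simp_all add: power2_eq_square)

lemma enclosure_a1:
  assumes b: "0 < b" "b < pi / 2" and q: "0.053425088038277 \<le> (sin b)\<^sup>2" "(sin b)\<^sup>2 \<le> 0.053425088038278"
  shows "0.233247890194 \<le> b" "b \<le> 0.233247890201"
    and "0.111658352153 \<le> arcsin_sec_int (sqrt (5 / 24)) 12 0 b"
    and "arcsin_sec_int (sqrt (5 / 24)) 12 (2 * cbin 13) b \<le> 0.111658352163"
  using fx_enclosure[OF b q, of 1000000000000 231138677071 231138677072 1056440422583 1056440422584 456435464587 456435464588 5 24 233247890194 233247890201 111658352153 111658352163]
    fx_eval_a1 by (simp_all add: power2_eq_square)

text \<open>An enclosure provides a lower bound with \<open>D = 0\<close> and an upper bound with
  the larger \<open>D\<close>. In a difference of two values with one common \<open>D\<close> both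
  kinds of bound occur, so one of them has to be carried over.\<close>

lemma arcsin_sec_int_mono:
  assumes "0 < x" "x < pi / 2" "0 \<le> k" "D \<le> D'"
  shows "arcsin_sec_int k M D x \<le> arcsin_sec_int k M D' x"
proof -
  have "0 < sin x" "0 < cos x" using assms by (auto intro!: sin_gt_zero cos_gt_zero_pi)
  moreover from this have "sin x < 1"
  proof -
    have "(cos x)\<^sup>2 > 0" using \<open>0 < cos x\<close> by simp
    hence "(sin x)\<^sup>2 < 1\<^sup>2" using sin_cos_squared_add[of x] unfolding one_power2 by linarith
    thus ?thesis by (rule power2_less_imp_less) simp
  qed
  ultimately have "0 \<le> sec_int_at (Suc M) x"
    using artanh_bounds(1)[of "sin x" 0] by (intro sec_int_nonneg) auto
  hence "D / (2 * real M + 3) * (k\<^sup>2) ^ Suc M * sec_int_at (Suc M) x \<le>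
      D' / (2 * real M + 3) * (k\<^sup>2) ^ Suc M * sec_int_at (Suc M) x"
    using assms(4) by (intro mult_right_mono divide_right_mono) auto
  thus ?thesis
    unfolding arcsin_sec_int_def sec_series_def using assms(3) by (intro mult_left_mono add_left_mono)
qed

lemma p6_value_bounds: "0.0717258 \<le> p6_value" "p6_value < 0.0717259"
proof -
  define x y z where "x = sqrt 30 / 6" and "y = sqrt 6 / 6" and "z = (sqrt 19 - 1) / 6"
  define t0 t1 t2 where "t0 = arccos x" and "t1 = arccos z" and "t2 = arccos y"
  define k1 k2 where "k1 = sqrt (1 / 24)" and "k2 = sqrt (5 / 24)"
  note folds = x_def[symmetric] y_def[symmetric] z_def[symmetric]
  note folds2 = t0_def[symmetric] t1_def[symmetric] t2_def[symmetric] k1_def[symmetric] k2_def[symmetric]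
  define I1 where "I1 = integral {t0..t1} (\<lambda>t. arccos ((- 5 - 6 * cos t) / (6 + 6 * cos t)) - (pi - t))"
  define I2 where "I2 = integral {t1..t2} (\<lambda>t. arccos ((1 - 6 * cos t) / (6 - 6 * cos t)) - (pi - t))"
  define b0 b1 b2 a1 where "b0 = t0 / 2" and "b1 = t1 / 2" and "b2 = t2 / 2" and "a1 = arccos (k2 / sin b1)"
  define C where "C = 2 * cbin 13"
  define G1 where "G1 D b = arcsin_sec_int k1 12 D b" for D b
  define G2 where "G2 D b = arcsin_sec_int k2 12 D b" for D b
  note ea = endpoint_angles[folded x_def y_def z_def, folded t0_def t1_def t2_def]
  note ev = endpoint_values[unfolded folds, unfolded folds2, folded b0_def b1_def b2_def, folded a1_def]
  have C0: "0 \<le> C" unfolding C_def using cbin_pos[of 13] by (simp del: cbin.simps)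
  have S13: "Suc 12 = 13" by simp
  have rem: "(2 * real 12 + 1) * cbin 12 \<le> C * (2 * real 12 + 2) - C * (2 * real 12 + 3) * W" if "W \<le> 0.3" for W
    using cbin_remainder[OF that, of 12] unfolding C_def S13 .
  have low: "0 * (2 * real 12 + 2) \<le> (2 * real 12 + 1) * cbin 12" using cbin_pos[of 12] by simp
  note fI = first_integral_bounds[unfolded folds, unfolded folds2, folded I1_def]
  note sI = second_integral_bounds[unfolded folds, unfolded folds2, folded I2_def]
  have bs: "0 < b0" "b0 < pi / 2" "0 < b1" "b1 < pi / 2" "0 < b2" "b2 < pi / 2" "0 < a1" "a1 < pi / 2"
    using ea ev pi_gt_zero by (auto simp: b0_def b1_def b2_def)
  \<comment> \<open>The terms in \<open>t1\<^sup>2\<close> cancel between the two integrals, and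
    \<open>g b2 = b2\<close> turns the quadratic part at \<open>t2\<close> into
    \<open>- 2 * b2\<^sup>2\<close>.\<close>
  have up: "I1 + I2 \<le> 4 * b1 * a1 - 2 * b0\<^sup>2 - 2 * b2\<^sup>2 - 4 * (G1 0 b1 - G1 0 b0) + 4 * (G2 C b2 - G2 C a1)"
    using fI(1)[OF order_refl low] sI(2)[OF C0 rem] unfolding b0_def[symmetric] b1_def[symmetric] b2_def[symmetric] a1_def[symmetric]
      G1_def[symmetric] G2_def[symmetric] ev(4)
    by (simp add: b0_def b1_def b2_def power2_eq_square field_simps)
  have lo: "4 * b1 * a1 - 2 * b0\<^sup>2 - 2 * b2\<^sup>2 - 4 * (G1 C b1 - G1 C b0) + 4 * (G2 0 b2 - G2 0 a1) \<le> I1 + I2"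
    using fI(2)[OF C0 rem] sI(1)[OF order_refl low] unfolding b0_def[symmetric] b1_def[symmetric] b2_def[symmetric] a1_def[symmetric]
      G1_def[symmetric] G2_def[symmetric] ev(4)
    by (simp add: b0_def b1_def b2_def power2_eq_square field_simps)
  have p6: "p6_value = 4 / pi\<^sup>2 * (I1 + I2)"
    unfolding p6_value_def folds folds2 I1_def I2_def ..
  \<comment> \<open>Sixteen decimals of the roots support the fifteen decimals of the squared
    sines.\<close>
  have "sqrt 30 \<in> {5.4772255750516611..5.4772255750516612}" "sqrt 19 \<in> {4.3588989435406735..4.3588989435406736}"
    "sqrt 6 \<in> {2.4494897427831780..2.4494897427831781}"
    unfolding atLeastAtMost_iff
    by (intro conjI real_le_rsqrt real_le_lsqrt; simp add: power2_eq_square)+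
  hence xyz: "x \<in> {5.4772255750516611 / 6..5.4772255750516612 / 6}" "z \<in> {3.3588989435406735 / 6..3.3588989435406736 / 6}"
    "y \<in> {2.4494897427831780 / 6..2.4494897427831781 / 6}"
    by (auto simp: x_def y_def z_def)
  have e0: "0.043564535412361 \<le> (sin b0)\<^sup>2" "(sin b0)\<^sup>2 \<le> 0.043564535412362"
    using xyz unfolding ev(1) by auto
  have e1: "0.220091754704943 \<le> (sin b1)\<^sup>2" "(sin b1)\<^sup>2 \<le> 0.220091754704944"
    using xyz unfolding ev(2) by auto
  have e2: "0.295875854768068 \<le> (sin b2)\<^sup>2" "(sin b2)\<^sup>2 \<le> 0.295875854768069"
    using xyz unfolding ev(3) by auto
  have e3: "0.053425088038277 \<le> (sin a1)\<^sup>2" "(sin a1)\<^sup>2 \<le> 0.053425088038278"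
    using xyz unfolding ev(5) by (auto simp: field_simps)
  note E0 = enclosure_b0[OF bs(1,2) e0, folded k1_def C_def, folded G1_def]
  note E1 = enclosure_b1[OF bs(3,4) e1, folded k1_def C_def, folded G1_def]
  note E2 = enclosure_b2[OF bs(5,6) e2, folded k2_def C_def, folded G2_def]
  note E3 = enclosure_a1[OF bs(7,8) e3, folded k2_def C_def, folded G2_def]
  have mono: "G1 0 b0 \<le> G1 C b0" "G1 0 b1 \<le> G1 C b1" "G2 0 b2 \<le> G2 C b2" "G2 0 a1 \<le> G2 C a1"
    unfolding G1_def G2_def k1_def k2_def by (intro arcsin_sec_int_mono bs C0; simp)+
  have prod: "0.488316004077 * 0.233247890194 \<le> b1 * a1" "b1 * a1 \<le> 0.488316004088 * 0.233247890201"
    using E1(1,2) E3(1,2) by (intro mult_mono; simp)+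
  have sq: "0.210267167640\<^sup>2 \<le> b0\<^sup>2" "b0\<^sup>2 \<le> 0.210267167646\<^sup>2" "0.575130995748\<^sup>2 \<le> b2\<^sup>2" "b2\<^sup>2 \<le> 0.575130995761\<^sup>2"
    using E0(1,2) E2(1,2) bs by (intro power_mono; simp)+
  \<comment> \<open>Half of \<open>t0 + t2 = pi / 2\<close> reads \<open>b0 + b2 = pi / 4\<close>,
    so the enclosures of the angles yield that of \<open>pi\<close>.\<close>
  have "pi = 4 * (b0 + b2)" using ev(8) by (simp add: b0_def b2_def)
  hence pi: "3.141592653552 \<le> pi" "pi \<le> 3.141592653628" using E0(1,2) E2(1,2) by simp_all
  have pi2: "3.141592653552\<^sup>2 \<le> pi\<^sup>2" "pi\<^sup>2 \<le> 3.141592653628\<^sup>2"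
    using pi by (intro power_mono; simp)+
  have "0.0717258 * pi\<^sup>2 \<le> 4 * (I1 + I2)"
    using lo prod(1) sq(2,4) E0(3) E1(4) E2(3) E3(4) mono pi2(2) by (simp add: power2_eq_square)
  thus "0.0717258 \<le> p6_value" unfolding p6 by (simp add: field_simps)
  have "4 * (I1 + I2) < 0.0717259 * pi\<^sup>2"
    using up prod(2) sq(1,3) E0(4) E1(3) E2(4) E3(3) mono pi2(1) by (simp add: power2_eq_square)
  thus "p6_value < 0.0717259" unfolding p6 by (simp add: field_simps)
qed

theorem theorem2:
  shows "(\<forall>\<tau> d. salem_number \<tau> \<and> d = alg_degree \<tau> \<longrightarrow>
      (d = 4 \<longrightarrow> has_natural_density {n. coeff_inequality d (min_poly (\<tau> ^ n))} (1 / 3)) \<and>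
      (d = 6 \<longrightarrow> has_natural_density {n. coeff_inequality d (min_poly (\<tau> ^ n))} p6_value)) \<and>
    0.0717258 \<le> p6_value \<and> p6_value < 0.0717259"
proof (intro conjI allI impI p6_value_bounds)
  fix \<tau> d assume "salem_number \<tau> \<and> d = alg_degree \<tau>"
  hence \<tau>: "salem_number \<tau>" and d: "d = alg_degree \<tau>" by auto
  show "has_natural_density {n. coeff_inequality d (min_poly (\<tau> ^ n))} (1 / 3)" if "d = 4"
  proof -
    have deg: "alg_degree \<tau> = 4" using d that by simp
    obtain \<theta> r where \<theta>: "\<And>a. a > 0 \<Longrightarrow> cos (real a * \<theta>) \<noteq> 1"
      and r: "\<And>n. n > 0 \<Longrightarrow> coeff_inequality 4 (min_poly (\<tau> ^ n)) \<longleftrightarrow> r n < 0"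
      and lim: "(\<lambda>n. r n - (2 * \<bar>cos (real n * \<theta>)\<bar> - 1)) \<longlonglongrightarrow> 0"
      using coeff_inequality_salem_power_4[OF \<tau> deg] by blast
    obtain \<beta> where \<beta>: "\<And>a b. a > 0 \<or> b > 0 \<Longrightarrow> cos (real a * \<theta>) \<noteq> cos (real b * \<beta>)"
      using exists_independent_angle[of \<theta>] \<theta> by blast
    show ?thesis unfolding that
    \<comment> \<open>The function ignores the second coordinate, which belongs to the auxiliary
      angle \<open>\<beta>\<close>.\<close>
    proof (rule has_natural_density_of_equidistributed[OF \<beta>, where g = "\<lambda>x. 2 * \<bar>fst x\<bar> - 1"])
      show "continuous_on UNIV (\<lambda>x. 2 * \<bar>fst x\<bar> - 1 :: real)" by (intro continuous_intros)
      show "(\<lambda>n. r n - (2 * \<bar>fst (cos2 (real n * \<theta>, real n * \<beta>))\<bar> - 1)) \<longlonglongrightarrow> 0"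
        using lim by (simp add: cos2_def)
    qed (use r measure_angle2_cos_fst in auto)
  qed
  show "has_natural_density {n. coeff_inequality d (min_poly (\<tau> ^ n))} p6_value" if "d = 6"
  proof -
    have deg: "alg_degree \<tau> = 6" using d that by simp
    obtain \<alpha> \<beta> r where indep: "\<And>a b. a > 0 \<or> b > 0 \<Longrightarrow> cos (real a * \<alpha>) \<noteq> cos (real b * \<beta>)"
      and r: "\<And>n. n > 0 \<Longrightarrow> coeff_inequality 6 (min_poly (\<tau> ^ n)) \<longleftrightarrow> r n < 0"
      and lim: "(\<lambda>n. r n - (3 * \<bar>cos (real n * \<alpha>) + cos (real n * \<beta>)\<bar> +
        3 / 2 * \<bar>1 + 2 * cos (real n * \<alpha>) * cos (real n * \<beta>)\<bar> - 1)) \<longlonglongrightarrow> 0"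
      using coeff_inequality_salem_power_6[OF \<tau> deg] by blast
    show ?thesis unfolding that
    proof (rule has_natural_density_of_equidistributed[OF indep, where g = sextic_form])
      show "continuous_on UNIV sextic_form"
        unfolding sextic_form_def[abs_def] by (intro continuous_intros)
      show "(\<lambda>n. r n - sextic_form (cos2 (real n * \<alpha>, real n * \<beta>))) \<longlonglongrightarrow> 0"
        using lim by (simp add: cos2_def sextic_form_def)
    qed (use r measure_sextic_form in auto)
  qed
qed

end
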